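(* Let $m>n\ge2$, $p\in\{2m,2m+1\}$, $q\in\{2n,2n+1\}$, and let $k=n$ if $q=2n+1$, $k=n-1$ if $q=2n$. The stable range branching algebra $\mathcal{B}_{SO}$ for $(SO_p,SO_q)$ is isomorphic to the length $k$ branching algebra $\mathcal{B}_{p,k}^q$ for $(GL_p,GL_q)$.
   Context: Definition of $\mathcal{B}_{p,k}^q$. $GL_p\times GL_k$ acts on the space $\mathsf{M}_{p,k}$ of complex $p\times k$ matrices by $(g_1,g_2)\cdot Q=(g_1^t)^{-1}Qg_2^{-1}$, hence on $\mathbb{C}[\mathsf{M}_{p,k}]$. $U_r\subset GL_r$ is the group of upper triangular matrices with $1$'s on the diagonal, and $GL_q\subset GL_p$ via $X\mapsto\begin{bmatrix}X&0\\0&I\end{bmatrix}$. Then $\mathcal{B}_{p,k}^q=\mathbb{C}[\mathsf{M}_{p,k}]^{U_q\times U_k}$. Definition of $\mathcal{B}_{SO}$. $O_p\subset GL_p$ preserves the symmetric bilinear form on $\mathbb{C}^p$ whose matrix has $1$'s on the antidiagonal and $0$ elsewhere. For a Young diagram $F$ with $\ell(F)\le m$ rows, $\sigma_p^F$ denotes the irreducible representation of $O_p$ labeled by $F$ and $\rho_p^F$ the irreducible polynomial representation of $GL_p$ with highest weight $F$. With the analogous action of $GL_p\times GL_m$ on $\mathbb{C}[\mathsf{M}_{p,m}]$, $\mathbb{C}[\mathsf{M}_{p,m}]^{U_m}=\bigoplus_{\ell(F)\le m}\rho_p^F$ (the $F$-summand being the weight-$F$ space for the diagonal torus of $GL_m$).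 For each $F$ write $\rho_p^F=\sigma_p^F\oplus\mathcal{I}^F$ as $O_p$-modules ($\sigma_p^F$ occurs once, and $\mathcal{I}^F$ is the $O_p$-stable complement). $\mathcal{I}_O=\sum_F\mathcal{I}^F$ is an ideal, and $\mathcal{F}_{SO}=\mathbb{C}[\mathsf{M}_{p,m}]^{U_m}/\mathcal{I}_O$. Let $\langle2m\rangle=\{u_1<v_1<\cdots<u_m<v_m\}$ and $\langle2m+1\rangle=\{u_1<v_1<\cdots<u_m<v_m<\infty\}$. $\mathcal{L}_{SO}$ is the set of nonempty subsets of $\langle p\rangle$ with at most $k$ elements of the form $[u_1,\dots,u_c,y_1,\dots,y_s]$, $[u_1,\dots,u_c]$ or $[y_1,\dots,y_s]$, where $c\le n$ and $y_1<\cdots<y_s$ in $\langle p\rangle$ with $y_1\ge u_{n+1}$ if $q=2n$, $y_1\ge v_{n+1}$ if $q=2n+1$. Let $\psi_p(u_c)=c$, $\psi_p(v_c)=p+1-c$ for $1\le c\le m$, and $\psi_{2m+1}(\infty)=m+1$. For $I=[w_1,\dots,w_r]\subset\langle p\rangle$ with $w_1<\cdots<w_r$, $r\le m$, $\delta_{I'}(Q)$, $Q\in\mathsf{M}_{p,m}$, is the determinant of the $r\times r$ matrix whose $j$-th row consists of the first $r$ entries of row $\psi_p(w_j)$ of $Q$. $\mathcal{B}_{SO}$ is the subalgebra of $\mathcal{F}_{SO}$ generated by $\{\delta_{I'}+\mathcal{I}_O:I\in\mathcal{L}_{SO}\}$. *)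

theory Defs
  imports
    "HOL-Algebra.Algebra"
    "HOL-Algebra.Algebraic_Closure_Type"
    "Jordan_Normal_Form.Determinant"
begin

section \<open>Complex algebras\<close>

text \<open>Algebras over the complex numbers are module records over this ring.\<close>

abbreviation complex_ring :: "complex ring" where
  "complex_ring \<equiv> ring_of_type_algebra"

definition alg_isomorphic ::
  "(complex, 'a, 'c) module_scheme \<Rightarrow> (complex, 'b, 'd) module_scheme \<Rightarrow> bool" where
  "alg_isomorphic A B \<longleftrightarrow>
    (\<exists>h \<in> ring_iso A B. \<forall>c. \<forall>x \<in> carrier A. h (c \<odot>\<^bsub>A\<^esub> x) = c \<odot>\<^bsub>B\<^esub> h x)"

definition generated_subalg :: "(complex, 'a, 'c) module_scheme \<Rightarrow> 'a set \<Rightarrow> 'a set" where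
  "generated_subalg A G =
    (\<lambda>S. subring S A \<and> (\<forall>c. \<forall>x \<in> S. c \<odot>\<^bsub>A\<^esub> x \<in> S)) hull G"

definition quot_alg :: "(complex, 'a, 'c) module_scheme \<Rightarrow> 'a set \<Rightarrow> (complex, 'a set) module" where
  "quot_alg A I =
    \<lparr>carrier = carrier (A Quot I), monoid.mult = monoid.mult (A Quot I), one = one (A Quot I),
     ring.zero = ring.zero (A Quot I), add = add (A Quot I),
     module.smult = (\<lambda>c C. \<Union>f \<in> C. I +>\<^bsub>A\<^esub> (c \<odot>\<^bsub>A\<^esub> f))\<rparr>"


section \<open>Polynomial functions on matrices and the group actions\<close>

text \<open>The coordinate ring of the space of \<open>p\<close> by \<open>k\<close> matrices is taken to be the ring of
  polynomial functions (the field is infinite). Functions are \<^const>\<open>undefined\<close> outside the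
  matrix space, so that equality of functions is equality on matrices of the right size.
  Matrix indices start at 0.\<close>

inductive_set poly_funs :: "nat \<Rightarrow> nat \<Rightarrow> (complex mat \<Rightarrow> complex) set" for p k where
  const: "(\<lambda>Q \<in> carrier_mat p k. c) \<in> poly_funs p k"
| coord: "i < p \<Longrightarrow> j < k \<Longrightarrow> (\<lambda>Q \<in> carrier_mat p k. Q $$ (i, j)) \<in> poly_funs p k"
| add: "f \<in> poly_funs p k \<Longrightarrow> g \<in> poly_funs p k \<Longrightarrow>
    (\<lambda>Q \<in> carrier_mat p k. f Q + g Q) \<in> poly_funs p k"
| mult: "f \<in> poly_funs p k \<Longrightarrow> g \<in> poly_funs p k \<Longrightarrow>
    (\<lambda>Q \<in> carrier_mat p k. f Q * g Q) \<in> poly_funs p k"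

definition coord_alg :: "nat \<Rightarrow> nat \<Rightarrow> (complex, complex mat \<Rightarrow> complex) module" where
  "coord_alg p k =
    \<lparr>carrier = poly_funs p k,
     monoid.mult = (\<lambda>f g. \<lambda>Q \<in> carrier_mat p k. f Q * g Q),
     one = (\<lambda>Q \<in> carrier_mat p k. 1),
     ring.zero = (\<lambda>Q \<in> carrier_mat p k. 0),
     add = (\<lambda>f g. \<lambda>Q \<in> carrier_mat p k. f Q + g Q),
     module.smult = (\<lambda>c f. \<lambda>Q \<in> carrier_mat p k. c * f Q)\<rparr>"

text \<open>A pair \<open>g = (g1, g2)\<close> of invertible matrices sends \<open>f\<close> to the function
  \<open>Q \<mapsto> f (g\<^sup>-\<^sup>1 Q)\<close>. As \<open>g Q\<close> is the inverse transpose of \<open>g1\<close> times \<open>Q\<close> times the inverse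
  of \<open>g2\<close>, the matrix \<open>g\<^sup>-\<^sup>1 Q\<close> is the one in the definition.\<close>

definition act ::
  "nat \<Rightarrow> nat \<Rightarrow> complex mat \<Rightarrow> complex mat \<Rightarrow> (complex mat \<Rightarrow> complex) \<Rightarrow> (complex mat \<Rightarrow> complex)"
  where "act p k g1 g2 f = (\<lambda>Q \<in> carrier_mat p k. f (transpose_mat g1 * Q * g2))"

lemma act_translate:
  assumes "g1 \<in> carrier_mat p p" "h1 \<in> carrier_mat p p" "transpose_mat g1 * h1 = 1\<^sub>m p"
    and "g2 \<in> carrier_mat k k" "h2 \<in> carrier_mat k k" "h2 * g2 = 1\<^sub>m k"
    and "Q \<in> carrier_mat p k"
  shows "act p k g1 g2 f (h1 * Q * h2) = f Q"
proof -
  have t: "transpose_mat g1 \<in> carrier_mat p p" using assms by simp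
  have "transpose_mat g1 * (h1 * Q * h2) * g2 = transpose_mat g1 * (h1 * Q) * (h2 * g2)"
    using assms t by (simp add: assoc_mult_mat[of _ p p _ k _ k] assoc_mult_mat[of _ p k _ k _ k])
  also have "\<dots> = (transpose_mat g1 * h1) * Q"
    using assms by (simp add: assoc_mult_mat[OF t assms(2) assms(7), symmetric])
  finally show ?thesis using assms by (simp add: act_def)
qed

definition unip :: "nat \<Rightarrow> complex mat set" where
  "unip r = {g \<in> carrier_mat r r. upper_triangular g \<and> (\<forall>i<r. g $$ (i, i) = 1)}"

definition torus :: "nat \<Rightarrow> complex mat set" where
  "torus r = {t \<in> carrier_mat r r. diagonal_mat t \<and> (\<forall>i<r. t $$ (i, i) \<noteq> 0)}"

definition torus_char :: "nat \<Rightarrow> (nat \<Rightarrow> nat) \<Rightarrow> complex mat \<Rightarrow> complex" where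
  "torus_char r F t = (\<Prod>i<r. t $$ (i, i) ^ F i)"

definition GL_embed :: "nat \<Rightarrow> nat \<Rightarrow> complex mat \<Rightarrow> complex mat" where
  "GL_embed p q g = four_block_mat g (0\<^sub>m q (p - q)) (0\<^sub>m (p - q) q) (1\<^sub>m (p - q))"

definition B_GL :: "nat \<Rightarrow> nat \<Rightarrow> nat \<Rightarrow> (complex, complex mat \<Rightarrow> complex) module" where
  "B_GL p q k = (coord_alg p k)
    \<lparr>carrier := {f \<in> poly_funs p k.
       \<forall>g1 \<in> unip q. \<forall>g2 \<in> unip k. act p k (GL_embed p q g1) g2 f = f}\<rparr>"


section \<open>The flag algebra of the special orthogonal group\<close>

definition U_inv_alg :: "nat \<Rightarrow> nat \<Rightarrow> (complex, complex mat \<Rightarrow> complex) module" where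
  "U_inv_alg p m = (coord_alg p m)
    \<lparr>carrier := {f \<in> poly_funs p m. \<forall>g \<in> unip m. act p m (1\<^sub>m p) g f = f}\<rparr>"

text \<open>Young diagrams with at most \<open>m\<close> rows; \<open>F i\<close> is the length of row \<open>i + 1\<close>.\<close>

definition young :: "nat \<Rightarrow> (nat \<Rightarrow> nat) set" where
  "young m = {F. antimono F \<and> (\<forall>i\<ge>m. F i = 0)}"

definition rho :: "nat \<Rightarrow> nat \<Rightarrow> (nat \<Rightarrow> nat) \<Rightarrow> (complex mat \<Rightarrow> complex) set" where
  "rho p m F = {f \<in> carrier (U_inv_alg p m).
     \<forall>t \<in> torus m. act p m (1\<^sub>m p) t f = torus_char m F t \<odot>\<^bsub>U_inv_alg p m\<^esub> f}"

definition antidiag :: "nat \<Rightarrow> complex mat" where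
  "antidiag p = mat p p (\<lambda>(i, j). if i + j + 1 = p then 1 else 0)"

definition orth_group :: "nat \<Rightarrow> complex mat set" where
  "orth_group p = {g \<in> carrier_mat p p. transpose_mat g * antidiag p * g = antidiag p}"

definition O_submodule :: "nat \<Rightarrow> nat \<Rightarrow> (complex mat \<Rightarrow> complex) set \<Rightarrow> bool" where
  "O_submodule p m S \<longleftrightarrow> submodule S complex_ring (U_inv_alg p m) \<and>
     (\<forall>g \<in> orth_group p. \<forall>f \<in> S. act p m g (1\<^sub>m m) f \<in> S)"

definition O_irreducible :: "nat \<Rightarrow> nat \<Rightarrow> (complex mat \<Rightarrow> complex) set \<Rightarrow> bool" where
  "O_irreducible p m S \<longleftrightarrow> O_submodule p m S \<and> S \<noteq> {\<zero>\<^bsub>U_inv_alg p m\<^esub>} \<and>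
     (\<forall>T \<subseteq> S. O_submodule p m T \<longrightarrow> T = {\<zero>\<^bsub>U_inv_alg p m\<^esub>} \<or> T = S)"

definition GL_highest_weight ::
  "nat \<Rightarrow> nat \<Rightarrow> (nat \<Rightarrow> nat) \<Rightarrow> (complex mat \<Rightarrow> complex) \<Rightarrow> bool" where
  "GL_highest_weight p m F v \<longleftrightarrow> v \<noteq> \<zero>\<^bsub>U_inv_alg p m\<^esub> \<and>
     (\<forall>g \<in> unip p. act p m g (1\<^sub>m m) v = v) \<and>
     (\<forall>t \<in> torus p. act p m t (1\<^sub>m m) v = torus_char p F t \<odot>\<^bsub>U_inv_alg p m\<^esub> v)"

text \<open>The irreducible representation of \<open>O\<^sub>p\<close> labeled by \<open>F\<close>, realized inside
  \<^term>\<open>rho p m F\<close>. The label of a representation of the full orthogonal group follows the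
  standard convention: it is the irreducible \<open>O\<^sub>p\<close>-constituent of the \<open>GL\<^sub>p\<close>-module
  with highest weight \<open>F\<close> that contains a \<open>GL\<^sub>p\<close>-highest weight vector. It is unique because the
  highest weight space is one-dimensional; it exists by complete reducibility, since the
  weight \<open>F\<close> of the diagonal torus of \<open>SO\<^sub>p\<close> also has multiplicity one when \<open>2 * m \<le> p\<close>.\<close>

definition sigma :: "nat \<Rightarrow> nat \<Rightarrow> (nat \<Rightarrow> nat) \<Rightarrow> (complex mat \<Rightarrow> complex) set" where
  "sigma p m F = (THE S. O_irreducible p m S \<and> S \<subseteq> rho p m F \<and>
     (\<exists>v \<in> S. GL_highest_weight p m F v))"

text \<open>The \<open>O\<^sub>p\<close>-stable complement is unique because \<^term>\<open>sigma p m F\<close> occurs with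
  multiplicity one.\<close>

definition I_comp :: "nat \<Rightarrow> nat \<Rightarrow> (nat \<Rightarrow> nat) \<Rightarrow> (complex mat \<Rightarrow> complex) set" where
  "I_comp p m F = (THE I. O_submodule p m I \<and>
     sigma p m F \<inter> I = {\<zero>\<^bsub>U_inv_alg p m\<^esub>} \<and>
     sigma p m F <+>\<^bsub>U_inv_alg p m\<^esub> I = rho p m F)"

text \<open>A sum of subspaces is the additive group generated by their union.\<close>

definition I_O :: "nat \<Rightarrow> nat \<Rightarrow> (complex mat \<Rightarrow> complex) set" where
  "I_O p m = generate (add_monoid (U_inv_alg p m)) (\<Union>F \<in> young m. I_comp p m F)"

definition F_SO :: "nat \<Rightarrow> nat \<Rightarrow> (complex, (complex mat \<Rightarrow> complex) set) module" where
  "F_SO p m = quot_alg (U_inv_alg p m) (I_O p m)"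


section \<open>The branching algebra of the special orthogonal groups\<close>

text \<open>The chain \<open>u\<^sub>1 < v\<^sub>1 < \<dots> < u\<^sub>m < v\<^sub>m\<close>, with an additional top element if \<open>p = 2 * m + 1\<close>, is
  encoded by \<open>{1..p}\<close> with its usual order.\<close>

definition chain_u :: "nat \<Rightarrow> nat" where "chain_u c = 2 * c - 1"
definition chain_v :: "nat \<Rightarrow> nat" where "chain_v c = 2 * c"
definition chain_inf :: "nat \<Rightarrow> nat" where "chain_inf m = 2 * m + 1"

definition psi :: "nat \<Rightarrow> nat \<Rightarrow> nat" where
  "psi p w = (if even w then p + 1 - w div 2 else (w + 1) div 2)"

lemma psi_u: "1 \<le> c \<Longrightarrow> psi p (chain_u c) = c"
  by (auto simp: psi_def chain_u_def)

lemma psi_v: "psi p (chain_v c) = p + 1 - c"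
  by (simp add: psi_def chain_v_def)

lemma psi_inf: "psi (2 * m + 1) (chain_inf m) = m + 1"
  by (simp add: psi_def chain_inf_def)

definition L_SO :: "nat \<Rightarrow> nat \<Rightarrow> nat \<Rightarrow> nat \<Rightarrow> nat set set" where
  "L_SO p q n k = {I. I \<noteq> {} \<and> I \<subseteq> {1..p} \<and> card I \<le> k \<and>
     (\<exists>c Y. c \<le> n \<and> I = chain_u ` {1..c} \<union> Y \<and>
       (\<forall>y \<in> Y. (if q = 2 * n then chain_u (n + 1) else chain_v (n + 1)) \<le> y))}"

definition delta :: "nat \<Rightarrow> nat \<Rightarrow> nat set \<Rightarrow> complex mat \<Rightarrow> complex" where
  "delta p m I = (\<lambda>Q \<in> carrier_mat p m.
     det (mat (card I) (card I)
       (\<lambda>(j, l). Q $$ (psi p (sorted_list_of_set I ! j) - 1, l))))"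

definition B_SO :: "nat \<Rightarrow> nat \<Rightarrow> nat \<Rightarrow> nat \<Rightarrow> nat \<Rightarrow> (complex, (complex mat \<Rightarrow> complex) set) module"
  where "B_SO p m q n k = (F_SO p m)
    \<lparr>carrier := generated_subalg (F_SO p m)
      ((\<lambda>I. I_O p m +>\<^bsub>U_inv_alg p m\<^esub> delta p m I) ` L_SO p q n k)\<rparr>"

end

theory Submission
  imports Defs
begin

text \<open>Restrict polynomial functions to the matrices \<open>g E t\<close>, where \<open>g\<close> is orthogonal, \<open>E\<close> has the unit
  matrix on top of zero rows, and \<open>t\<close> is diagonal and invertible. In each weight \<open>F\<close> the functions vanishing there
  form an \<open>O\<^sub>p\<close>-stable complement of the module generated by the highest weight vector; this complement is
  \<open>\<I>\<^sup>F\<close>, so the elements of \<open>\<I>\<^sub>O\<close> vanish at all these matrices. On the other hand, the branching algebra of the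
  general linear groups is spanned by products of minors, and moving the rows by \<open>\<psi>\<^sub>p\<close> turns the minors
  into the generators of \<open>\<B>\<^sub>S\<^sub>O\<close>. The resulting map to the quotient is injective: orthogonal matrices that are
  exponentials of nilpotent ones already make the moved rows arbitrary, so a function in the kernel vanishes on a
  dense set.\<close>

section \<open>Polynomial functions of infinite arrays\<close>

text \<open>\<open>sigma\<close> and \<open>I_comp\<close> are definite descriptions, so existence
  and uniqueness have to be produced by hand. Existence rests on the Cauchy-Binet formula and on the
  stability of the orthogonal group under complex conjugation: they make the two modules orthogonal
  complements in a finite coordinate space of products of minors. Uniqueness rests on a
  one-parameter torus of the orthogonal group, which extracts the highest weight vector from any
  function that does not vanish on the orbit. That minors span is proved by adding one row at a
  time. The new row is set to the powers \<open>s ^ N ^ j\<close>, whose exponents recover every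
  monomial in it; the top coefficient in \<open>s\<close> is again an invariant, and its weight
  interlaces with the old one. Interlacing is exactly the condition under which the minors of the
  smaller array can be extended by the new row. The bound \<open>k \<le> n\<close> enters through
  isotropy: the first \<open>k\<close> columns of an orthogonal matrix can be the unit matrix in the
  first \<open>n\<close> rows and arbitrary in the middle rows, because the last \<open>k\<close>
  rows leave room for the correction.\<close>

definition monomial_fun :: "nat \<Rightarrow> nat \<Rightarrow> (nat \<Rightarrow> nat \<Rightarrow> nat) \<Rightarrow> (nat \<Rightarrow> nat \<Rightarrow> complex) \<Rightarrow> complex" where
  "monomial_fun p k e x = (\<Prod>i<p. \<Prod>j<k. x i j ^ e i j)"

definition peval :: "nat \<Rightarrow> nat \<Rightarrow> (complex \<times> (nat \<Rightarrow> nat \<Rightarrow> nat)) list \<Rightarrow> (nat \<Rightarrow> nat \<Rightarrow> complex) \<Rightarrow> complex" where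
  "peval p k xs x = (\<Sum>(c, e)\<leftarrow>xs. c * monomial_fun p k e x)"

text \<open>Arrays are infinite so that the number of rows can grow without a change of type; only
  the entries with \<open>i < p\<close> and \<open>j < k\<close> are read. The list keeps the single
  terms accessible and need not be reduced: exponents may repeat.\<close>

definition polyfn :: "nat \<Rightarrow> nat \<Rightarrow> ((nat \<Rightarrow> nat \<Rightarrow> complex) \<Rightarrow> complex) \<Rightarrow> bool" where
  "polyfn p k F \<longleftrightarrow> (\<exists>xs. F = peval p k xs)"

lemma monomial_fun_add:
  "monomial_fun p k (\<lambda>i j. e i j + f i j) x = monomial_fun p k e x * monomial_fun p k f x"
  by (simp add: monomial_fun_def power_add prod.distrib)

lemma monomial_fun_coord:
  assumes "i < p" "j < k"
  shows "monomial_fun p k (\<lambda>i' j'. if i' = i \<and> j' = j then 1 else 0) x = x i j"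
proof -
  have "(\<Prod>j'<k. x i' j' ^ (if i' = i \<and> j' = j then 1 else 0)) = (if i' = i then x i j else 1)" for i'
  proof (cases "i' = i")
    case True
    have "(\<Prod>j'<k. x i' j' ^ (if i' = i \<and> j' = j then 1 else 0)) = (\<Prod>j'<k. if j' = j then x i j' else 1)"
      by (rule prod.cong) (auto simp: True)
    then show ?thesis using assms True by simp
  qed simp
  then show ?thesis using assms by (simp add: monomial_fun_def)
qed

lemma polyfn_const: "polyfn p k (\<lambda>x. c)"
  unfolding polyfn_def
  by (rule exI[of _ "[(c, \<lambda>i j. 0)]"]) (auto simp: peval_def monomial_fun_def)

lemma polyfn_coord: "i < p \<Longrightarrow> j < k \<Longrightarrow> polyfn p k (\<lambda>x. x i j)"
  unfolding polyfn_def
  by (rule exI[of _ "[(1, \<lambda>i' j'. if i' = i \<and> j' = j then 1 else 0)]"])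
    (use monomial_fun_coord[of i p j k] in \<open>auto simp: peval_def\<close>)

lemma polyfn_add: "polyfn p k F \<Longrightarrow> polyfn p k G \<Longrightarrow> polyfn p k (\<lambda>x. F x + G x)"
proof -
  assume "polyfn p k F" "polyfn p k G"
  then obtain xs ys where "F = peval p k xs" "G = peval p k ys" unfolding polyfn_def by auto
  then have "(\<lambda>x. F x + G x) = peval p k (xs @ ys)" by (auto simp: peval_def)
  then show ?thesis unfolding polyfn_def by blast
qed

lemma polyfn_mult:
  assumes "polyfn p k F" "polyfn p k G" shows "polyfn p k (\<lambda>x. F x * G x)"
proof -
  obtain xs ys where xy: "F = peval p k xs" "G = peval p k ys"
    using assms unfolding polyfn_def by auto
  define zs where "zs = concat (map (\<lambda>(c, e). map (\<lambda>(d, f). (c * d, \<lambda>i j. e i j + f i j)) ys) xs)"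
  have one: "peval p k (map (\<lambda>(d, f). (c * d, \<lambda>i j. e i j + f i j)) ys) x
      = c * monomial_fun p k e x * peval p k ys x" for c e x
    by (induction ys) (auto simp: peval_def monomial_fun_add algebra_simps)
  have "peval p k zs x = peval p k xs x * peval p k ys x" for x
    unfolding zs_def
  proof (induction xs)
    case (Cons a xs)
    obtain c e where "a = (c, e)" by force
    with Cons one[of c e x] show ?case by (simp add: peval_def algebra_simps)
  qed (simp add: peval_def)
  then have "(\<lambda>x. F x * G x) = peval p k zs" using xy by auto
  then show ?thesis unfolding polyfn_def by blast
qed

lemma polyfn_minus: "polyfn p k F \<Longrightarrow> polyfn p k (\<lambda>x. - F x)"
  using polyfn_mult[OF polyfn_const[of p k "-1"], of F] by simp

lemma polyfn_diff: "polyfn p k F \<Longrightarrow> polyfn p k G \<Longrightarrow> polyfn p k (\<lambda>x. F x - G x)"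
  using polyfn_add[OF _ polyfn_minus, of p k F G] by simp

lemma polyfn_sum: "(\<And>a. a \<in> A \<Longrightarrow> polyfn p k (F a)) \<Longrightarrow> polyfn p k (\<lambda>x. \<Sum>a\<in>A. F a x)"
  by (induction A rule: infinite_finite_induct) (simp_all add: polyfn_const polyfn_add)

lemma polyfn_prod: "(\<And>a. a \<in> A \<Longrightarrow> polyfn p k (F a)) \<Longrightarrow> polyfn p k (\<lambda>x. \<Prod>a\<in>A. F a x)"
  by (induction A rule: infinite_finite_induct) (simp_all add: polyfn_const polyfn_mult)

lemma polyfn_power: "polyfn p k F \<Longrightarrow> polyfn p k (\<lambda>x. F x ^ n)"
  by (induction n) (simp_all add: polyfn_const polyfn_mult)

lemma polyfn_sum_list: "(\<And>a. a \<in> set as \<Longrightarrow> polyfn p k (F a)) \<Longrightarrow> polyfn p k (\<lambda>x. \<Sum>a\<leftarrow>as. F a x)"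
  by (induction as) (simp_all add: polyfn_const polyfn_add)

lemma polyfn_prod_list: "(\<And>a. a \<in> set as \<Longrightarrow> polyfn p k (F a)) \<Longrightarrow> polyfn p k (\<lambda>x. \<Prod>a\<leftarrow>as. F a x)"
  by (induction as) (simp_all add: polyfn_const polyfn_mult)

text \<open>Induction along the construction of a polynomial, with a substitution \<open>Y\<close>.
  Through \<open>polyfn_closed\<close> it serves polynomial functions, polynomials in one variable
  and membership in \<open>poly_funs\<close>.\<close>

lemma peval_closed:
  assumes const: "\<And>c. P (\<lambda>x. c)"
    and coord: "\<And>i j. i < p \<Longrightarrow> j < k \<Longrightarrow> P (\<lambda>x. Y x i j)"
    and add: "\<And>F G. P F \<Longrightarrow> P G \<Longrightarrow> P (\<lambda>x. F x + G x)"
    and mult: "\<And>F G. P F \<Longrightarrow> P G \<Longrightarrow> P (\<lambda>x. F x * G x)"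
  shows "P (\<lambda>x. peval p k xs (Y x))"
proof -
  have pow: "P F \<Longrightarrow> P (\<lambda>x. F x ^ n)" for F n by (induction n) (simp_all add: const mult)
  have prod: "(\<And>a. a \<in> A \<Longrightarrow> P (F a)) \<Longrightarrow> P (\<lambda>x. \<Prod>a\<in>A. F a x)" if "finite A" for A :: "nat set" and F
    using that by (induction A) (simp_all add: const mult)
  have mon: "P (\<lambda>x. monomial_fun p k e (Y x))" for e
    unfolding monomial_fun_def by (intro prod pow coord) auto
  show ?thesis
  proof (induction xs)
    case (Cons a xs)
    obtain c e where "a = (c, e)" by force
    then show ?case using add[OF mult[OF const[of c] mon[of e]] Cons] by (simp add: peval_def)
  qed (simp add: peval_def const)
qed

lemma polyfn_closed:
  assumes F: "polyfn p k F"
    and "\<And>c. P (\<lambda>x. c)"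
    and "\<And>i j. i < p \<Longrightarrow> j < k \<Longrightarrow> P (\<lambda>x. Y x i j)"
    and "\<And>F G. P F \<Longrightarrow> P G \<Longrightarrow> P (\<lambda>x. F x + G x)"
    and "\<And>F G. P F \<Longrightarrow> P G \<Longrightarrow> P (\<lambda>x. F x * G x)"
  shows "P (\<lambda>x. F (Y x))"
proof -
  obtain xs where eq: "F = peval p k xs" using F unfolding polyfn_def by auto
  show ?thesis unfolding eq using assms(2-5) by (rule peval_closed[of P])
qed

lemma polyfn_compose:
  assumes "polyfn p k F" "\<And>i j. i < p \<Longrightarrow> j < k \<Longrightarrow> polyfn p' k' (\<lambda>x. Y x i j)"
  shows "polyfn p' k' (\<lambda>x. F (Y x))"
  using assms(1) polyfn_const assms(2) polyfn_add polyfn_mult by (rule polyfn_closed[of p k F "polyfn p' k'" Y])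

lemma polyfn_cong:
  assumes "polyfn p k F" "\<And>i j. i < p \<Longrightarrow> j < k \<Longrightarrow> x i j = y i j"
  shows "F x = F y"
proof -
  obtain xs where "F = peval p k xs" using assms(1) unfolding polyfn_def by auto
  moreover have "monomial_fun p k e x = monomial_fun p k e y" for e
    unfolding monomial_fun_def by (intro prod.cong) (auto simp: assms)
  ultimately show ?thesis by (simp add: peval_def)
qed

lemma polyfn_mono:
  assumes "polyfn p k F" "p \<le> p'" "k \<le> k'" shows "polyfn p' k' F"
  by (rule polyfn_compose[of p k F p' k' "\<lambda>x. x"]) (use assms in \<open>auto intro!: polyfn_coord\<close>)

section \<open>Polynomials in one variable and base expansions\<close>

text \<open>Density arguments run along lines and curves: on a polynomial curve a polynomial
  function is of this kind, hence determined outside any finite set of parameters.\<close>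

definition upoly :: "(complex \<Rightarrow> complex) \<Rightarrow> bool" where
  "upoly h \<longleftrightarrow> (\<exists>P. \<forall>t. h t = poly P t)"

lemma upoly_const: "upoly (\<lambda>t. c)"
  unfolding upoly_def by (rule exI[of _ "[:c:]"]) auto

lemma upoly_id: "upoly (\<lambda>t. t)"
  unfolding upoly_def by (rule exI[of _ "[:0, 1:]"]) auto

lemma upoly_add: "upoly f \<Longrightarrow> upoly g \<Longrightarrow> upoly (\<lambda>t. f t + g t)"
  unfolding upoly_def by (auto simp flip: poly_add)

lemma upoly_mult: "upoly f \<Longrightarrow> upoly g \<Longrightarrow> upoly (\<lambda>t. f t * g t)"
  unfolding upoly_def by (auto simp flip: poly_mult)

lemma upoly_diff: "upoly f \<Longrightarrow> upoly g \<Longrightarrow> upoly (\<lambda>t. f t - g t)"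
  unfolding upoly_def by (auto simp flip: poly_diff)

lemma upoly_power: "upoly f \<Longrightarrow> upoly (\<lambda>t. f t ^ n)"
  unfolding upoly_def by (auto simp flip: poly_power)

lemma upoly_if: "(b \<Longrightarrow> upoly f) \<Longrightarrow> (\<not> b \<Longrightarrow> upoly g) \<Longrightarrow> upoly (\<lambda>t. if b then f t else g t)"
  by (cases b) simp_all

lemma upoly_polyfn:
  assumes "polyfn p k F" "\<And>i j. i < p \<Longrightarrow> j < k \<Longrightarrow> upoly (\<lambda>t. Y t i j)"
  shows "upoly (\<lambda>t. F (Y t))"
  using assms(1) upoly_const assms(2) upoly_add upoly_mult by (rule polyfn_closed[of p k F upoly Y])

lemma poly_eq_cofinite:
  fixes P Q :: "complex poly"
  assumes "finite T" "\<And>t. t \<notin> T \<Longrightarrow> poly P t = poly Q t"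
  shows "P = Q"
proof (rule ccontr)
  assume "P \<noteq> Q"
  then have "finite {t. poly (P - Q) t = 0}" by (intro poly_roots_finite) simp
  moreover have "UNIV \<subseteq> T \<union> {t. poly (P - Q) t = 0}" using assms(2) by auto
  ultimately have "finite (UNIV :: complex set)" using assms(1) by (meson finite_Un finite_subset)
  then show False using infinite_UNIV_char_0 by blast
qed

lemma upoly_eq_cofinite:
  assumes "upoly f" "upoly g" "finite T" "\<And>t. t \<notin> T \<Longrightarrow> f t = g t"
  shows "f t = g t"
proof -
  obtain P Q where "\<forall>t. f t = poly P t" "\<forall>t. g t = poly Q t" using assms(1,2) unfolding upoly_def by auto
  with poly_eq_cofinite[of T P Q] assms(3,4) show ?thesis by simp
qed

lemma upoly_finite_zeros:
  assumes "upoly f" "f s \<noteq> 0" shows "finite {t. f t = 0}"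
proof -
  obtain P where P: "f = poly P" using assms(1) unfolding upoly_def by auto
  then have "P \<noteq> 0" using assms(2) by auto
  then show ?thesis using P poly_roots_finite by auto
qed

text \<open>Both sides are polynomials in \<open>s\<close> that agree off \<open>0\<close>, so their
  coefficients agree. This isolates the terms of one degree when the terms of a sum scale by
  different powers.\<close>

lemma power_sum_coeff:
  fixes a :: "'a \<Rightarrow> complex" and b :: "'b \<Rightarrow> complex"
  assumes "\<And>s. s \<noteq> 0 \<Longrightarrow> (\<Sum>y\<leftarrow>ys. a y * s ^ d y) = (\<Sum>z\<leftarrow>zs. b z * s ^ d' z)"
  shows "(\<Sum>y\<leftarrow>ys. if d y = D then a y else 0) = (\<Sum>z\<leftarrow>zs. if d' z = D then b z else 0)"
proof -
  define P where "P = (\<Sum>y\<leftarrow>ys. Polynomial.monom (a y) (d y))"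
  define Q where "Q = (\<Sum>z\<leftarrow>zs. Polynomial.monom (b z) (d' z))"
  have P: "poly P s = (\<Sum>y\<leftarrow>ys. a y * s ^ d y)" for s
    unfolding P_def by (induction ys) (auto simp: poly_monom)
  have Q: "poly Q s = (\<Sum>y\<leftarrow>zs. b y * s ^ d' y)" for s
    unfolding Q_def by (induction zs) (auto simp: poly_monom)
  have "P = Q" by (rule poly_eq_cofinite[of "{0}"]) (auto simp: P Q assms)
  moreover have "Polynomial.coeff P D = (\<Sum>y\<leftarrow>ys. if d y = D then a y else 0)"
    unfolding P_def by (induction ys) auto
  moreover have "Polynomial.coeff Q D = (\<Sum>z\<leftarrow>zs. if d' z = D then b z else 0)"
    unfolding Q_def by (induction zs) auto
  ultimately show ?thesis by simp
qed

lemma digits_less: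
  fixes b :: "nat \<Rightarrow> nat"
  assumes "\<And>j. j < k \<Longrightarrow> b j < N"
  shows "(\<Sum>j<k. b j * N ^ j) < N ^ k"
  using assms
proof (induction k)
  case (Suc k)
  then have "(\<Sum>j<k. b j * N ^ j) < N ^ k" "b k + 1 \<le> N" by (auto simp: Suc_leI)
  then have "(\<Sum>j<Suc k. b j * N ^ j) < N ^ k + b k * N ^ k" "(b k + 1) * N ^ k \<le> N * N ^ k"
    using mult_le_mono1 by (auto simp del: mult_Suc)
  then show ?case by (simp add: algebra_simps)
qed simp

text \<open>Uniqueness of base \<open>N\<close> expansions. It lets a single parameter, with column
  \<open>j\<close> scaled by \<open>s ^ N ^ j\<close>, separate all exponent vectors with entries
  below \<open>N\<close> (Kronecker substitution).\<close>

lemma digits_inj: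
  fixes b b' :: "nat \<Rightarrow> nat"
  assumes "\<And>j. j < k \<Longrightarrow> b j < N" "\<And>j. j < k \<Longrightarrow> b' j < N"
    and "(\<Sum>j<k. b j * N ^ j) = (\<Sum>j<k. b' j * N ^ j)" and "j < k"
  shows "b j = b' j"
  using assms
proof (induction k arbitrary: j)
  case (Suc k)
  have l: "(\<Sum>j<k. b j * N ^ j) < N ^ k" "(\<Sum>j<k. b' j * N ^ j) < N ^ k"
    using Suc.prems by (auto intro!: digits_less)
  have N: "N ^ k > 0" using l by linarith
  have "((\<Sum>j<k. b j * N ^ j) + b k * N ^ k) div N ^ k = b k"
    "((\<Sum>j<k. b' j * N ^ j) + b' k * N ^ k) div N ^ k = b' k"
    using l N by simp_all
  then have k: "b k = b' k" using Suc.prems(3) by simp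
  then have "(\<Sum>j<k. b j * N ^ j) = (\<Sum>j<k. b' j * N ^ j)" using Suc.prems(3) by simp
  then have "b i = b' i" if "i < k" for i
    using Suc.IH[OF _ _ _ that] Suc.prems(1,2) less_SucI by blast
  with k show ?case using Suc.prems(4) less_Suc_eq by blast
qed simp

section \<open>Minors and elementary operations\<close>

text \<open>\<open>colop\<close> and \<open>rowop\<close> are the actions of the elementary
  unipotent matrices by right multiplication and by left multiplication with the transpose: for
  upper triangular matrices an earlier column or row is added to a later one.\<close>

definition colop :: "nat \<Rightarrow> nat \<Rightarrow> complex \<Rightarrow> (nat \<Rightarrow> nat \<Rightarrow> complex) \<Rightarrow> nat \<Rightarrow> nat \<Rightarrow> complex" where
  "colop c c' s x = (\<lambda>i j. if j = c' then x i j + s * x i c else x i j)"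

definition rowop :: "nat \<Rightarrow> nat \<Rightarrow> complex \<Rightarrow> (nat \<Rightarrow> nat \<Rightarrow> complex) \<Rightarrow> nat \<Rightarrow> nat \<Rightarrow> complex" where
  "rowop c c' s x = (\<lambda>i j. if i = c' then x i j + s * x c j else x i j)"

definition col_inv :: "nat \<Rightarrow> ((nat \<Rightarrow> nat \<Rightarrow> complex) \<Rightarrow> complex) \<Rightarrow> bool" where
  "col_inv k F \<longleftrightarrow> (\<forall>c c' s x. c < c' \<longrightarrow> c' < k \<longrightarrow> F (colop c c' s x) = F x)"

definition row_inv :: "nat \<Rightarrow> ((nat \<Rightarrow> nat \<Rightarrow> complex) \<Rightarrow> complex) \<Rightarrow> bool" where
  "row_inv q F \<longleftrightarrow> (\<forall>c c' s x. c < c' \<longrightarrow> c' < q \<longrightarrow> F (rowop c c' s x) = F x)"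

definition col_weight :: "nat \<Rightarrow> (nat \<Rightarrow> nat) \<Rightarrow> ((nat \<Rightarrow> nat \<Rightarrow> complex) \<Rightarrow> complex) \<Rightarrow> bool" where
  "col_weight k wt F \<longleftrightarrow> (\<forall>t x. (\<forall>j<k. t j \<noteq> 0) \<longrightarrow>
     F (\<lambda>i j. x i j * t j) = (\<Prod>j<k. t j ^ wt j) * F x)"

text \<open>The columns are always the first \<open>length R\<close> ones, which makes the minor
  invariant under adding earlier columns to later ones. The row list may be unordered or have
  repetitions, as in the Cauchy-Binet sum below.\<close>

definition minor :: "nat list \<Rightarrow> (nat \<Rightarrow> nat \<Rightarrow> complex) \<Rightarrow> complex" where
  "minor R x = det (mat (length R) (length R) (\<lambda>(j, l). x (R ! j) l))"

definition mprod :: "nat list list \<Rightarrow> (nat \<Rightarrow> nat \<Rightarrow> complex) \<Rightarrow> complex" where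
  "mprod Rs x = (\<Prod>R\<leftarrow>Rs. minor R x)"

lemma mprod_simps [simp]:
  "mprod [] x = 1" "mprod (R # Rs) x = minor R x * mprod Rs x"
  "mprod (Rs @ Ss) x = mprod Rs x * mprod Ss x"
  by (simp_all add: mprod_def)

lemma minor_Nil [simp]: "minor [] x = 1"
  by (simp add: minor_def)

lemma minor_expand:
  "minor R x = (\<Sum>\<pi> | \<pi> permutes {0..<length R}. signof \<pi> * (\<Prod>i = 0..<length R. x (R ! i) (\<pi> i)))"
  unfolding minor_def
  by (subst det_def') (auto intro!: sum.cong prod.cong)

lemma minor_cong:
  assumes "\<And>i j. i \<in> set R \<Longrightarrow> j < length R \<Longrightarrow> x i j = y i j"
  shows "minor R x = minor R y"
  unfolding minor_def using assms by (intro arg_cong[of _ _ det] eq_matI) auto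

lemma mprod_cong:
  assumes "\<And>R i j. R \<in> set Rs \<Longrightarrow> i \<in> set R \<Longrightarrow> j < length R \<Longrightarrow> x i j = y i j"
  shows "mprod Rs x = mprod Rs y"
  unfolding mprod_def using assms by (intro arg_cong[of _ _ prod_list] map_cong refl minor_cong) auto

lemma polyfn_minor:
  assumes "set R \<subseteq> {..<p}" "length R \<le> k" shows "polyfn p k (minor R)"
proof -
  have "polyfn p k (\<lambda>x. \<Sum>\<pi> | \<pi> permutes {0..<length R}.
      signof \<pi> * (\<Prod>i = 0..<length R. x (R ! i) (\<pi> i)))"
  proof (rule polyfn_sum, rule polyfn_mult[OF polyfn_const], rule polyfn_prod, rule polyfn_coord)
    fix \<pi> i assume pi: "\<pi> \<in> {\<pi>. \<pi> permutes {0..<length R}}" "i \<in> {0..<length R}"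
    then have "\<pi> i < length R" using permutes_in_image[of \<pi> "{0..<length R}" i] by simp
    then show "\<pi> i < k" using assms by simp
    have "R ! i \<in> set R" using pi(2) by simp
    then show "R ! i < p" using assms(1) by blast
  qed
  then show ?thesis unfolding minor_expand[abs_def] .
qed

lemma polyfn_mprod:
  assumes "\<And>R. R \<in> set Rs \<Longrightarrow> set R \<subseteq> {..<p} \<and> length R \<le> k"
  shows "polyfn p k (mprod Rs)"
  unfolding mprod_def[abs_def] using assms by (intro polyfn_prod_list polyfn_minor) auto

text \<open>If \<open>c'\<close> is among the first \<open>length R\<close> columns, then so is
  \<open>c\<close>, and a multiple of one column of the determinant is added to another; otherwise
  the changed column is not read.\<close>

lemma minor_colop:
  assumes "c < c'" shows "minor R (colop c c' s x) = minor R x"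
proof (cases "c' < length R")
  case True
  have "mat (length R) (length R) (\<lambda>(j, l). colop c c' s x (R ! j) l) =
      addcol s c' c (mat (length R) (length R) (\<lambda>(j, l). x (R ! j) l))"
    using True assms by (intro eq_matI) (auto simp: colop_def mat_addcol_def)
  then show ?thesis unfolding minor_def
    by simp (rule det_addcol[of _ "length R"], use True assms in auto)
next
  case False
  then show ?thesis by (intro minor_cong) (auto simp: colop_def)
qed

lemma col_inv_mprod: "col_inv k (mprod Rs)"
  by (simp add: col_inv_def mprod_def minor_colop)

text \<open>The rows below \<open>q\<close> form an initial segment, which makes the minor invariant
  under \<open>unip q\<close>; the rows from \<open>q\<close> on are chosen freely.\<close>

definition good_row :: "nat \<Rightarrow> nat \<Rightarrow> nat list \<Rightarrow> bool" where
  "good_row q p R \<longleftrightarrow> (\<exists>c Y. R = [0..<c] @ Y \<and> c \<le> q \<and> sorted_wrt (<) Y \<and> set Y \<subseteq> {q..<p})"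

lemma good_row_set: "good_row q p R \<Longrightarrow> q \<le> p \<Longrightarrow> set R \<subseteq> {..<p}"
  unfolding good_row_def by fastforce

lemma good_row_Nil: "good_row q p []"
  unfolding good_row_def by (intro exI[of _ 0] exI[of _ "[]"]) auto

lemma good_row_upt: "c \<le> q \<Longrightarrow> good_row q p [0..<c]"
  unfolding good_row_def by (intro exI[of _ c] exI[of _ "[]"]) auto

lemma good_row_Suc: "good_row q p R \<Longrightarrow> good_row q (Suc p) R"
  unfolding good_row_def by fastforce

lemma good_row_snoc:
  assumes "good_row q p R" "q \<le> p" shows "good_row q (Suc p) (R @ [p])"
proof -
  obtain c Y where "R = [0..<c] @ Y" "c \<le> q" "sorted_wrt (<) Y" "set Y \<subseteq> {q..<p}"
    using assms(1) unfolding good_row_def by auto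
  then show ?thesis using assms(2) unfolding good_row_def
    by (intro exI[of _ c] exI[of _ "Y @ [p]"]) (auto simp: sorted_wrt_append)
qed

lemma good_row_distinct: "good_row q p R \<Longrightarrow> distinct R"
proof -
  assume "good_row q p R"
  then obtain c Y where R: "R = [0..<c] @ Y" "c \<le> q" "sorted_wrt (<) Y" "set Y \<subseteq> {q..<p}"
    unfolding good_row_def by auto
  from R(3) have "distinct Y" by (induction Y) auto
  with R show ?thesis by fastforce
qed

text \<open>An initial segment that contains \<open>c'\<close> also contains \<open>c\<close>, so
  one row of the minor is added to another.\<close>

lemma minor_rowop:
  assumes "good_row q p R" "c < c'" "c' < q" shows "minor R (rowop c c' s x) = minor R x"
proof (cases "c' \<in> set R")
  case True
  obtain d Y where R: "R = [0..<d] @ Y" "d \<le> q" "set Y \<subseteq> {q..<p}"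
    using assms(1) unfolding good_row_def by auto
  with True assms(3) have c': "c' < d" by fastforce
  have dist: "distinct R" by (rule good_row_distinct[OF assms(1)])
  have nth: "R ! c' = c'" "R ! c = c" "c' < length R" using c' assms R by (auto simp: nth_append)
  have eq: "R ! i = c' \<longleftrightarrow> i = c'" if "i < length R" for i
    using nth_eq_iff_index_eq[OF dist that nth(3)] nth(1) by simp
  have "mat (length R) (length R) (\<lambda>(j, l). rowop c c' s x (R ! j) l) =
      addrow s c' c (mat (length R) (length R) (\<lambda>(j, l). x (R ! j) l))"
    using nth assms(2) by (intro eq_matI) (auto simp: rowop_def eq)
  then show ?thesis unfolding minor_def
    by simp (rule det_addrow[of _ "length R"], use nth assms in auto)
next
  case False
  then show ?thesis by (intro minor_cong) (auto simp: rowop_def)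
qed

lemma row_inv_mprod:
  assumes "\<And>R. R \<in> set Rs \<Longrightarrow> good_row q p R" shows "row_inv q (mprod Rs)"
  unfolding row_inv_def mprod_def
  by (intro allI impI arg_cong[of _ _ prod_list] map_cong refl minor_rowop[OF assms])

lemma minor_col_scale: "minor R (\<lambda>i j. x i j * t j) = (\<Prod>j<length R. t j) * minor R x"
proof -
  have "(\<Prod>i = 0..<length R. x (R ! i) (\<pi> i) * t (\<pi> i)) =
      (\<Prod>j<length R. t j) * (\<Prod>i = 0..<length R. x (R ! i) (\<pi> i))"
    if "\<pi> permutes {0..<length R}" for \<pi>
    using prod.permute[OF that, of t] by (simp add: prod.distrib comp_def atLeast0LessThan)
  then show ?thesis unfolding minor_expand by (simp add: sum_distrib_left mult.left_commute)
qed

lemma minor_row_scale: "minor R (\<lambda>i j. t i * x i j) = (\<Prod>i\<leftarrow>R. t i) * minor R x"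
proof -
  have "(\<Prod>i = 0..<length R. t (R ! i) * x (R ! i) (\<pi> i)) =
      (\<Prod>i\<leftarrow>R. t i) * (\<Prod>i = 0..<length R. x (R ! i) (\<pi> i))" for \<pi>
    by (simp add: prod.distrib prod.list_conv_set_nth)
  then show ?thesis unfolding minor_expand by (simp add: sum_distrib_left mult.left_commute)
qed

text \<open>The number of minors that read column \<open>j\<close>. It is the column weight of
  \<open>mprod Rs\<close>, and a row length of the diagram whose columns have the lengths of the
  lists in \<open>Rs\<close>.\<close>

definition rlen :: "nat list list \<Rightarrow> nat \<Rightarrow> nat" where
  "rlen Rs j = length (filter (\<lambda>R. j < length R) Rs)"

lemma rlen_simps [simp]:
  "rlen [] j = 0" "rlen (R # Rs) j = (if j < length R then 1 else 0) + rlen Rs j"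
  "rlen (Rs @ Ss) j = rlen Rs j + rlen Ss j"
  by (simp_all add: rlen_def)

lemma mprod_col_scale:
  assumes "\<And>R. R \<in> set Rs \<Longrightarrow> length R \<le> k"
  shows "mprod Rs (\<lambda>i j. x i j * t j) = (\<Prod>j<k. t j ^ rlen Rs j) * mprod Rs x"
  using assms
proof (induction Rs)
  case (Cons R Rs)
  have "(\<Prod>j<k. t j ^ (if j < length R then 1 else 0)) = (\<Prod>j<length R. t j)"
    by (rule prod.mono_neutral_cong_right) (use Cons.prems[of R] in auto)
  with Cons show ?case by (simp add: minor_col_scale power_add prod.distrib)
qed simp

lemma col_weight_mprod:
  assumes "\<And>R. R \<in> set Rs \<Longrightarrow> length R \<le> k" "\<And>j. j < k \<Longrightarrow> rlen Rs j = wt j"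
  shows "col_weight k wt (mprod Rs)"
  unfolding col_weight_def using mprod_col_scale[of Rs k] assms by simp

lemma minor_lower_triangular:
  assumes "\<And>i j. i < j \<Longrightarrow> j < n \<Longrightarrow> x i j = 0"
  shows "minor [0..<n] x = (\<Prod>i<n. x i i)"
proof -
  have "minor [0..<n] x = prod_list (diag_mat (mat n n (\<lambda>(j, l). x j l)))"
    unfolding minor_def using assms
    by (subst det_lower_triangular[symmetric, where n = n]) (auto intro!: arg_cong[of _ _ det] eq_matI)
  also have "\<dots> = (\<Prod>i<n. x i i)"
    by (simp add: prod_list_diag_prod atLeast0LessThan)
  finally show ?thesis .
qed

text \<open>Laplace expansion along the new row: the cofactors \<open>C\<close> do not see that row,
  and the one of its last entry is the minor without it. This is the entry of largest degree under
  \<open>krow\<close>.\<close>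

lemma minor_snoc:
  assumes "p \<notin> set R"
  shows "\<exists>C. C (length R) = minor R x \<and>
    (\<forall>z. minor (R @ [p]) (x(p := z)) = (\<Sum>l<Suc (length R). z l * C l))"
proof -
  let ?n = "length R"
  define A where "A = (\<lambda>z. mat (Suc ?n) (Suc ?n) (\<lambda>(j, l). (x(p := z)) ((R @ [p]) ! j) l))"
  define C where "C = (\<lambda>l. cofactor (A (\<lambda>_. 0)) ?n l)"
  have del: "mat_delete (A z) ?n l = mat_delete (A (\<lambda>_. 0)) ?n l" for z l
    using assms by (intro eq_matI) (auto simp: A_def mat_delete_def nth_append)
  have cof: "cofactor (A z) ?n l = C l" for z l
    by (simp only: cofactor_def C_def del[of z l])
  have "minor (R @ [p]) (x(p := z)) = (\<Sum>l<Suc ?n. z l * C l)" for z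
  proof -
    have "minor (R @ [p]) (x(p := z)) = det (A z)" by (simp add: minor_def A_def)
    also have "\<dots> = (\<Sum>l<Suc ?n. A z $$ (?n, l) * cofactor (A z) ?n l)"
      by (rule laplace_expansion_row) (auto simp: A_def)
    also have "\<dots> = (\<Sum>l<Suc ?n. z l * C l)"
      by (rule sum.cong) (simp_all only: cof, auto simp: A_def nth_append)
    finally show ?thesis .
  qed
  moreover have "C ?n = minor R x"
  proof -
    have "mat_delete (A (\<lambda>_. 0)) ?n ?n = mat ?n ?n (\<lambda>(j, l). x (R ! j) l)"
      using assms by (intro eq_matI) (auto simp: A_def mat_delete_def nth_append)
    then show ?thesis by (simp add: C_def cofactor_def minor_def)
  qed
  ultimately show ?thesis by blast
qed

section \<open>Weights and elimination\<close>

text \<open>The second equation bounds the degree of \<open>P\<close> by \<open>A\<close>, while the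
  first makes \<open>t ^ B\<close> a divisor of \<open>P\<close>.\<close>

lemma poly_order_degree_zero:
  fixes P Q R :: "complex poly"
  assumes PR: "\<And>t. t \<noteq> 0 \<Longrightarrow> poly P t = t ^ B * poly R t"
    and PQ: "\<And>t. t \<noteq> 0 \<Longrightarrow> poly P t = t ^ A * poly Q (1 / t)" and "A < B"
  shows "P = 0"
proof (rule ccontr)
  assume P: "P \<noteq> 0"
  have eq1: "P = Polynomial.monom 1 B * R"
    by (rule poly_eq_cofinite[of "{0}"]) (auto simp: poly_monom PR)
  have eq2: "P * Polynomial.monom 1 (Polynomial.degree Q) = Polynomial.monom 1 A * reflect_poly Q"
    by (rule poly_eq_cofinite[of "{0}"])
      (auto simp: poly_monom PQ poly_reflect_poly_nz inverse_eq_divide)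
  have "R \<noteq> 0" using P eq1 by auto
  then have "Polynomial.degree P \<ge> B" using eq1 by (simp add: degree_mult_eq degree_monom_eq)
  moreover have "Polynomial.degree P + Polynomial.degree Q \<le> A + Polynomial.degree Q"
  proof -
    have "Polynomial.degree (P * Polynomial.monom 1 (Polynomial.degree Q)) = Polynomial.degree P + Polynomial.degree Q"
      using P by (subst degree_mult_eq) (simp_all add: degree_monom_eq)
    moreover have "Polynomial.degree (Polynomial.monom 1 A * reflect_poly Q) \<le> A + Polynomial.degree Q"
      by (rule order_trans[OF degree_mult_le]) (simp add: degree_monom_eq degree_reflect_poly_le)
    ultimately show ?thesis using eq2 by simp
  qed
  ultimately show False using \<open>A < B\<close> by simp
qed

text \<open>The fact that highest weights of \<open>SL_2\<close> are dominant, done by hand. Column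
  \<open>c\<close> moves along \<open>x_c' - t y\<close> with \<open>y = x_c' - x_c\<close>.
  Subtracting it from column \<open>c'\<close> leaves \<open>t y\<close> there, so the value is
  divisible by \<open>t ^ B\<close>; pulling \<open>t\<close> out of column \<open>c\<close> bounds
  its degree by \<open>A\<close>. At \<open>t = 1\<close> the array is \<open>x\<close>.\<close>

lemma dominant_weight_pair:
  assumes H: "polyfn p k H" and c: "c \<noteq> c'"
    and inv: "\<And>x s. H (colop c c' s x) = H x"
    and hA: "\<And>x t. t \<noteq> 0 \<Longrightarrow> H (\<lambda>i j. if j = c then t * x i j else x i j) = t ^ A * H x"
    and hB: "\<And>x t. t \<noteq> 0 \<Longrightarrow> H (\<lambda>i j. if j = c' then t * x i j else x i j) = t ^ B * H x"
    and "A < B"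
  shows "H x = 0"
proof -
  define y where "y = (\<lambda>i. x i c' - x i c)"
  define pf where "pf = (\<lambda>t i j. if j = c then x i c' - t * y i else x i j)"
  define rf where "rf = (\<lambda>t i j. if j = c then x i c' - t * y i else if j = c' then y i else x i j)"
  define qf where "qf = (\<lambda>t i j. if j = c then t * x i c' - y i else x i j)"
  have "upoly (\<lambda>t. H (pf t))"
    unfolding pf_def by (rule upoly_polyfn[OF H]) (intro upoly_if upoly_diff upoly_mult upoly_const upoly_id)
  then obtain P where P: "\<And>t. H (pf t) = poly P t"
    unfolding upoly_def by auto
  have "upoly (\<lambda>t. H (rf t))"
    unfolding rf_def by (rule upoly_polyfn[OF H]) (intro upoly_if upoly_diff upoly_mult upoly_const upoly_id)
  then obtain R where R: "\<And>t. H (rf t) = poly R t"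
    unfolding upoly_def by auto
  have "upoly (\<lambda>t. H (qf t))"
    unfolding qf_def by (rule upoly_polyfn[OF H]) (intro upoly_if upoly_diff upoly_mult upoly_const upoly_id)
  then obtain Q where Q: "\<And>t. H (qf t) = poly Q t"
    unfolding upoly_def by auto
  have "poly P t = t ^ B * poly R t" if t: "t \<noteq> 0" for t
  proof -
    have "H (pf t) = H (colop c c' (-1) (pf t))" by (simp only: inv)
    also have "colop c c' (-1) (pf t) = (\<lambda>i j. if j = c' then t * rf t i j else rf t i j)"
      using c by (auto simp: colop_def pf_def rf_def fun_eq_iff)
    also have "H \<dots> = t ^ B * H (rf t)" by (rule hB[OF t])
    finally show ?thesis by (simp only: P R)
  qed
  moreover have "poly P t = t ^ A * poly Q (1 / t)" if t: "t \<noteq> 0" for t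
  proof -
    have "pf t = (\<lambda>i j. if j = c then t * qf (1 / t) i j else qf (1 / t) i j)"
      using t by (auto simp: pf_def qf_def fun_eq_iff algebra_simps)
    then have "H (pf t) = t ^ A * H (qf (1 / t))" using hA[OF t, of "qf (1 / t)"] by (simp only:)
    then show ?thesis by (simp only: P Q)
  qed
  ultimately have "P = 0" using poly_order_degree_zero \<open>A < B\<close> by blast
  moreover have "pf 1 = x"
    by (auto simp: pf_def y_def fun_eq_iff)
  ultimately show ?thesis using P[of 1] by simp
qed

lemma col_weight_single:
  assumes "col_weight k wt F" "c < k" "t \<noteq> 0"
  shows "F (\<lambda>i j. if j = c then t * x i j else x i j) = t ^ wt c * F x"
proof -
  have "(\<lambda>i j. if j = c then t * x i j else x i j) = (\<lambda>i j. x i j * (if j = c then t else 1))"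
    by (auto simp: fun_eq_iff)
  moreover have "(\<Prod>j<k. (if j = c then t else 1) ^ wt j) = (\<Prod>j<k. if j = c then t ^ wt j else 1)"
    by (rule prod.cong) auto
  ultimately show ?thesis using assms unfolding col_weight_def by simp
qed

text \<open>Hence the weight of a nonzero column invariant is weakly decreasing, that is, a Young
  diagram.\<close>

lemma col_weight_dominant:
  assumes "polyfn p k F" "col_inv k F" "col_weight k wt F" "Suc c < k" "wt c < wt (Suc c)"
  shows "F x = 0"
  by (rule dominant_weight_pair[of p k F c "Suc c" "wt c" "wt (Suc c)"])
    (use assms in \<open>auto simp: col_inv_def intro!: col_weight_single\<close>)

section \<open>Terms of a given column weight\<close>

lemma monomial_fun_col_scale:
  "monomial_fun p k e (\<lambda>i j. x i j * t j) = (\<Prod>j<k. t j ^ (\<Sum>i<p. e i j)) * monomial_fun p k e x"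
proof -
  have "(\<Prod>i<p. \<Prod>j<k. t j ^ e i j) = (\<Prod>j<k. t j ^ (\<Sum>i<p. e i j))"
    by (subst prod.swap) (simp add: power_sum)
  then show ?thesis by (simp add: monomial_fun_def power_mult_distrib prod.distrib mult.commute)
qed

lemma peval_alt: "peval p k xs x = (\<Sum>y\<leftarrow>xs. fst y * monomial_fun p k (snd y) x)"
  unfolding peval_def by (simp only: case_prod_unfold)

lemma peval_filter:
  "peval p k (filter (\<lambda>y. Q (snd y)) xs) x =
    (\<Sum>y\<leftarrow>xs. if Q (snd y) then fst y * monomial_fun p k (snd y) x else 0)"
  unfolding peval_alt by (simp only: sum_list_map_filter')

lemma ex_digit_bound:
  fixes k :: nat
  obtains N where "\<And>c e j. (c, e) \<in> set xs \<Longrightarrow> j < k \<Longrightarrow> (\<Sum>i<p. e i j) < (N :: nat)"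
    "\<And>j. j < k \<Longrightarrow> wt j < N"
proof -
  have fin: "finite ((\<lambda>(ce, j). \<Sum>i<p. snd ce i j) ` (set xs \<times> {..<k}) \<union> wt ` {..<k})" (is "finite ?S")
    by (intro finite_UnI finite_imageI finite_cartesian_product) simp_all
  show thesis
  proof (rule that[of "Suc (Max ?S)"])
    fix c e j assume ce: "(c, e) \<in> set xs" "j < k"
    have "(\<Sum>i<p. e i j) \<in> ?S" by (rule UnI1, rule image_eqI[of _ _ "((c, e), j)"]) (use ce in auto)
    then show "(\<Sum>i<p. e i j) < Suc (Max ?S)" using Max_ge[OF fin] by (simp add: less_Suc_eq_le)
  next
    fix j assume "j < k"
    then have "wt j \<in> ?S" by auto
    then show "wt j < Suc (Max ?S)" using Max_ge[OF fin] by (simp add: less_Suc_eq_le)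
  qed
qed

text \<open>Column \<open>j\<close> is scaled by \<open>s ^ N ^ j\<close> with \<open>N\<close>
  above all column degrees and weights. The exponent of \<open>s\<close> in a term is then the base
  \<open>N\<close> number whose digits are its column degrees, so comparing coefficients discards
  exactly the terms of wrong weight.\<close>

lemma weight_list:
  assumes "polyfn p k F" "col_weight k wt F"
  obtains xs where "F = peval p k xs" "\<And>c e j. (c, e) \<in> set xs \<Longrightarrow> j < k \<Longrightarrow> (\<Sum>i<p. e i j) = wt j"
proof -
  obtain xs where xs: "F = peval p k xs" using assms(1) unfolding polyfn_def by auto
  obtain N where N: "\<And>c e j. (c, e) \<in> set xs \<Longrightarrow> j < k \<Longrightarrow> (\<Sum>i<p. e i j) < (N :: nat)"
    "\<And>j. j < k \<Longrightarrow> wt j < N" using ex_digit_bound[of xs k p wt] by metis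
  define D where "D = (\<lambda>b. \<Sum>j<k. b j * N ^ j)"
  define key where "key = (\<lambda>e. D (\<lambda>j. \<Sum>i<p. e i j))"
  have pow: "(\<Prod>j<k. (s ^ N ^ j) ^ b j) = s ^ D b" for s :: complex and b
    by (simp add: D_def power_sum mult.commute flip: power_mult)
  have "F x = peval p k (filter (\<lambda>y. key (snd y) = D wt) xs) x" for x
  proof -
    have "(\<Sum>y\<leftarrow>xs. (fst y * monomial_fun p k (snd y) x) * s ^ key (snd y)) =
        (\<Sum>z\<leftarrow>[()]. F x * s ^ D wt)" if "s \<noteq> 0" for s
    proof -
      have "F (\<lambda>i j. x i j * s ^ N ^ j) = s ^ D wt * F x"
        using assms(2) that unfolding col_weight_def pow[symmetric] by simp
      moreover have "F (\<lambda>i j. x i j * s ^ N ^ j) = (\<Sum>y\<leftarrow>xs. (fst y * monomial_fun p k (snd y) x) * s ^ key (snd y))"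
        unfolding xs peval_alt monomial_fun_col_scale pow key_def by (simp only: mult.assoc mult.commute)
      ultimately show ?thesis by simp
    qed
    from power_sum_coeff[OF this, of "D wt"]
    show ?thesis by (simp add: peval_filter[of p k "\<lambda>e. key e = D wt"])
  qed
  then have "F = peval p k (filter (\<lambda>y. key (snd y) = D wt) xs)" by auto
  then show thesis
  proof (rule that)
    fix c e j assume ce: "(c, e) \<in> set (filter (\<lambda>y. key (snd y) = D wt) xs)" and j: "j < k"
    then have "(c, e) \<in> set xs" "D (\<lambda>j. \<Sum>i<p. e i j) = D wt" by (auto simp: key_def)
    then show "(\<Sum>i<p. e i j) = wt j"
      unfolding D_def using digits_inj[of k "\<lambda>j. \<Sum>i<p. e i j" N wt j] N j by blast
  qed
qed

section \<open>Normal forms under elimination\<close>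

definition E_arr :: "nat \<Rightarrow> nat \<Rightarrow> complex" where
  "E_arr i j = (if i = j then 1 else 0)"

lemma minor_E: "minor [0..<n] E_arr = 1"
  by (subst minor_lower_triangular) (auto simp: E_arr_def)

text \<open>On the line from \<open>E_arr\<close> to \<open>x\<close> the product of the leading
  minors is a polynomial with value 1 at the start, so it has finitely many zeros, and
  \<open>H\<close> vanishes at all other points of the line.\<close>

lemma eq_zero_generic:
  assumes H: "polyfn p k H" and "k \<le> p"
    and gen: "\<And>x. (\<And>j. j \<le> k \<Longrightarrow> minor [0..<j] x \<noteq> 0) \<Longrightarrow> H x = 0"
  shows "H x = 0"
proof -
  define Z where "Z = (\<lambda>t i j. (1 - t) * E_arr i j + t * x i j)"
  have entry: "upoly (\<lambda>t. Z t i j)" for i j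
    unfolding Z_def by (intro upoly_add upoly_mult upoly_diff upoly_const upoly_id)
  define m where "m = (\<lambda>t. \<Prod>j\<in>{..k}. minor [0..<j] (Z t))"
  have "polyfn p k (\<lambda>x. \<Prod>j\<in>{..k}. minor [0..<j] x)"
    by (rule polyfn_prod, rule polyfn_minor) (use \<open>k \<le> p\<close> in auto)
  then have "upoly m" unfolding m_def by (rule upoly_polyfn) (rule entry)
  moreover have Z0: "Z 0 = E_arr" by (auto simp: Z_def)
  then have "m 0 \<noteq> 0" by (simp add: m_def minor_E)
  ultimately have fin: "finite {t. m t = 0}" by (rule upoly_finite_zeros)
  have "H (Z 1) = 0"
  proof (rule upoly_eq_cofinite[OF upoly_polyfn[OF H] upoly_const fin])
    show "upoly (\<lambda>t. Z t i j)" for i j by (rule entry)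
    show "H (Z t) = 0" if "t \<notin> {t. m t = 0}" for t
      using that by (intro gen) (auto simp: m_def)
  qed
  then show ?thesis by (simp add: Z_def)
qed

text \<open>Column operations preserve the leading minors. Once the rows above row \<open>r\<close>
  are triangular, the leading minor of size \<open>r + 1\<close> is the product of the diagonal
  entries, so the next pivot cannot be zero.\<close>

lemma col_elimination:
  assumes minors: "\<And>j. j \<le> k \<Longrightarrow> minor [0..<j] x \<noteq> 0"
  obtains y where "\<And>H. col_inv k H \<Longrightarrow> H y = H x" "\<And>i j. i < j \<Longrightarrow> j < k \<Longrightarrow> y i j = 0"
    "\<And>j. j < k \<Longrightarrow> y j j \<noteq> 0"
proof -
  have pivot: "y r r \<noteq> 0" if reach: "\<forall>H. col_inv k H \<longrightarrow> H y = H x" and r: "r < k"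
    and tri: "\<forall>i<r. \<forall>j. i < j \<longrightarrow> j < k \<longrightarrow> y i j = 0" for y r
  proof -
    have "minor [0..<Suc r] y = minor [0..<Suc r] x"
      using reach col_inv_mprod[of k "[[0..<Suc r]]"] by (auto simp del: upt_Suc)
    moreover have "minor [0..<Suc r] y = (\<Prod>i<Suc r. y i i)"
      by (rule minor_lower_triangular) (use tri r in auto)
    ultimately show ?thesis using minors[of "Suc r"] r by auto
  qed
  have "\<exists>y. (\<forall>H. col_inv k H \<longrightarrow> H y = H x) \<and> (\<forall>i<r. \<forall>j. i < j \<longrightarrow> j < k \<longrightarrow> y i j = 0)"
    if "r \<le> k" for r
    using that
  proof (induction r)
    case (Suc r)
    have "\<exists>y. (\<forall>H. col_inv k H \<longrightarrow> H y = H x) \<and> (\<forall>i<r. \<forall>j. i < j \<longrightarrow> j < k \<longrightarrow> y i j = 0)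
        \<and> (\<forall>j. r < j \<longrightarrow> j < l \<longrightarrow> y r j = 0)" if "l \<le> k" for l
      using that
    proof (induction l)
      case 0
      then show ?case using Suc by auto
    next
      case (Suc l)
      then obtain y where y: "\<forall>H. col_inv k H \<longrightarrow> H y = H x" "\<forall>i<r. \<forall>j. i < j \<longrightarrow> j < k \<longrightarrow> y i j = 0"
        "\<forall>j. r < j \<longrightarrow> j < l \<longrightarrow> y r j = 0" by auto
      show ?case
      proof (cases "r < l")
        case True
        define z where "z = colop r l (- (y r l / y r r)) y"
        have rk: "r < k" using \<open>Suc r \<le> k\<close> by simp
        have "H z = H x" if "col_inv k H" for H
          using that y(1) True Suc.prems by (auto simp: z_def col_inv_def)
        moreover have "\<forall>i<r. \<forall>j. i < j \<longrightarrow> j < k \<longrightarrow> z i j = 0"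
          using y(2) rk by (auto simp: z_def colop_def)
        moreover have "\<forall>j. r < j \<longrightarrow> j < Suc l \<longrightarrow> z r j = 0"
          using y(3) pivot[OF y(1) rk y(2)] by (auto simp: z_def colop_def less_Suc_eq)
        ultimately show ?thesis by blast
      next
        case False
        then show ?thesis using y by (intro exI[of _ y]) (auto simp: less_Suc_eq)
      qed
    qed
    from this[of k] show ?case by (auto simp: less_Suc_eq)
  qed auto
  from this[of k] obtain y where y: "\<forall>H. col_inv k H \<longrightarrow> H y = H x"
    "\<forall>i<k. \<forall>j. i < j \<longrightarrow> j < k \<longrightarrow> y i j = 0" by auto
  show thesis
  proof (rule that[of y])
    show "y j j \<noteq> 0" if "j < k" for j using pivot[OF y(1) that] y(2) that by auto
  qed (use y in auto)
qed

text \<open>When column \<open>r\<close> is to be cleared, the pivot is the only nonzero entry of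
  row \<open>r\<close> in the first \<open>k\<close> columns: those to the left were cleared before,
  those to the right vanish by triangularity. Adding row \<open>r\<close> to lower rows therefore
  changes column \<open>r\<close> alone and keeps the diagonal.\<close>

lemma row_elimination:
  assumes tri: "\<And>i j. i < j \<Longrightarrow> j < k \<Longrightarrow> y i j = 0" and diag: "\<And>j. j < k \<Longrightarrow> y j j \<noteq> 0"
  obtains z where "\<And>H. row_inv q H \<Longrightarrow> H z = H y"
    "\<And>i j. i < q \<Longrightarrow> j < k \<Longrightarrow> i \<noteq> j \<Longrightarrow> z i j = 0" "\<And>j. j < k \<Longrightarrow> z j j = y j j"
proof -
  define reach where "reach = (\<lambda>z. (\<forall>H. row_inv q H \<longrightarrow> H z = H y) \<and>
    (\<forall>i j. i < j \<longrightarrow> j < k \<longrightarrow> z i j = 0) \<and> (\<forall>j<k. z j j = y j j))"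
  have "\<exists>z. reach z \<and> (\<forall>j<r. \<forall>i<q. i \<noteq> j \<longrightarrow> z i j = 0)" if "r \<le> k" for r
    using that
  proof (induction r)
    case 0
    then show ?case using tri by (intro exI[of _ y]) (auto simp: reach_def)
  next
    case (Suc r)
    have "\<exists>z. reach z \<and> (\<forall>j<r. \<forall>i<q. i \<noteq> j \<longrightarrow> z i j = 0) \<and> (\<forall>i<l. i \<noteq> r \<longrightarrow> z i r = 0)" if "l \<le> q" for l
      using that
    proof (induction l)
      case 0
      then show ?case using Suc by auto
    next
      case (Suc l)
      then obtain z where z: "reach z" "\<forall>j<r. \<forall>i<q. i \<noteq> j \<longrightarrow> z i j = 0" "\<forall>i<l. i \<noteq> r \<longrightarrow> z i r = 0"
        by auto
      show ?case
      proof (cases "r < l")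
        case True
        define w where "w = rowop r l (- (z l r / z r r)) z"
        have rk: "r < k" using \<open>Suc r \<le> k\<close> by simp
        have zr: "z r r \<noteq> 0" using z(1) diag rk by (auto simp: reach_def)
        have rowr: "z r j = 0" if "j < k" "j \<noteq> r" for j
          using z(1,2) that True Suc.prems by (cases "j < r") (auto simp: reach_def)
        have "reach w"
          unfolding reach_def
        proof (intro conjI allI impI)
          show "H w = H y" if "row_inv q H" for H
            using that z(1) True Suc.prems by (auto simp: w_def row_inv_def reach_def)
          show "w i j = 0" if "i < j" "j < k" for i j
            using that z(1) rowr[of j] True by (auto simp: w_def rowop_def reach_def)
          show "w j j = y j j" if "j < k" for j
            using that z(1) rowr[of j] True by (auto simp: w_def rowop_def reach_def)
        qed
        moreover have "\<forall>j<r. \<forall>i<q. i \<noteq> j \<longrightarrow> w i j = 0"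
          using z(2) rowr rk by (auto simp: w_def rowop_def)
        moreover have "\<forall>i<Suc l. i \<noteq> r \<longrightarrow> w i r = 0"
          using z(3) zr by (auto simp: w_def rowop_def less_Suc_eq)
        ultimately show ?thesis by blast
      next
        case False
        have "l < r \<Longrightarrow> z l r = 0" using z(1) \<open>Suc r \<le> k\<close> by (auto simp: reach_def)
        then show ?thesis using z False by (intro exI[of _ z]) (auto simp: less_Suc_eq)
      qed
    qed
    from this[of q] show ?case by (auto simp: less_Suc_eq)
  qed
  from this[of k] obtain z where "reach z" "\<forall>j<k. \<forall>i<q. i \<noteq> j \<longrightarrow> z i j = 0" by auto
  then show thesis using that[of z] by (auto simp: reach_def)
qed

text \<open>A generic array has nonzero leading minors, and the two eliminations then reach an array
  that is diagonal in the first \<open>q\<close> rows. The rows from \<open>q\<close> on remain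
  arbitrary.\<close>

lemma eq_zero_diagonal:
  assumes "polyfn p k H" "col_inv k H" "row_inv q H" "k \<le> q" "q \<le> p"
    and diag: "\<And>x. (\<And>i j. i < q \<Longrightarrow> j < k \<Longrightarrow> i \<noteq> j \<Longrightarrow> x i j = 0) \<Longrightarrow> (\<And>j. j < k \<Longrightarrow> x j j \<noteq> 0) \<Longrightarrow> H x = 0"
  shows "H x = 0"
proof (rule eq_zero_generic[OF assms(1)])
  show "k \<le> p" using assms by simp
  fix x assume "\<And>j. j \<le> k \<Longrightarrow> minor [0..<j] x \<noteq> 0"
  then obtain y where y: "\<And>H. col_inv k H \<Longrightarrow> H y = H x" "\<And>i j. i < j \<Longrightarrow> j < k \<Longrightarrow> y i j = 0"
    "\<And>j. j < k \<Longrightarrow> y j j \<noteq> 0" using col_elimination by metis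
  obtain z where z: "\<And>H. row_inv q H \<Longrightarrow> H z = H y"
    "\<And>i j. i < q \<Longrightarrow> j < k \<Longrightarrow> i \<noteq> j \<Longrightarrow> z i j = 0" "\<And>j. j < k \<Longrightarrow> z j j = y j j"
    by (rule row_elimination[of k y q, OF y(2,3)]) auto
  have "H z = 0" by (rule diag) (use z y(3) in auto)
  then show "H x = 0" using z(1)[OF assms(3)] y(1)[OF assms(2)] by simp
qed

section \<open>Invariants are spanned by products of minors\<close>

text \<open>The value \<open>a\<close> may be zero: it will itself be a function of the array, with
  zeros at special arrays.\<close>

definition top_coeff :: "complex poly \<Rightarrow> nat \<Rightarrow> complex \<Rightarrow> bool" where
  "top_coeff P d a \<longleftrightarrow> Polynomial.degree P \<le> d \<and> Polynomial.coeff P d = a"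

lemma top_coeff_mult:
  assumes "top_coeff P d a" "top_coeff Q e b" shows "top_coeff (P * Q) (d + e) (a * b)"
proof -
  have dP: "Polynomial.degree P \<le> d" "Polynomial.coeff P d = a"
    and dQ: "Polynomial.degree Q \<le> e" "Polynomial.coeff Q e = b"
    using assms by (auto simp: top_coeff_def)
  have deg: "Polynomial.degree (P * Q) \<le> Polynomial.degree P + Polynomial.degree Q" by (rule degree_mult_le)
  have "Polynomial.coeff (P * Q) (d + e) = a * b"
  proof (cases "Polynomial.degree P = d \<and> Polynomial.degree Q = e")
    case True
    then show ?thesis using coeff_mult_degree_sum[of P Q] dP dQ by simp
  next
    case False
    then have "Polynomial.degree P + Polynomial.degree Q < d + e" "a * b = 0"
      using dP dQ by (auto simp: coeff_eq_0)
    then show ?thesis using deg by (simp add: coeff_eq_0)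
  qed
  then show ?thesis using deg dP dQ by (simp add: top_coeff_def)
qed

lemma top_coeff_const: "top_coeff [:a:] 0 a"
  by (simp add: top_coeff_def)

lemma top_coeff_power: "top_coeff P d 1 \<Longrightarrow> top_coeff (P ^ n) (n * d) 1"
proof (induction n)
  case 0
  show ?case using top_coeff_const[of 1] by (simp add: one_pCons)
next
  case (Suc n)
  then show ?case using top_coeff_mult[of P d 1 "P ^ n" "n * d" 1] by simp
qed

lemma top_coeff_prod:
  fixes P :: "nat \<Rightarrow> complex poly"
  assumes "\<And>j. j < k \<Longrightarrow> top_coeff (P j) (d j) 1"
  shows "top_coeff (\<Prod>j<k. P j) (\<Sum>j<k. d j) 1"
  using assms
proof (induction k)
  case 0
  show ?case using top_coeff_const[of 1] by (simp add: one_pCons)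
next
  case (Suc k)
  then show ?case using top_coeff_mult[of "\<Prod>j<k. P j" "\<Sum>j<k. d j" 1 "P k" "d k" 1] by simp
qed

text \<open>Kronecker substitution in row \<open>p\<close>: a monomial in the entries of that row
  becomes a power of \<open>s\<close> whose base \<open>N\<close> digits are the exponents.\<close>

definition krow :: "nat \<Rightarrow> nat \<Rightarrow> complex \<Rightarrow> (nat \<Rightarrow> nat \<Rightarrow> complex) \<Rightarrow> nat \<Rightarrow> nat \<Rightarrow> complex" where
  "krow p N s x = x(p := \<lambda>j. s ^ N ^ j)"

lemma minor_snoc_top_coeff:
  assumes "p \<notin> set R" "N \<ge> 2"
  shows "\<exists>P. (\<forall>s. minor (R @ [p]) (krow p N s x) = poly P s) \<and>
    top_coeff P (N ^ length R) (minor R x)"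
proof -
  let ?n = "length R"
  obtain C where C: "C ?n = minor R x" "\<And>z. minor (R @ [p]) (x(p := z)) = (\<Sum>l<Suc ?n. z l * C l)"
    using minor_snoc[OF assms(1)] by blast
  define P where "P = (\<Sum>l<Suc ?n. Polynomial.monom (C l) (N ^ l))"
  have "poly P s = minor (R @ [p]) (krow p N s x)" for s
    unfolding C krow_def P_def by (simp add: poly_sum poly_monom mult.commute)
  moreover have "Polynomial.degree P \<le> N ^ ?n"
    unfolding P_def
  proof (rule degree_sum_le)
    fix l assume "l \<in> {..<Suc ?n}"
    then have "N ^ l \<le> N ^ ?n" using assms(2) by (intro power_increasing) auto
    then show "Polynomial.degree (Polynomial.monom (C l) (N ^ l)) \<le> N ^ ?n"
      using degree_monom_le order_trans by blast
  qed simp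
  moreover have "Polynomial.coeff P (N ^ ?n) = minor R x"
  proof -
    have "N ^ l \<noteq> N ^ ?n" if "l < ?n" for l
      using power_strict_increasing[OF that, of N] assms(2) by simp
    then have "(\<Sum>l<?n. Polynomial.coeff (Polynomial.monom (C l) (N ^ l)) (N ^ ?n)) = 0"
      by (intro sum.neutral) auto
    then show ?thesis unfolding P_def using C(1) by (simp add: coeff_sum)
  qed
  ultimately show ?thesis unfolding top_coeff_def by metis
qed

text \<open>Row \<open>p\<close> is appended to \<open>b j\<close> of the lists of length
  \<open>j\<close>. An extended minor has top degree \<open>N ^ j\<close> with the old minor as top
  coefficient, and the other minors are constant in \<open>s\<close>. Each list grows by at most one
  entry, so the added boxes form a horizontal strip.\<close>

lemma extend_rows:
  assumes "\<And>R. R \<in> set Rs \<Longrightarrow> good_row q p R \<and> length R \<le> k" "q \<le> p" "N \<ge> 2"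
    and "\<And>j. b j \<le> length (filter (\<lambda>R. length R = j) Rs)" "\<And>j. k \<le> j \<Longrightarrow> b j = 0"
  shows "\<exists>Rs'. (\<forall>R\<in>set Rs'. good_row q (Suc p) R \<and> length R \<le> k) \<and> (\<forall>j. rlen Rs' j = rlen Rs j + b j) \<and>
    (\<forall>x. \<exists>P. (\<forall>s. mprod Rs' (krow p N s x) = poly P s) \<and>
       top_coeff P (\<Sum>j<k. b j * N ^ j) (mprod Rs x))"
  using assms(1,4,5)
proof (induction Rs arbitrary: b)
  case Nil
  then have "b j = 0" for j by auto
  then show ?case using top_coeff_const[of 1] by (intro exI[of _ "[]"]) (auto intro!: exI[of _ 1] simp: one_pCons)
next
  case (Cons R Rs)
  let ?r = "length R"
  have R: "good_row q p R" "?r \<le> k" using Cons.prems(1) by auto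
  have p: "p \<notin> set R" using good_row_set[OF R(1) assms(2)] by auto
  show ?case
  proof (cases "b ?r = 0")
    case True
    have "b j \<le> length (filter (\<lambda>R. length R = j) Rs)" for j
      using Cons.prems(2)[of j] True by (cases "j = ?r") auto
    from Cons.IH[OF _ this Cons.prems(3)] Cons.prems(1)
    obtain Rs' where Rs': "\<forall>R\<in>set Rs'. good_row q (Suc p) R \<and> length R \<le> k" "\<forall>j. rlen Rs' j = rlen Rs j + b j"
      "\<forall>x. \<exists>P. (\<forall>s. mprod Rs' (krow p N s x) = poly P s) \<and>
       top_coeff P (\<Sum>j<k. b j * N ^ j) (mprod Rs x)" by auto
    have "\<exists>P. (\<forall>s. mprod (R # Rs') (krow p N s x) = poly P s) \<and>
       top_coeff P (\<Sum>j<k. b j * N ^ j) (mprod (R # Rs) x)" for x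
    proof -
      obtain P where P: "\<forall>s. mprod Rs' (krow p N s x) = poly P s"
        "top_coeff P (\<Sum>j<k. b j * N ^ j) (mprod Rs x)" using Rs'(3) by auto
      have "minor R (krow p N s x) = minor R x" for s
        unfolding krow_def using p by (intro minor_cong) auto
      then show ?thesis using P top_coeff_mult[OF top_coeff_const[of "minor R x"] P(2)]
        by (intro exI[of _ "[:minor R x:] * P"]) auto
    qed
    then show ?thesis using Rs' R good_row_Suc by (intro exI[of _ "R # Rs'"]) auto
  next
    case False
    have rk: "?r < k" using Cons.prems(3)[of ?r] False by (meson not_le)
    define b' where "b' = b(?r := b ?r - 1)"
    have b: "b j = b' j + (if j = ?r then 1 else 0)" for j using False by (auto simp: b'_def)
    have "b' j \<le> length (filter (\<lambda>R. length R = j) Rs)" for j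
      using Cons.prems(2)[of j] by (auto simp: b'_def)
    moreover have "b' j = 0" if "k \<le> j" for j using Cons.prems(3)[OF that] by (auto simp: b'_def)
    ultimately obtain Rs' where Rs': "\<forall>R\<in>set Rs'. good_row q (Suc p) R \<and> length R \<le> k" "\<forall>j. rlen Rs' j = rlen Rs j + b' j"
      "\<forall>x. \<exists>P. (\<forall>s. mprod Rs' (krow p N s x) = poly P s) \<and>
       top_coeff P (\<Sum>j<k. b' j * N ^ j) (mprod Rs x)" using Cons.IH[of b'] Cons.prems(1) by auto
    have sum: "(\<Sum>j<k. b j * N ^ j) = N ^ ?r + (\<Sum>j<k. b' j * N ^ j)"
    proof -
      have "(\<Sum>j<k. b j * N ^ j) = (\<Sum>j<k. b' j * N ^ j) + (\<Sum>j<k. if j = ?r then N ^ j else 0)"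
        unfolding sum.distrib[symmetric] by (rule sum.cong) (auto simp: b algebra_simps)
      then show ?thesis using rk by simp
    qed
    have "\<exists>P. (\<forall>s. mprod ((R @ [p]) # Rs') (krow p N s x) = poly P s) \<and>
       top_coeff P (\<Sum>j<k. b j * N ^ j) (mprod (R # Rs) x)" for x
    proof -
      obtain P where P: "\<forall>s. mprod Rs' (krow p N s x) = poly P s"
        "top_coeff P (\<Sum>j<k. b' j * N ^ j) (mprod Rs x)" using Rs'(3) by auto
      obtain Q where Q: "\<forall>s. minor (R @ [p]) (krow p N s x) = poly Q s"
        "top_coeff Q (N ^ ?r) (minor R x)" using minor_snoc_top_coeff[OF p assms(3)] by auto
      show ?thesis unfolding sum using P(1) Q(1) top_coeff_mult[OF Q(2) P(2)]
        by (intro exI[of _ "Q * P"]) auto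
    qed
    moreover have "rlen ((R @ [p]) # Rs') j = rlen (R # Rs) j + b j" for j
      using Rs'(2) by (auto simp: b)
    ultimately show ?thesis using Rs'(1) good_row_snoc[OF R(1) assms(2)] rk
      by (intro exI[of _ "(R @ [p]) # Rs'"]) auto
  qed
qed

section \<open>Spans of minors and the square case\<close>

definition minor_span :: "nat \<Rightarrow> nat \<Rightarrow> nat \<Rightarrow> (nat \<Rightarrow> nat) \<Rightarrow> ((nat \<Rightarrow> nat \<Rightarrow> complex) \<Rightarrow> complex) \<Rightarrow> bool" where
  "minor_span q p k wt F \<longleftrightarrow> (\<exists>ys. (\<forall>y\<in>set ys. (\<forall>R\<in>set (snd y). good_row q p R \<and> length R \<le> k) \<and>
       (\<forall>j<k. rlen (snd y) j = wt j)) \<and> (\<forall>x. F x = (\<Sum>y\<leftarrow>ys. fst y * mprod (snd y) x)))"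

text \<open>The monomial in the leading minors whose column weight is \<open>wt\<close>, provided
  that \<open>wt\<close> decreases up to \<open>k\<close> and \<open>wt k\<close> is zero. It will
  be the highest weight vector for the diagram \<open>wt\<close>.\<close>

definition lead_rows :: "nat \<Rightarrow> (nat \<Rightarrow> nat) \<Rightarrow> nat list list" where
  "lead_rows k wt = concat (map (\<lambda>j. replicate (wt j - wt (Suc j)) [0..<Suc j]) [0..<k])"

lemma lead_rows_Suc: "lead_rows (Suc k) wt = lead_rows k wt @ replicate (wt k - wt (Suc k)) [0..<Suc k]"
  by (simp add: lead_rows_def)

lemma rlen_replicate: "rlen (replicate n R) j = (if j < length R then n else 0)"
  by (induction n) auto

text \<open>The differences from \<open>i\<close> up to \<open>k\<close> telescope, which leaves the
  term \<open>wt k\<close>.\<close>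

lemma rlen_lead_rows:
  assumes "\<And>j. j < k \<Longrightarrow> wt (Suc j) \<le> wt j" "i \<le> k"
  shows "rlen (lead_rows k wt) i + wt k = wt i"
  using assms
proof (induction k arbitrary: i)
  case 0
  then show ?case by (simp add: lead_rows_def)
next
  case (Suc k)
  have top: "rlen (lead_rows k wt) j = 0" if "k \<le> j" for j
    using that by (induction k) (auto simp: lead_rows_Suc rlen_replicate lead_rows_def[of 0])
  show ?case
  proof (cases "i = Suc k")
    case True
    then show ?thesis using top[of "Suc k"] by (simp add: lead_rows_Suc rlen_replicate)
  next
    case False
    then have "rlen (lead_rows k wt) i + wt k = wt i" using Suc by auto
    then show ?thesis using False Suc.prems(1)[of k] Suc.prems(2) by (simp add: lead_rows_Suc rlen_replicate)
  qed
qed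

lemma set_lead_rows:
  assumes "R \<in> set (lead_rows k wt)" obtains j where "j < k" "R = [0..<Suc j]"
  using assms unfolding lead_rows_def by (auto simp: set_replicate_conv_if split: if_splits)

lemma mprod_lead_rows_E: "mprod (lead_rows k wt) E_arr = 1"
proof -
  have "minor R E_arr = 1" if "R \<in> set (lead_rows k wt)" for R
    using set_lead_rows[OF that] minor_E by metis
  then have "map (\<lambda>R. minor R E_arr) (lead_rows k wt) = map (\<lambda>_. 1) (lead_rows k wt)"
    by (intro map_cong) auto
  then show ?thesis unfolding mprod_def by (simp add: map_replicate_const)
qed

lemma minor_span_add:
  assumes "minor_span q p k wt F" "minor_span q p k wt G" shows "minor_span q p k wt (\<lambda>x. F x + G x)"
proof -
  obtain ys zs where "\<forall>y\<in>set ys. (\<forall>R\<in>set (snd y). good_row q p R \<and> length R \<le> k) \<and> (\<forall>j<k. rlen (snd y) j = wt j)"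
    "\<forall>x. F x = (\<Sum>y\<leftarrow>ys. fst y * mprod (snd y) x)"
    "\<forall>y\<in>set zs. (\<forall>R\<in>set (snd y). good_row q p R \<and> length R \<le> k) \<and> (\<forall>j<k. rlen (snd y) j = wt j)"
    "\<forall>x. G x = (\<Sum>y\<leftarrow>zs. fst y * mprod (snd y) x)"
    using assms unfolding minor_span_def by blast
  then show ?thesis unfolding minor_span_def by (intro exI[of _ "ys @ zs"]) auto
qed

lemma minor_span_zero: "minor_span q p k wt (\<lambda>x. 0)"
  unfolding minor_span_def by (rule exI[of _ "[]"]) auto

lemma col_inv_diff: "col_inv k F \<Longrightarrow> col_inv k G \<Longrightarrow> col_inv k (\<lambda>x. F x - G x)"
  by (simp add: col_inv_def)

lemma row_inv_diff: "row_inv q F \<Longrightarrow> row_inv q G \<Longrightarrow> row_inv q (\<lambda>x. F x - G x)"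
  by (simp add: row_inv_def)

lemma col_weight_diff: "col_weight k wt F \<Longrightarrow> col_weight k wt G \<Longrightarrow> col_weight k wt (\<lambda>x. F x - G x)"
  by (simp add: col_weight_def algebra_simps)

lemma minor_span_props:
  assumes "minor_span q p k wt F" "q \<le> p"
  shows "polyfn p k F" "col_inv k F" "row_inv q F" "col_weight k wt F"
proof -
  obtain ys where ys: "\<And>y R. y \<in> set ys \<Longrightarrow> R \<in> set (snd y) \<Longrightarrow> good_row q p R \<and> length R \<le> k"
    "\<And>y j. y \<in> set ys \<Longrightarrow> j < k \<Longrightarrow> rlen (snd y) j = wt j"
    "F = (\<lambda>x. \<Sum>y\<leftarrow>ys. fst y * mprod (snd y) x)"
    using assms unfolding minor_span_def by blast
  show "polyfn p k F" unfolding ys(3)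
    by (rule polyfn_sum_list, rule polyfn_mult[OF polyfn_const], rule polyfn_mprod)
      (use ys(1) good_row_set[OF _ assms(2)] in blast)
  show "col_inv k F"
    using col_inv_mprod by (simp add: ys(3) col_inv_def)
  have "mprod (snd y) (rowop c c' s x) = mprod (snd y) x" if "y \<in> set ys" "c < c'" "c' < q" for y c c' s x
    using row_inv_mprod[of "snd y" q p] ys(1) that by (simp add: row_inv_def)
  then show "row_inv q F" unfolding row_inv_def ys(3)
    by (intro allI impI arg_cong[of _ _ sum_list] map_cong) simp_all
  have "mprod (snd y) (\<lambda>i j. x i j * t j) = (\<Prod>j<k. t j ^ wt j) * mprod (snd y) x"
    if "y \<in> set ys" for y x t
    using mprod_col_scale[of "snd y" k] ys(1,2) that by simp
  then have "F (\<lambda>i j. x i j * t j) = (\<Sum>y\<leftarrow>ys. (\<Prod>j<k. t j ^ wt j) * (fst y * mprod (snd y) x))" for x t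
    unfolding ys(3) by (intro arg_cong[of _ _ sum_list] map_cong) simp_all
  then show "col_weight k wt F"
    by (simp add: col_weight_def ys(3) sum_list_const_mult)
qed

text \<open>For \<open>p = q\<close> an array that is diagonal in all rows is \<open>E_arr\<close>
  with scaled columns, so an invariant of given weight is determined by its value at
  \<open>E_arr\<close>. The monomial in the leading minors has value 1 there.\<close>

lemma minor_span_square:
  assumes F: "polyfn q k F" "col_inv k F" "row_inv q F" "col_weight k wt F" and "k \<le> q"
  shows "minor_span q q k wt F"
proof (cases "\<forall>x. F x = 0")
  case True
  then show ?thesis using minor_span_zero[of q q k wt] by (simp add: minor_span_def)
next
  case False
  \<comment> \<open>Cut off at \<open>k\<close>, so that the telescoping sum ends at zero and the
    weight below \<open>k\<close> is exactly \<open>wt\<close>.\<close>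
  define wt' where "wt' = (\<lambda>j. if j < k then wt j else 0)"
  have mono: "wt' (Suc j) \<le> wt' j" if "j < k" for j
    using col_weight_dominant[OF F(1,2,4), of j] False that by (auto simp: wt'_def not_less[symmetric])
  have rl: "rlen (lead_rows k wt') j = wt j" if "j < k" for j
    using rlen_lead_rows[of k wt' j] mono that by (simp add: wt'_def)
  define G where "G = (\<lambda>x. F E_arr * mprod (lead_rows k wt') x)"
  have "\<forall>R\<in>set (lead_rows k wt'). good_row q q R \<and> length R \<le> k"
    using \<open>k \<le> q\<close> by (auto elim!: set_lead_rows intro!: good_row_upt simp del: upt_Suc)
  then have G: "minor_span q q k wt G"
    unfolding minor_span_def G_def
    by (intro exI[of _ "[(F E_arr, lead_rows k wt')]"]) (use rl in auto)
  note Gp = minor_span_props[OF G order_refl]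
  define H where "H = (\<lambda>x. F x - G x)"
  have H: "polyfn q k H" "col_inv k H" "row_inv q H" "col_weight k wt H"
    unfolding H_def
    by (rule polyfn_diff col_inv_diff row_inv_diff col_weight_diff; fact F Gp)+
  have "H x = 0" for x
  proof (rule eq_zero_diagonal[OF H(1-3) \<open>k \<le> q\<close> order_refl])
    fix x :: "nat \<Rightarrow> nat \<Rightarrow> complex"
    assume x: "\<And>i j. i < q \<Longrightarrow> j < k \<Longrightarrow> i \<noteq> j \<Longrightarrow> x i j = 0" "\<And>j. j < k \<Longrightarrow> x j j \<noteq> 0"
    have "H x = H (\<lambda>i j. E_arr i j * x j j)"
      by (rule polyfn_cong[OF H(1)]) (auto simp: E_arr_def x)
    also have "\<dots> = (\<Prod>j<k. x j j ^ wt j) * H E_arr"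
      by (rule H(4)[unfolded col_weight_def, rule_format]) (rule x(2))
    also have "H E_arr = 0" by (simp add: H_def G_def mprod_lead_rows_E)
    finally show "H x = 0" by simp
  qed
  then have "F = G" by (auto simp: H_def)
  with G show ?thesis by simp
qed

lemma top_coeff_coeff: "top_coeff P r a \<Longrightarrow> r \<le> d \<Longrightarrow> Polynomial.coeff P d = (if r = d then a else 0)"
  by (auto simp: top_coeff_def coeff_eq_0)

section \<open>The last row and its leading term\<close>

lemma monomial_fun_Suc:
  "monomial_fun (Suc p) k e x = monomial_fun p k e x * (\<Prod>j<k. x p j ^ e p j)"
  by (simp add: monomial_fun_def)

lemma monomial_fun_upd: "monomial_fun p k e (x(p := z)) = monomial_fun p k e x"
  unfolding monomial_fun_def by (intro prod.cong) auto

lemma peval_row: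
  "peval (Suc p) k xs (x(p := z)) =
    (\<Sum>y\<leftarrow>xs. fst y * monomial_fun p k (snd y) x * (\<Prod>j<k. z j ^ snd y p j))"
  unfolding peval_alt monomial_fun_Suc monomial_fun_upd by (simp add: mult.assoc)

text \<open>With \<open>w j = N ^ j\<close> this is the power of \<open>s\<close> that row
  \<open>p\<close> contributes under \<open>krow\<close>. A second choice of \<open>w\<close>, used
  for the interlacing, merges two adjacent digits.\<close>

definition rkey :: "nat \<Rightarrow> nat \<Rightarrow> (nat \<Rightarrow> nat) \<Rightarrow> (nat \<Rightarrow> nat \<Rightarrow> nat) \<Rightarrow> nat" where
  "rkey p k w e = (\<Sum>j<k. e p j * w j)"

lemma prod_power_rkey: "(\<Prod>j<k. (s ^ w j * z j) ^ e p j) = (\<Prod>j<k. z j ^ e p j) * (s :: complex) ^ rkey p k w e"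
  by (simp add: rkey_def power_mult_distrib prod.distrib power_sum mult.commute flip: power_mult)

lemma peval_krow:
  "peval (Suc p) k xs (krow p N s x) =
    (\<Sum>y\<leftarrow>xs. fst y * monomial_fun p k (snd y) x * s ^ rkey p k (\<lambda>j. N ^ j) (snd y))"
  unfolding krow_def peval_row
  using prod_power_rkey[of s "\<lambda>j. N ^ j" "\<lambda>_. 1"] by simp

lemma sum_list_group_zero:
  fixes f :: "'a \<Rightarrow> complex"
  assumes "\<And>D. (\<Sum>y\<leftarrow>xs. if key y = D then f y else 0) = 0"
  shows "(\<Sum>y\<leftarrow>xs. f y) = 0"
proof -
  have "finite S \<Longrightarrow> key ` set xs \<subseteq> S \<Longrightarrow>
      (\<Sum>y\<leftarrow>xs. f y) = (\<Sum>D\<in>S. \<Sum>y\<leftarrow>xs. if key y = D then f y else 0)" for S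
    by (induction xs) (auto simp: sum.distrib)
  from this[OF _ order_refl] show ?thesis by (simp add: assms)
qed

lemma peval_truncate:
  assumes F: "F = peval (Suc p) k xs"
    and bound: "\<And>y j. y \<in> set xs \<Longrightarrow> j < k \<Longrightarrow> snd y p j < N"
    and deg: "\<And>x. \<exists>P. (\<forall>s. F (krow p N s x) = poly P s) \<and> (\<forall>D\<ge>d. Polynomial.coeff P D = 0)"
  shows "F = peval (Suc p) k (filter (\<lambda>y. rkey p k (\<lambda>j. N ^ j) (snd y) < d) xs)"
proof
  fix x
  let ?key = "\<lambda>y. rkey p k (\<lambda>j. N ^ j) (snd y)"
  have coeff: "(\<Sum>y\<leftarrow>xs. if ?key y = D then fst y * monomial_fun p k (snd y) x else 0) = 0" if "D \<ge> d" for D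
  proof -
    obtain P where P: "\<forall>s. F (krow p N s x) = poly P s" "\<forall>D\<ge>d. Polynomial.coeff P D = 0"
      using deg by blast
    have "P = (\<Sum>y\<leftarrow>xs. Polynomial.monom (fst y * monomial_fun p k (snd y) x) (?key y))"
    proof (rule poly_eq_cofinite[of "{}"])
      fix s
      have "poly (\<Sum>y\<leftarrow>ys. Polynomial.monom (fst y * monomial_fun p k (snd y) x) (?key y)) s =
        (\<Sum>y\<leftarrow>ys. fst y * monomial_fun p k (snd y) x * s ^ ?key y)" for ys
        by (induction ys) (auto simp: poly_monom)
      then show "poly P s = poly (\<Sum>y\<leftarrow>xs. Polynomial.monom (fst y * monomial_fun p k (snd y) x) (?key y)) s"
        using P(1) by (simp add: F peval_krow)
    qed simp
    moreover have "Polynomial.coeff (\<Sum>y\<leftarrow>ys. Polynomial.monom (fst y * monomial_fun p k (snd y) x) (?key y)) D =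
        (\<Sum>y\<leftarrow>ys. if ?key y = D then fst y * monomial_fun p k (snd y) x else 0)" for ys
      by (induction ys) auto
    ultimately show ?thesis using P(2) that by metis
  qed
  define g where "g = (\<lambda>y. if ?key y < d then 0 else fst y * monomial_fun (Suc p) k (snd y) x)"
  have "(\<Sum>y\<leftarrow>xs. if ?key y = D then g y else 0) = 0" for D
  proof (cases "D \<ge> d \<and> (\<exists>y0\<in>set xs. ?key y0 = D)")
    case True
    then obtain y0 where y0: "y0 \<in> set xs" "?key y0 = D" by auto
    have "(\<Sum>y\<leftarrow>xs. if ?key y = D then g y else 0) =
        (\<Sum>y\<leftarrow>xs. (\<Prod>j<k. x p j ^ snd y0 p j) * (if ?key y = D then fst y * monomial_fun p k (snd y) x else 0))"
    proof (intro arg_cong[of _ _ sum_list] map_cong refl)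
      fix y assume y: "y \<in> set xs"
      have "snd y p j = snd y0 p j" if "?key y = D" "j < k" for j
        using digits_inj[of k "snd y p" N "snd y0 p" j] bound[OF y] bound[OF y0(1)] that y0(2)
        by (simp add: rkey_def)
      then show "(if ?key y = D then g y else 0) =
        (\<Prod>j<k. x p j ^ snd y0 p j) * (if ?key y = D then fst y * monomial_fun p k (snd y) x else 0)"
        using True by (auto simp: g_def monomial_fun_Suc)
    qed
    also have "\<dots> = 0" using coeff[of D] True by (simp add: sum_list_const_mult)
    finally show ?thesis .
  next
    case False
    then have "(\<Sum>y\<leftarrow>xs. if ?key y = D then g y else 0) = (\<Sum>y\<leftarrow>xs. 0)"
      by (intro arg_cong[of _ _ sum_list] map_cong refl) (auto simp: g_def)
    then show ?thesis by simp
  qed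
  then have "(\<Sum>y\<leftarrow>xs. g y) = 0" by (rule sum_list_group_zero)
  moreover have "F x = peval (Suc p) k (filter (\<lambda>y. ?key y < d) xs) x + (\<Sum>y\<leftarrow>xs. g y)"
    unfolding F g_def by (induction xs) (auto simp: peval_alt)
  ultimately show "F x = peval (Suc p) k (filter (\<lambda>y. ?key y < d) xs) x" by simp
qed

text \<open>Here \<open>d\<close> bounds the degree under \<open>krow\<close>, \<open>h\<close>
  collects the terms of degree \<open>d\<close> without their row monomial, and \<open>b\<close>
  holds the digits of \<open>d\<close>. The bound on sums of adjacent weights leaves room for
  merging two digits. The aim is that \<open>h\<close> is an invariant with one row less and of
  weight \<open>wt - b\<close>.\<close>

locale leading_row =
  fixes p k q N d :: nat and wt b :: "nat \<Rightarrow> nat" and xs :: "(complex \<times> (nat \<Rightarrow> nat \<Rightarrow> nat)) list"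
    and F h :: "(nat \<Rightarrow> nat \<Rightarrow> complex) \<Rightarrow> complex"
  assumes F: "F = peval (Suc p) k xs" "col_inv k F" "row_inv q F" and qp: "q \<le> p"
    and weight: "\<And>y j. y \<in> set xs \<Longrightarrow> j < k \<Longrightarrow> (\<Sum>i<Suc p. snd y i j) = wt j"
    and N: "2 \<le> N" "\<And>c. Suc c < k \<Longrightarrow> wt c + wt (Suc c) < N" "\<And>c. c < k \<Longrightarrow> wt c < N"
    and top: "\<And>y. y \<in> set xs \<Longrightarrow> rkey p k (\<lambda>j. N ^ j) (snd y) \<le> d"
    and h: "h = peval p k (filter (\<lambda>y. rkey p k (\<lambda>j. N ^ j) (snd y) = d) xs)"
    and b: "\<And>j. j < k \<Longrightarrow> b j \<le> wt j" "(\<Sum>j<k. b j * N ^ j) = d"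
begin

lemma digit_le: "y \<in> set xs \<Longrightarrow> j < k \<Longrightarrow> snd y p j \<le> wt j"
  using weight[of y j] by simp

lemma top_digits: "y \<in> set xs \<Longrightarrow> rkey p k (\<lambda>j. N ^ j) (snd y) = d \<Longrightarrow> j < k \<Longrightarrow> snd y p j = b j"
  using digits_inj[of k "snd y p" N b j] digit_le N(3) b le_less_trans by (simp add: rkey_def) blast

lemma h_alt: "h x = (\<Sum>y\<leftarrow>xs. if rkey p k (\<lambda>j. N ^ j) (snd y) = d then fst y * monomial_fun p k (snd y) x else 0)"
  unfolding h using peval_filter[of p k "\<lambda>e. rkey p k (\<lambda>j. N ^ j) e = d" xs x] by simp

lemma h_coeff: "\<exists>P. (\<forall>s. F (krow p N s x) = poly P s) \<and> top_coeff P d (h x)"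
proof -
  let ?M = "\<lambda>y. Polynomial.monom (fst y * monomial_fun p k (snd y) x) (rkey p k (\<lambda>j. N ^ j) (snd y))"
  have "poly (\<Sum>y\<leftarrow>ys. ?M y) s =
        (\<Sum>y\<leftarrow>ys. fst y * monomial_fun p k (snd y) x * s ^ rkey p k (\<lambda>j. N ^ j) (snd y))" for ys s
    by (induction ys) (auto simp: poly_monom)
  then have "\<forall>s. F (krow p N s x) = poly (\<Sum>y\<leftarrow>xs. ?M y) s"
    by (simp add: F peval_krow)
  moreover have "Polynomial.coeff (\<Sum>y\<leftarrow>ys. ?M y) d =
      (\<Sum>y\<leftarrow>ys. if rkey p k (\<lambda>j. N ^ j) (snd y) = d then fst y * monomial_fun p k (snd y) x else 0)" for ys
    by (induction ys) auto
  moreover have "Polynomial.degree (\<Sum>y\<leftarrow>ys. ?M y) \<le> d" if "set ys \<subseteq> set xs" for ys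
    using that
  proof (induction ys)
    case (Cons y ys)
    then show ?case using degree_monom_le[of _ "rkey p k (\<lambda>j. N ^ j) (snd y)"] top[of y]
      by (auto intro!: degree_add_le intro: order_trans)
  qed simp
  ultimately show ?thesis unfolding top_coeff_def h_alt by blast
qed

lemma h_weight: "col_weight k (\<lambda>j. wt j - b j) h"
proof -
  have "monomial_fun p k (snd y) (\<lambda>i j. x i j * t j) = (\<Prod>j<k. t j ^ (wt j - b j)) * monomial_fun p k (snd y) x"
    if "y \<in> set xs" "rkey p k (\<lambda>j. N ^ j) (snd y) = d" for y x t
  proof -
    have "(\<Sum>i<p. snd y i j) = wt j - b j" if "j < k" for j
      using weight[OF \<open>y \<in> set xs\<close> that] top_digits[OF \<open>y \<in> set xs\<close> _ that] \<open>rkey _ _ _ _ = d\<close> by simp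
    then show ?thesis by (simp add: monomial_fun_col_scale)
  qed
  then have "h (\<lambda>i j. x i j * t j) = (\<Sum>y\<leftarrow>xs. (\<Prod>j<k. t j ^ (wt j - b j)) *
      (if rkey p k (\<lambda>j. N ^ j) (snd y) = d then fst y * monomial_fun p k (snd y) x else 0))" for x t
    unfolding h_alt by (intro arg_cong[of _ _ sum_list] map_cong refl) simp
  then show ?thesis by (simp add: col_weight_def h_alt sum_list_const_mult)
qed

text \<open>The operation concerns rows below \<open>q \<le> p\<close>, so it commutes with
  inserting row \<open>p\<close>; equal polynomials have equal top coefficients.\<close>

lemma h_row_inv: "row_inv q h"
  unfolding row_inv_def
proof (intro allI impI)
  fix c c' and s :: complex and x assume c: "c < c'" "c' < q"
  obtain P where P: "\<forall>s. F (krow p N s x) = poly P s" "top_coeff P d (h x)" using h_coeff by blast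
  obtain Q where Q: "\<forall>t. F (krow p N t (rowop c c' s x)) = poly Q t" "top_coeff Q d (h (rowop c c' s x))"
    using h_coeff by blast
  have "krow p N t (rowop c c' s x) = rowop c c' s (krow p N t x)" for t
    using c qp by (auto simp: krow_def rowop_def fun_eq_iff)
  then have "poly P t = poly Q t" for t
    using P(1) Q(1) F(3) c by (simp add: row_inv_def)
  then have "P = Q" by (intro poly_eq_cofinite[of "{}"]) auto
  then show "h (rowop c c' s x) = h x" using P(2) Q(2) by (simp add: top_coeff_def)
qed

text \<open>The column operation also changes row \<open>p\<close>: in the parameter
  \<open>t\<close> it adds \<open>s t ^ N ^ c\<close> to the entry \<open>t ^ N ^ c'\<close>. Since
  \<open>c < c'\<close>, this is of smaller degree, so the top coefficient in \<open>t\<close> feels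
  the operation on the rows above only. \<open>Z\<close> lists the changed entries.\<close>

lemma h_col_inv: "col_inv k h"
  unfolding col_inv_def
proof (intro allI impI)
  fix c c' and s :: complex and x assume c: "c < c'" "c' < k"
  obtain P where P: "\<forall>s. F (krow p N s x) = poly P s" "top_coeff P d (h x)" using h_coeff by blast
  define Z where "Z = (\<lambda>j. Polynomial.monom 1 (N ^ j) + (if j = c' then Polynomial.monom s (N ^ c) else 0))"
  define Q where "Q = (\<lambda>ys. \<Sum>y\<leftarrow>ys. [:fst y * monomial_fun p k (snd y) (colop c c' s x):] * (\<Prod>j<k. Z j ^ snd y p j))"
  have less: "N ^ c < N ^ c'" using c N(1) by (intro power_strict_increasing) auto
  have Z: "top_coeff (Z j) (N ^ j) 1" for j
  proof -
    have "Polynomial.degree (Z j) \<le> N ^ j"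
      unfolding Z_def using less degree_monom_le[of s "N ^ c"]
      by (intro degree_add_le degree_monom_le) (auto intro: order_trans)
    then show ?thesis using less by (auto simp: top_coeff_def Z_def)
  qed
  have tc: "top_coeff ([:fst y * monomial_fun p k (snd y) (colop c c' s x):] * (\<Prod>j<k. Z j ^ snd y p j))
      (rkey p k (\<lambda>j. N ^ j) (snd y)) (fst y * monomial_fun p k (snd y) (colop c c' s x))" for y
    using top_coeff_mult[OF top_coeff_const top_coeff_prod[of k "\<lambda>j. Z j ^ snd y p j", OF top_coeff_power[OF Z]]]
    by (simp add: rkey_def)
  have "poly (Q ys) t = (\<Sum>y\<leftarrow>ys. fst y * monomial_fun p k (snd y) (colop c c' s x) * (\<Prod>j<k. poly (Z j) t ^ snd y p j))" for ys t
    unfolding Q_def by (induction ys) (auto simp: poly_prod poly_power)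
  then have Qp: "poly (Q xs) t = F ((colop c c' s x)(p := \<lambda>j. poly (Z j) t))" for t
    unfolding F peval_row by simp
  have "colop c c' s (krow p N t x) = (colop c c' s x)(p := \<lambda>j. poly (Z j) t)" for t
    by (auto simp: krow_def colop_def Z_def poly_monom fun_eq_iff)
  then have "poly P t = poly (Q xs) t" for t
    using F(2) c P(1) unfolding Qp col_inv_def by metis
  then have "P = Q xs" by (intro poly_eq_cofinite[of "{}"]) auto
  moreover have "Polynomial.coeff (Q ys) d = (\<Sum>y\<leftarrow>ys. if rkey p k (\<lambda>j. N ^ j) (snd y) = d
      then fst y * monomial_fun p k (snd y) (colop c c' s x) else 0)" if "set ys \<subseteq> set xs" for ys
    using that
  proof (induction ys)
    case (Cons y ys)
    have "Polynomial.coeff ([:fst y * monomial_fun p k (snd y) (colop c c' s x):] * (\<Prod>j<k. Z j ^ snd y p j)) d =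
        (if rkey p k (\<lambda>j. N ^ j) (snd y) = d then fst y * monomial_fun p k (snd y) (colop c c' s x) else 0)"
      using top_coeff_coeff[OF tc[of y]] top[of y] Cons.prems by simp
    with Cons show ?case by (simp add: Q_def)
  qed (simp add: Q_def)
  ultimately show "h (colop c c' s x) = h x" using P(2) by (simp add: top_coeff_def h_alt)
qed

lemma sum_split_pair:
  fixes f :: "nat \<Rightarrow> nat"
  assumes "Suc c < k"
  shows "(\<Sum>j<k. f j) = f c + f (Suc c) + (\<Sum>j\<in>{..<k} - {c, Suc c}. f j)"
proof -
  have "(\<Sum>j<k. f j) = f c + (\<Sum>j\<in>{..<k} - {c}. f j)" using assms by (intro sum.remove) auto
  also have "(\<Sum>j\<in>{..<k} - {c}. f j) = f (Suc c) + (\<Sum>j\<in>{..<k} - {c} - {Suc c}. f j)"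
    using assms by (intro sum.remove) auto
  also have "{..<k} - {c} - {Suc c} = {..<k} - {c, Suc c}" by auto
  finally show ?thesis by simp
qed

text \<open>Only the terms of \<^term>\<open>F\<close> whose last row exponents differ from those of the leading term by
  a shift between the columns \<^term>\<open>c\<close> and \<^term>\<open>Suc c\<close> matter. They have the factor \<open>x p c ^ b c\<close>,
  and the quotient is still invariant, with a smaller weight in column \<^term>\<open>c\<close>.\<close>

lemma h_interlacing:
  assumes c: "Suc c < k" and x0: "h x0 \<noteq> 0"
  shows "wt (Suc c) + b c \<le> wt c"
proof (rule ccontr)
  assume "\<not> ?thesis"
  then have less: "wt c - b c < wt (Suc c)" using b(1)[of c] c by simp
  \<comment> \<open>Columns \<open>c\<close> and \<open>c + 1\<close> get the same weight, so the
    key sees only the sum of their exponents, which an operation between these columns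
    preserves.\<close>
  define w where "w = (\<lambda>j. if j = Suc c then N ^ c else N ^ j)"
  define D where "D = (\<Sum>j<k. b j * w j)"
  define S where "S = (\<lambda>y :: complex \<times> (nat \<Rightarrow> nat \<Rightarrow> nat). rkey p k w (snd y) = D)"
  have S: "(\<forall>j<k. j \<noteq> c \<longrightarrow> j \<noteq> Suc c \<longrightarrow> snd y p j = b j) \<and> snd y p c + snd y p (Suc c) = b c + b (Suc c)"
    if y: "y \<in> set xs" "S y" for y
  proof -
    \<comment> \<open>Merging the two exponents into digit \<open>c\<close> rewrites the key for
      \<open>w\<close> as a base \<open>N\<close> expansion; the bound on sums of adjacent weights
      keeps the merged digit below \<open>N\<close>.\<close>
    define m where "m = (\<lambda>e j. if j = c then e c + e (Suc c) else if j = Suc c then 0 else e j :: nat)"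
    have m: "(\<Sum>j<k. m e j * N ^ j) = (\<Sum>j<k. e j * w j)" for e
    proof -
      have "(\<Sum>j\<in>{..<k} - {c, Suc c}. m e j * N ^ j) = (\<Sum>j\<in>{..<k} - {c, Suc c}. e j * w j)"
        by (rule sum.cong) (auto simp: m_def w_def)
      then show ?thesis unfolding sum_split_pair[OF c] by (simp add: m_def w_def algebra_simps)
    qed
    have bd: "m e j < N" if "\<And>j. j < k \<Longrightarrow> e j \<le> wt j" "j < k" for e j
      using that(1)[of c] that(1)[of "Suc c"] that(1)[of j] that(2) c N(2)[OF c] N(3)[OF that(2)] N(1)
      by (auto simp: m_def)
    have "(\<Sum>j<k. m (snd y p) j * N ^ j) = (\<Sum>j<k. m b j * N ^ j)"
      using y(2) unfolding m by (simp add: S_def rkey_def D_def)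
    then have eq: "m (snd y p) j = m b j" if "j < k" for j
      using digits_inj[of k "m (snd y p)" N "m b" j] bd digit_le[OF y(1)] b(1) that by blast
    have "snd y p j = b j" if "j < k" "j \<noteq> c" "j \<noteq> Suc c" for j
      using eq[OF that(1)] that(2,3) by (simp add: m_def)
    then show ?thesis using eq[of c] c by (simp add: m_def)
  qed
  \<comment> \<open>Moving exponents from column \<open>c\<close> to column \<open>c + 1\<close>
    would raise the key above its maximum \<open>d\<close>.\<close>
  have Sle: "b c \<le> snd y p c" if y: "y \<in> set xs" "S y" for y
  proof (rule ccontr)
    assume "\<not> ?thesis"
    then obtain t where t: "b c = snd y p c + t" "t > 0" by (metis less_imp_add_positive not_le)
    have t2: "snd y p (Suc c) = b (Suc c) + t" using S[OF y] t by simp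
    have "(\<Sum>j\<in>{..<k} - {c, Suc c}. snd y p j * N ^ j) = (\<Sum>j\<in>{..<k} - {c, Suc c}. b j * N ^ j)"
      by (rule sum.cong) (use S[OF y] in auto)
    then have "snd y p c * N ^ c + snd y p (Suc c) * N ^ Suc c \<le> b c * N ^ c + b (Suc c) * N ^ Suc c"
      using top[OF y(1)] b(2) unfolding rkey_def sum_split_pair[OF c] by simp
    then have "t * N ^ Suc c \<le> t * N ^ c" unfolding t(1) t2 by (simp add: algebra_simps)
    moreover have "N ^ c < N ^ Suc c" using N(1) by (intro power_strict_increasing) auto
    ultimately show False using t(2) by simp
  qed
  have Stop: "rkey p k (\<lambda>j. N ^ j) (snd y) = d \<longleftrightarrow> S y \<and> snd y p c = b c" if y: "y \<in> set xs" for y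
  proof
    assume d: "rkey p k (\<lambda>j. N ^ j) (snd y) = d"
    have "rkey p k w (snd y) = D"
      unfolding rkey_def D_def by (rule sum.cong) (use top_digits[OF y d] in auto)
    then show "S y \<and> snd y p c = b c" using top_digits[OF y d] c by (auto simp: S_def)
  next
    assume *: "S y \<and> snd y p c = b c"
    then have "snd y p j = b j" if "j < k" for j using S[OF y] that by (cases "j = c"; cases "j = Suc c") auto
    then show "rkey p k (\<lambda>j. N ^ j) (snd y) = d" unfolding rkey_def b(2)[symmetric] by (intro sum.cong) auto
  qed
  \<comment> \<open>A homogeneous component of \<open>F\<close>: scaling entry \<open>j\<close> of
    row \<open>p\<close> by \<open>t ^ w j\<close> commutes with the operation on columns
    \<open>c\<close> and \<open>c + 1\<close>, so the component is still invariant under it.\<close>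
  define G where "G = peval (Suc p) k (filter S xs)"
  have G: "G x = (\<Sum>y\<leftarrow>xs. if rkey p k w (snd y) = D then fst y * monomial_fun (Suc p) k (snd y) x else 0)" for x
    unfolding G_def S_def using peval_filter[of "Suc p" k "\<lambda>e. rkey p k w e = D" xs x] by simp
  have G_inv: "G (colop c (Suc c) s x) = G x" for s x
    unfolding G
  proof (rule power_sum_coeff)
    fix t :: complex assume "t \<noteq> 0"
    have ev: "F (x(p := \<lambda>j. t ^ w j * x p j)) =
        (\<Sum>y\<leftarrow>xs. fst y * monomial_fun (Suc p) k (snd y) x * t ^ rkey p k w (snd y))" for x
      unfolding F peval_row prod_power_rkey monomial_fun_Suc by (simp add: mult.assoc)
    have "colop c (Suc c) s (x(p := \<lambda>j. t ^ w j * x p j)) =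
        (colop c (Suc c) s x)(p := \<lambda>j. t ^ w j * colop c (Suc c) s x p j)"
      by (auto simp: colop_def w_def fun_eq_iff algebra_simps)
    then show "(\<Sum>y\<leftarrow>xs. fst y * monomial_fun (Suc p) k (snd y) (colop c (Suc c) s x) * t ^ rkey p k w (snd y)) =
      (\<Sum>y\<leftarrow>xs. fst y * monomial_fun (Suc p) k (snd y) x * t ^ rkey p k w (snd y))"
      using F(2) c unfolding ev[symmetric] col_inv_def by (metis lessI)
  qed
  define H where "H = (\<lambda>x. \<Sum>y\<leftarrow>filter S xs. fst y * monomial_fun p k (snd y) x *
    (x p c ^ (snd y p c - b c) * x p (Suc c) ^ snd y p (Suc c)))"
  have H: "polyfn (Suc p) k H"
  proof -
    have "polyfn p k (monomial_fun p k e)" for e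
      unfolding polyfn_def by (rule exI[of _ "[(1, e)]"]) (auto simp: peval_def)
    then have mon: "polyfn (Suc p) k (monomial_fun p k e)" for e by (rule polyfn_mono) auto
    show ?thesis unfolding H_def
      by (rule polyfn_sum_list, rule polyfn_mult, rule polyfn_mult[OF polyfn_const mon],
          rule polyfn_mult; rule polyfn_power; rule polyfn_coord) (use c in auto)
  qed
  \<comment> \<open>The entries of row \<open>p\<close> outside the two columns are set to 1; their
    exponents are the fixed numbers \<open>b j\<close>.\<close>
  define R where "R = (\<lambda>z j. if j = c \<or> j = Suc c then z j else 1 :: complex)"
  have GH: "G (x(p := R (x p))) = x p c ^ b c * H x" for x
  proof -
    have "(\<Prod>j<k. R (x p) j ^ snd y p j) = x p c ^ b c * (x p c ^ (snd y p c - b c) * x p (Suc c) ^ snd y p (Suc c))"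
      if y: "y \<in> set xs" "S y" for y
    proof -
      have "(\<Prod>j<k. R (x p) j ^ snd y p j) = (\<Prod>j\<in>{c, Suc c}. x p j ^ snd y p j)"
        by (rule prod.mono_neutral_cong_right) (use c in \<open>auto simp: R_def\<close>)
      also have "\<dots> = x p c ^ snd y p c * x p (Suc c) ^ snd y p (Suc c)" by simp
      also have "x p c ^ snd y p c = x p c ^ b c * x p c ^ (snd y p c - b c)"
        using Sle[OF y] by (simp flip: power_add)
      finally show ?thesis by simp
    qed
    then have "G (x(p := R (x p))) = (\<Sum>y\<leftarrow>filter S xs. x p c ^ b c * (fst y * monomial_fun p k (snd y) x *
        (x p c ^ (snd y p c - b c) * x p (Suc c) ^ snd y p (Suc c))))"
      unfolding G_def peval_row by (intro arg_cong[of _ _ sum_list] map_cong refl) auto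
    then show ?thesis by (simp add: H_def sum_list_const_mult)
  qed
  have H_inv0: "H (colop c (Suc c) s x) = H x" if "x p c \<noteq> 0" for s x
  proof -
    have "colop c (Suc c) s (x(p := R (x p))) = (colop c (Suc c) s x)(p := R (colop c (Suc c) s x p))"
      by (auto simp: colop_def R_def fun_eq_iff)
    then have "x p c ^ b c * H (colop c (Suc c) s x) = x p c ^ b c * H x"
      using GH[of "colop c (Suc c) s x"] GH[of x] G_inv[of s "x(p := R (x p))"] by (simp add: colop_def)
    then show ?thesis using that by simp
  qed
  have H_inv: "H (colop c (Suc c) s x) = H x" for s x
  proof -
    \<comment> \<open>Cancelling \<open>x p c ^ b c\<close> needs a nonzero entry. Varying that
      entry extends the identity to the value zero.\<close>
    define v where "v = (\<lambda>t. x(p := (x p)(c := t)))"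
    have v: "upoly (\<lambda>t. v t i j)" for i j
      unfolding v_def by (cases "i = p"; cases "j = c") (auto intro: upoly_const upoly_id)
    have "H (colop c (Suc c) s (v (x p c))) = H (v (x p c))"
    proof (rule upoly_eq_cofinite[OF upoly_polyfn[OF H] upoly_polyfn[OF H], of _ _ "{0}"])
      show "upoly (\<lambda>t. colop c (Suc c) s (v t) i j)" for i j
        unfolding colop_def by (intro upoly_if upoly_add upoly_mult upoly_const v)
      show "H (colop c (Suc c) s (v t)) = H (v t)" if "t \<notin> {0}" for t
        using that by (intro H_inv0) (simp add: v_def)
    qed (simp_all add: v)
    then show ?thesis by (simp add: v_def)
  qed
  have scale: "H (\<lambda>i j. if j = a then t * x i j else x i j) = t ^ r * H x"
    if a: "a = c \<and> r = wt c - b c \<or> a = Suc c \<and> r = wt (Suc c)" for a r t x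
  proof -
    have "monomial_fun p k e (\<lambda>i j. if j = a then t * x i j else x i j) =
        t ^ (\<Sum>i<p. e i a) * monomial_fun p k e x" for e
    proof -
      have "(\<lambda>i j. if j = a then t * x i j else x i j) = (\<lambda>i j. x i j * (if j = a then t else 1))"
        by (auto simp: fun_eq_iff)
      moreover have "(\<Prod>j<k. (if j = a then t else 1) ^ (\<Sum>i<p. e i j)) =
          (\<Prod>j<k. if j = a then t ^ (\<Sum>i<p. e i j) else 1)" by (rule prod.cong) auto
      ultimately show ?thesis using a c by (auto simp: monomial_fun_col_scale)
    qed
    moreover have "(\<Sum>i<p. snd y i c) + (snd y p c - b c) = wt c - b c"
      "(\<Sum>i<p. snd y i (Suc c)) + snd y p (Suc c) = wt (Suc c)" if "y \<in> set xs" "S y" for y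
      using weight[OF that(1), of c] weight[OF that(1), of "Suc c"] c Sle[OF that] by auto
    then have "t ^ (\<Sum>i<p. snd y i c) * t ^ (snd y p c - b c) = t ^ (wt c - b c)"
      "t ^ (\<Sum>i<p. snd y i (Suc c)) * t ^ snd y p (Suc c) = t ^ wt (Suc c)" if "y \<in> set xs" "S y" for y
      using that by (simp_all flip: power_add)
    ultimately have "H (\<lambda>i j. if j = a then t * x i j else x i j) =
        (\<Sum>y\<leftarrow>filter S xs. t ^ r * (fst y * monomial_fun p k (snd y) x *
          (x p c ^ (snd y p c - b c) * x p (Suc c) ^ snd y p (Suc c))))"
      unfolding H_def using a
      by (intro arg_cong[of _ _ sum_list] map_cong refl) (auto simp: power_mult_distrib mult_ac)
    then show ?thesis by (simp add: H_def sum_list_const_mult)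
  qed
  have "H x = 0" for x
    by (rule dominant_weight_pair[OF H _ H_inv scale scale less]) auto
  \<comment> \<open>With 0 in column \<open>c\<close> and 1 elsewhere only the terms with exponent
    exactly \<open>b c\<close> survive, and these are the leading terms.\<close>
  moreover have "H (x0(p := \<lambda>j. if j = c then 0 else 1)) = h x0"
  proof -
    have "H (x0(p := \<lambda>j. if j = c then 0 else 1)) = (\<Sum>y\<leftarrow>xs. if S y then fst y * monomial_fun p k (snd y) x0 *
        0 ^ (snd y p c - b c) else 0)"
      unfolding H_def monomial_fun_upd by (simp add: sum_list_map_filter')
    also have "\<dots> = h x0"
      unfolding h_alt
    proof (intro arg_cong[of _ _ sum_list] map_cong refl)
      fix y assume "y \<in> set xs"
      from Stop[OF this] Sle[OF this]
      show "(if S y then fst y * monomial_fun p k (snd y) x0 * 0 ^ (snd y p c - b c) else 0) =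
        (if rkey p k (\<lambda>j. N ^ j) (snd y) = d then fst y * monomial_fun p k (snd y) x0 else 0)"
        by (cases "S y") (auto simp: power_0_left dest: le_antisym)
    qed
    finally show ?thesis .
  qed
  ultimately show False using x0 by simp
qed

end

lemma rlen_length_eq: "length (filter (\<lambda>R. length R = Suc c) Rs) + rlen Rs (Suc c) = rlen Rs c"
  by (induction Rs) auto

text \<open>Induction on a bound for the degree under \<open>krow\<close>. By the hypothesis for
  \<open>p\<close> rows the top coefficient \<open>h\<close> is a combination of products of minors.
  Interlacing allows each product to be extended by row \<open>p\<close> so that the old product
  becomes its top coefficient, and subtracting the extended combination lowers the degree.\<close>

lemma minor_span_Suc:
  assumes qp: "q \<le> p"
    and IH: "\<And>F wt. polyfn p k F \<Longrightarrow> col_inv k F \<Longrightarrow> row_inv q F \<Longrightarrow> col_weight k wt F \<Longrightarrow> minor_span q p k wt F"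
    and "polyfn (Suc p) k F" "col_inv k F" "row_inv q F" "col_weight k wt F"
  shows "minor_span q (Suc p) k wt F"
proof -
  \<comment> \<open>Larger than every sum of two adjacent weights, and at least 2 so that the powers
    of \<open>N\<close> are distinct.\<close>
  define N where "N = 2 + 2 * (\<Sum>j<k. wt j)"
  have wt_le: "wt j \<le> (\<Sum>j<k. wt j)" if "j < k" for j using that by (intro member_le_sum) auto
  have N: "2 \<le> N" "\<And>c. Suc c < k \<Longrightarrow> wt c + wt (Suc c) < N" "\<And>c. c < k \<Longrightarrow> wt c < N"
  proof -
    show "2 \<le> N" by (simp add: N_def)
    show "wt c + wt (Suc c) < N" if "Suc c < k" for c using wt_le[of c] wt_le[of "Suc c"] that by (simp add: N_def)
    show "wt c < N" if "c < k" for c using wt_le[of c] that by (simp add: N_def)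
  qed
  have claim: "minor_span q (Suc p) k wt F"
    if "polyfn (Suc p) k F" "col_inv k F" "row_inv q F" "col_weight k wt F"
      and "\<And>x. \<exists>P. (\<forall>s. F (krow p N s x) = poly P s) \<and> (\<forall>D\<ge>d. Polynomial.coeff P D = 0)"
    for F d
    using that
  proof (induction d arbitrary: F)
    case 0
    obtain xs where xs: "F = peval (Suc p) k xs" "\<And>c e j. (c, e) \<in> set xs \<Longrightarrow> j < k \<Longrightarrow> (\<Sum>i<Suc p. e i j) = wt j"
      using weight_list[OF 0(1,4)] by metis
    have "snd y p j < N" if "y \<in> set xs" "j < k" for y j
      using xs(2)[of "fst y" "snd y" j] that N(3)[of j] by simp
    from peval_truncate[OF xs(1) this 0(5)] have "F = (\<lambda>x. 0)" by (simp add: peval_def fun_eq_iff)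
    then show ?case using minor_span_zero by simp
  next
    case (Suc d)
    obtain xs where xs: "F = peval (Suc p) k xs" "\<And>c e j. (c, e) \<in> set xs \<Longrightarrow> j < k \<Longrightarrow> (\<Sum>i<Suc p. e i j) = wt j"
      using weight_list[OF Suc.prems(1,4)] by metis
    have bd: "snd y p j < N" if "y \<in> set xs" "j < k" for y j
      using xs(2)[of "fst y" "snd y" j] that N(3)[of j] by simp
    define ys where "ys = filter (\<lambda>y. rkey p k (\<lambda>j. N ^ j) (snd y) < Suc d) xs"
    have Fys: "F = peval (Suc p) k ys" unfolding ys_def by (rule peval_truncate[OF xs(1) bd Suc.prems(5)])
    have weight: "(\<Sum>i<Suc p. snd y i j) = wt j" if "y \<in> set ys" "j < k" for y j
      using that xs(2)[of "fst y" "snd y" j] by (simp add: ys_def)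
    have top: "rkey p k (\<lambda>j. N ^ j) (snd y) \<le> d" if "y \<in> set ys" for y
      using that by (simp add: ys_def)
    define h where "h = peval p k (filter (\<lambda>y. rkey p k (\<lambda>j. N ^ j) (snd y) = d) ys)"
    show ?case
    proof (cases "\<exists>y0\<in>set ys. rkey p k (\<lambda>j. N ^ j) (snd y0) = d")
      case False
      then have less: "rkey p k (\<lambda>j. N ^ j) (snd y) < d" if "y \<in> set ys" for y
        using top[OF that] that le_neq_implies_less by blast
      have "\<exists>P. (\<forall>s. F (krow p N s x) = poly P s) \<and> (\<forall>D\<ge>d. Polynomial.coeff P D = 0)" for x
      proof -
        let ?M = "\<lambda>y. Polynomial.monom (fst y * monomial_fun p k (snd y) x) (rkey p k (\<lambda>j. N ^ j) (snd y))"
        have "poly (\<Sum>y\<leftarrow>zs. ?M y) s =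
            (\<Sum>y\<leftarrow>zs. fst y * monomial_fun p k (snd y) x * s ^ rkey p k (\<lambda>j. N ^ j) (snd y))" for zs s
          by (induction zs) (auto simp: poly_monom)
        then have "\<forall>s. F (krow p N s x) = poly (\<Sum>y\<leftarrow>ys. ?M y) s" by (simp add: Fys peval_krow)
        moreover have "Polynomial.coeff (\<Sum>y\<leftarrow>zs. ?M y) D = 0" if "set zs \<subseteq> set ys" "D \<ge> d" for zs D
          using that(1)
        proof (induction zs)
          case (Cons y zs)
          then show ?case using less[of y] that(2) by simp
        qed simp
        ultimately show ?thesis by blast
      qed
      with Suc.IH[OF Suc.prems(1-4)] show ?thesis by blast
    next
      case True
      then obtain y0 where y0: "y0 \<in> set ys" "rkey p k (\<lambda>j. N ^ j) (snd y0) = d" by auto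
      \<comment> \<open>The digits of \<open>d\<close>, hence the exponents of row \<open>p\<close>
        in every term of degree \<open>d\<close>.\<close>
      define b where "b = (\<lambda>j. if j < k then snd y0 p j else 0)"
      have b_le: "b j \<le> wt j" if "j < k" for j using weight[OF y0(1) that] that by (simp add: b_def)
      have b_sum: "(\<Sum>j<k. b j * N ^ j) = d" using y0(2) by (simp add: rkey_def b_def)
      interpret L: leading_row p k q N d wt b ys F h
        by (unfold_locales; fact Fys Suc.prems(2) Suc.prems(3) qp weight N top b_le b_sum h_def)
      have hp: "polyfn p k h" unfolding h_def polyfn_def by blast
      from IH[OF hp L.h_col_inv L.h_row_inv L.h_weight] obtain zs where zs:
        "\<And>z R. z \<in> set zs \<Longrightarrow> R \<in> set (snd z) \<Longrightarrow> good_row q p R \<and> length R \<le> k"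
        "\<And>z j. z \<in> set zs \<Longrightarrow> j < k \<Longrightarrow> rlen (snd z) j = wt j - b j"
        "\<And>x. h x = (\<Sum>z\<leftarrow>zs. fst z * mprod (snd z) x)"
        unfolding minor_span_def by blast
      show ?thesis
      proof (cases "\<exists>x0. h x0 \<noteq> 0")
        case False
        have "\<exists>P. (\<forall>s. F (krow p N s x) = poly P s) \<and> (\<forall>D\<ge>d. Polynomial.coeff P D = 0)" for x
        proof -
          obtain P where P: "\<forall>s. F (krow p N s x) = poly P s" "top_coeff P d (h x)" using L.h_coeff by blast
          have "Polynomial.coeff P D = 0" if "D \<ge> d" for D
            using P(2) that False by (cases "D = d") (auto simp: top_coeff_def coeff_eq_0)
          with P(1) show ?thesis by blast
        qed
        with Suc.IH[OF Suc.prems(1-4)] show ?thesis by blast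
      next
        case True
        then obtain x0 where x0: "h x0 \<noteq> 0" by auto
        have "\<exists>Rs'. (\<forall>R\<in>set Rs'. good_row q (Suc p) R \<and> length R \<le> k) \<and> (\<forall>j<k. rlen Rs' j = wt j) \<and>
          (\<forall>x. \<exists>P. (\<forall>s. mprod Rs' (krow p N s x) = poly P s) \<and> top_coeff P d (mprod (snd z) x))"
          if z: "z \<in> set zs" for z
        proof -
          \<comment> \<open>Empty lists have minor 1. They are put in so that \<open>b 0\<close> of
            them can be extended to \<open>[p]\<close>.\<close>
          define Rs where "Rs = replicate (b 0) [] @ snd z"
          have good: "good_row q p R \<and> length R \<le> k" if "R \<in> set Rs" for R
            using that zs(1)[OF z] good_row_Nil by (auto simp: Rs_def split: if_splits)
          have rl: "rlen Rs j = rlen (snd z) j" for j by (simp add: Rs_def rlen_replicate)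
          have "b j \<le> length (filter (\<lambda>R. length R = j) Rs)" for j
          proof (cases j)
            case 0
            then show ?thesis by (simp add: Rs_def)
          next
            case (Suc c)
            show ?thesis
            proof (cases "j < k")
              case True
              \<comment> \<open>There are \<open>(wt c - b c) - (wt (c + 1) - b (c + 1))\<close>
                lists of length \<open>c + 1\<close>, and interlacing makes this number at least
                \<open>b (c + 1)\<close>.\<close>
              then have "wt (Suc c) + b c \<le> wt c" using L.h_interlacing[OF _ x0] Suc by simp
              moreover have "length (filter (\<lambda>R. length R = Suc c) Rs) + (wt (Suc c) - b (Suc c)) = wt c - b c"
                using rlen_length_eq[of c Rs] zs(2)[OF z] True Suc by (simp add: rl)
              ultimately show ?thesis using b_le[of c] b_le[of "Suc c"] True Suc by simp
            qed (simp add: b_def)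
          qed
          moreover have "b j = 0" if "k \<le> j" for j using that by (simp add: b_def)
          ultimately have "\<exists>Rs'. (\<forall>R\<in>set Rs'. good_row q (Suc p) R \<and> length R \<le> k) \<and> (\<forall>j. rlen Rs' j = rlen Rs j + b j) \<and>
              (\<forall>x. \<exists>P. (\<forall>s. mprod Rs' (krow p N s x) = poly P s) \<and> top_coeff P (\<Sum>j<k. b j * N ^ j) (mprod Rs x))"
            by (intro extend_rows[OF good qp N(1)])
          then obtain Rs' where Rs': "\<forall>R\<in>set Rs'. good_row q (Suc p) R \<and> length R \<le> k"
            "\<forall>j. rlen Rs' j = rlen Rs j + b j"
            "\<forall>x. \<exists>P. (\<forall>s. mprod Rs' (krow p N s x) = poly P s) \<and> top_coeff P (\<Sum>j<k. b j * N ^ j) (mprod Rs x)"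
            by (elim exE conjE)
          have eq: "mprod Rs x = mprod (snd z) x" for x
          proof -
            have "mprod (replicate n []) x = 1" for n by (induction n) auto
            then show ?thesis by (simp add: Rs_def)
          qed
          have "\<forall>j<k. rlen Rs' j = wt j"
            using Rs'(2) rl zs(2)[OF z] b_le by simp
          then show ?thesis by (intro exI[of _ Rs'] conjI Rs'(1) Rs'(3)[unfolded b_sum eq])
        qed
        then have "\<exists>ext. \<forall>z\<in>set zs. (\<forall>R\<in>set (ext z). good_row q (Suc p) R \<and> length R \<le> k) \<and>
          (\<forall>j<k. rlen (ext z) j = wt j) \<and>
          (\<forall>x. \<exists>P. (\<forall>s. mprod (ext z) (krow p N s x) = poly P s) \<and> top_coeff P d (mprod (snd z) x))"
          by (intro bchoice ballI)
        then obtain ext where ext0: "\<forall>z\<in>set zs. (\<forall>R\<in>set (ext z). good_row q (Suc p) R \<and> length R \<le> k) \<and>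
          (\<forall>j<k. rlen (ext z) j = wt j) \<and>
          (\<forall>x. \<exists>P. (\<forall>s. mprod (ext z) (krow p N s x) = poly P s) \<and> top_coeff P d (mprod (snd z) x))"
          by (elim exE)
        have ext: "R \<in> set (ext z) \<Longrightarrow> good_row q (Suc p) R \<and> length R \<le> k"
          "j < k \<Longrightarrow> rlen (ext z) j = wt j"
          "\<exists>P. (\<forall>s. mprod (ext z) (krow p N s x) = poly P s) \<and> top_coeff P d (mprod (snd z) x)"
          if "z \<in> set zs" for z R j x
          using bspec[OF ext0 that] by auto
        define G where "G = (\<lambda>x. \<Sum>y\<leftarrow>map (\<lambda>z. (fst z, ext z)) zs. fst y * mprod (snd y) x)"
        have G: "minor_span q (Suc p) k wt G"
          unfolding minor_span_def G_def
          by (rule exI[of _ "map (\<lambda>z. (fst z, ext z)) zs"]) (use ext(1,2) in auto)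
        note Gp = minor_span_props[OF G le_SucI[OF qp]]
        have G_top: "\<exists>P. (\<forall>s. G (krow p N s x) = poly P s) \<and> top_coeff P d (h x)" for x
        proof -
          have "\<exists>P. (\<forall>s. (\<Sum>z\<leftarrow>vs. fst z * mprod (ext z) (krow p N s x)) = poly P s) \<and>
              top_coeff P d (\<Sum>z\<leftarrow>vs. fst z * mprod (snd z) x)" if "set vs \<subseteq> set zs" for vs
            using that
          proof (induction vs)
            case Nil
            show ?case by (rule exI[of _ 0]) (simp add: top_coeff_def)
          next
            case (Cons z vs)
            then obtain P where P: "\<forall>s. (\<Sum>z\<leftarrow>vs. fst z * mprod (ext z) (krow p N s x)) = poly P s"
              "top_coeff P d (\<Sum>z\<leftarrow>vs. fst z * mprod (snd z) x)" by auto
            obtain Q where Q: "\<forall>s. mprod (ext z) (krow p N s x) = poly Q s" "top_coeff Q d (mprod (snd z) x)"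
              using ext(3)[of z x] Cons.prems by auto
            show ?case
              by (rule exI[of _ "Polynomial.smult (fst z) Q + P"])
                (use P Q in \<open>auto simp: top_coeff_def intro!: degree_add_le degree_smult_le[THEN order_trans]\<close>)
          qed
          from this[OF order_refl] show ?thesis by (simp add: G_def zs(3) comp_def)
        qed
        have "minor_span q (Suc p) k wt (\<lambda>x. F x - G x)"
        proof (rule Suc.IH)
          show "polyfn (Suc p) k (\<lambda>x. F x - G x)" by (rule polyfn_diff[OF Suc.prems(1) Gp(1)])
          show "col_inv k (\<lambda>x. F x - G x)" by (rule col_inv_diff[OF Suc.prems(2) Gp(2)])
          show "row_inv q (\<lambda>x. F x - G x)" by (rule row_inv_diff[OF Suc.prems(3) Gp(3)])
          show "col_weight k wt (\<lambda>x. F x - G x)" by (rule col_weight_diff[OF Suc.prems(4) Gp(4)])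
          fix x
          obtain P where P: "\<forall>s. F (krow p N s x) = poly P s" "top_coeff P d (h x)" using L.h_coeff by blast
          obtain Q where Q: "\<forall>s. G (krow p N s x) = poly Q s" "top_coeff Q d (h x)" using G_top by blast
          have "Polynomial.coeff (P - Q) D = 0" if "D \<ge> d" for D
            using P(2) Q(2) that by (cases "D = d") (auto simp: top_coeff_def coeff_eq_0)
          then show "\<exists>P. (\<forall>s. F (krow p N s x) - G (krow p N s x) = poly P s) \<and> (\<forall>D\<ge>d. Polynomial.coeff P D = 0)"
            using P(1) Q(1) by (intro exI[of _ "P - Q"]) auto
        qed
        from minor_span_add[OF this G] show ?thesis by simp
      qed
    qed
  qed
  show ?thesis
  \<comment> \<open>No exponent in row \<open>p\<close> exceeds the weight of its column, so the
    largest possible key has the digits \<open>wt\<close>.\<close>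
  proof (rule claim[OF assms(3-6), where d = "Suc (\<Sum>j<k. wt j * N ^ j)"])
    fix x
    obtain xs where xs: "F = peval (Suc p) k xs" "\<And>c e j. (c, e) \<in> set xs \<Longrightarrow> j < k \<Longrightarrow> (\<Sum>i<Suc p. e i j) = wt j"
      using weight_list[OF assms(3,6)] by metis
    have weight: "(\<Sum>i<Suc p. snd y i j) = wt j" if "y \<in> set xs" "j < k" for y j
      using that xs(2)[of "fst y" "snd y" j] by simp
    have top: "rkey p k (\<lambda>j. N ^ j) (snd y) \<le> (\<Sum>j<k. wt j * N ^ j)" if "y \<in> set xs" for y
      unfolding rkey_def by (intro sum_mono mult_right_mono) (use weight[OF that] in fastforce)+
    interpret L: leading_row p k q N "\<Sum>j<k. wt j * N ^ j" wt wt xs F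
        "peval p k (filter (\<lambda>y. rkey p k (\<lambda>j. N ^ j) (snd y) = (\<Sum>j<k. wt j * N ^ j)) xs)"
      by (unfold_locales; (fact xs(1) assms(4) assms(5) qp weight N top refl | rule order_refl))
    show "\<exists>P. (\<forall>s. F (krow p N s x) = poly P s) \<and> (\<forall>D\<ge>Suc (\<Sum>j<k. wt j * N ^ j). Polynomial.coeff P D = 0)"
      using L.h_coeff[of x] by (auto simp: top_coeff_def intro!: coeff_eq_0)
  qed
qed

text \<open>Rows are added starting from \<open>p = q\<close>. For \<open>k \<le> q\<close> the
  start is the square case. For \<open>q = 0\<close> there are no entries, and a nonzero constant
  has weight zero; this case covers functions with column invariance alone, such as those in
  \<open>rho\<close>.\<close>

theorem minor_span_invariant:
  assumes "q = 0 \<or> k \<le> q" "q \<le> p"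
    and "polyfn p k F" "col_inv k F" "row_inv q F" "col_weight k wt F"
  shows "minor_span q p k wt F"
  using assms(2-)
proof (induction p arbitrary: F wt rule: dec_induct)
  case base
  show ?case
  proof (cases "k \<le> q")
    case True
    then show ?thesis using base by (intro minor_span_square)
  next
    case False
    then have q: "q = 0" using assms(1) by simp
    have const: "F x = F y" for x y using polyfn_cong[OF base(1)] q by simp
    show ?thesis
    proof (cases "F undefined = 0")
      case True
      then have "F = (\<lambda>x. 0)" using const[of _ undefined] by (simp add: fun_eq_iff)
      then show ?thesis using minor_span_zero by simp
    next
      case F0: False
      have "wt j = 0" if j: "j < k" for j
      proof -
        have "F (\<lambda>i j'. if j' = j then 2 * undefined i j' else undefined i j') = 2 ^ wt j * F undefined"
          by (rule col_weight_single[OF base(4) j]) simp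
        moreover have "F (\<lambda>i j'. if j' = j then 2 * undefined i j' else undefined i j') = F undefined"
          by (rule const)
        ultimately have "F undefined = 2 ^ wt j * F undefined" by (rule trans[OF sym, rotated])
        then have "(2 :: complex) ^ wt j = 1" using F0 by simp
        then have "norm ((2 :: complex) ^ wt j) = 1" by simp
        then show ?thesis using one_less_power[of "2 :: real" "wt j"] by (cases "wt j = 0") (auto simp: norm_power)
      qed
      then show ?thesis unfolding minor_span_def
        by (intro exI[of _ "[(F undefined, [])]"]) (use const in auto)
    qed
  qed
next
  case (step p)
  then show ?case by (intro minor_span_Suc[of q p k F wt]) auto
qed

section \<open>A positive kernel\<close>

text \<open>Gram-Schmidt along the coordinates in \<open>A\<close>. The elements of \<open>W\<close>
  that vanish at the new coordinate are handled by induction; if some \<open>w1\<close> does not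
  vanish there, its part orthogonal to them spans the rest. Only the coordinates in \<open>A\<close>
  are compared, so \<open>W\<close> itself may be infinite-dimensional.\<close>

lemma orthogonal_projection_exists:
  fixes W :: "('a \<Rightarrow> complex) set"
  assumes "finite A" "(\<lambda>_. 0) \<in> W"
    and "\<And>f g c. f \<in> W \<Longrightarrow> g \<in> W \<Longrightarrow> (\<lambda>i. f i + c * g i) \<in> W"
  shows "\<exists>w\<in>W. \<forall>x\<in>W. (\<Sum>i\<in>A. (a i - w i) * cnj (x i)) = 0"
  using assms
proof (induction A arbitrary: W a)
  case empty
  then show ?case by auto
next
  case (insert z A)
  show ?case
  proof (cases "\<forall>w\<in>W. w z = 0")
    case True
    obtain w where "w \<in> W" "\<forall>x\<in>W. (\<Sum>i\<in>A. (a i - w i) * cnj (x i)) = 0"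
      using insert.IH[OF insert.prems, of a] by auto
    with True insert.hyps show ?thesis by (intro bexI[of _ w] ballI) simp_all
  next
    case False
    then obtain w1 where w1: "w1 \<in> W" "w1 z \<noteq> 0" by auto
    define W0 where "W0 = {w \<in> W. w z = 0}"
    have W0: "(\<lambda>_. 0) \<in> W0" "\<And>f g c. f \<in> W0 \<Longrightarrow> g \<in> W0 \<Longrightarrow> (\<lambda>i. f i + c * g i) \<in> W0"
      using insert.prems by (auto simp: W0_def)
    obtain p1 where p1: "p1 \<in> W0" "\<forall>x\<in>W0. (\<Sum>i\<in>A. (w1 i - p1 i) * cnj (x i)) = 0"
      using insert.IH[OF W0, of w1] by auto
    obtain p0 where p0: "p0 \<in> W0" "\<forall>x\<in>W0. (\<Sum>i\<in>A. (a i - p0 i) * cnj (x i)) = 0"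
      using insert.IH[OF W0, of a] by auto
    \<comment> \<open>Orthogonal to \<open>W0\<close> and nonzero at \<open>z\<close>, so its norm
      over \<open>insert z A\<close> is positive.\<close>
    define u where "u = (\<lambda>i. w1 i + (- 1) * p1 i)"
    have u: "u \<in> W" "u z \<noteq> 0"
      using insert.prems(2)[of w1 p1 "- 1"] w1 p1(1) by (auto simp: u_def W0_def)
    define n where "n = (\<Sum>i\<in>insert z A. u i * cnj (u i))"
    define S where "S = (\<Sum>i\<in>insert z A. (cmod (u i))\<^sup>2)"
    have "n = of_real S" unfolding S_def
      by (simp only: n_def complex_norm_square[symmetric] of_real_sum)
    moreover have "S > 0" unfolding S_def
      using insert.hyps u(2) by (auto intro!: add_pos_nonneg sum_nonneg)
    ultimately have n: "n \<noteq> 0" by simp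
    define l where "l = (\<Sum>i\<in>insert z A. (a i - p0 i) * cnj (u i)) / n"
    show ?thesis
    proof (intro bexI[of _ "\<lambda>i. p0 i + l * u i"] ballI)
      show "(\<lambda>i. p0 i + l * u i) \<in> W" using insert.prems(2) p0(1) u(1) by (auto simp: W0_def)
      fix x assume x: "x \<in> W"
      define m where "m = x z / u z"
      define x' where "x' = (\<lambda>i. x i + (- m) * u i)"
      have x': "x' \<in> W0" using insert.prems(2)[of x u "- m"] x u by (auto simp: x'_def W0_def m_def)
      have cx: "cnj (x i) = cnj (x' i) + cnj m * cnj (u i)" for i by (simp add: x'_def)
      have x'z: "x' z = 0" using x' by (simp add: W0_def)
      have o1: "(\<Sum>i\<in>insert z A. (a i - p0 i) * cnj (x' i)) = 0"
        using p0(2) x' insert.hyps x'z by simp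
      have o2: "(\<Sum>i\<in>insert z A. u i * cnj (x' i)) = 0"
        using p1(2) x' insert.hyps x'z by (simp add: u_def)
      have "(\<Sum>i\<in>insert z A. (a i - (p0 i + l * u i)) * cnj (x i)) =
         (\<Sum>i\<in>insert z A. (a i - p0 i) * cnj (x' i)) - l * (\<Sum>i\<in>insert z A. u i * cnj (x' i)) +
         cnj m * ((\<Sum>i\<in>insert z A. (a i - p0 i) * cnj (u i)) - l * n)"
        unfolding n_def cx sum_distrib_left sum_subtractf[symmetric] sum.distrib[symmetric]
        by (rule sum.cong) (auto simp: algebra_simps)
      also have "\<dots> = 0" using n by (simp add: o1 o2 l_def)
      finally show "(\<Sum>i\<in>insert z A. (a i - (p0 i + l * u i)) * cnj (x i)) = 0" .
    qed
  qed
qed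

section \<open>The Cauchy-Binet formula\<close>

definition row_lists :: "nat \<Rightarrow> nat \<Rightarrow> nat list set" where
  "row_lists p r = {R. set R \<subseteq> {..<p} \<and> length R = r}"

lemma finite_row_lists: "finite (row_lists p r)"
  unfolding row_lists_def by (rule finite_lists_length_eq) simp

lemma prod_sum_row_lists:
  fixes g :: "nat \<Rightarrow> nat \<Rightarrow> complex"
  shows "(\<Prod>i<r. \<Sum>s<p. g i s) = (\<Sum>R\<in>row_lists p r. \<Prod>i<r. g i (R ! i))"
proof (induction r arbitrary: g)
  case 0
  have "row_lists p 0 = {[]}" by (auto simp: row_lists_def)
  then show ?case by simp
next
  case (Suc r)
  have im: "row_lists p (Suc r) = (\<lambda>(s, R). s # R) ` ({..<p} \<times> row_lists p r)"
    by (auto simp: row_lists_def image_iff length_Suc_conv)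
  have inj: "inj_on (\<lambda>(s, R). s # R) ({..<p} \<times> row_lists p r)" by (auto simp: inj_on_def)
  have "(\<Sum>R\<in>row_lists p (Suc r). \<Prod>i<Suc r. g i (R ! i)) =
      (\<Sum>(s, R)\<in>{..<p} \<times> row_lists p r. g 0 s * (\<Prod>i<r. g (Suc i) (R ! i)))"
    unfolding im sum.reindex[OF inj] prod.lessThan_Suc_shift by (simp add: case_prod_unfold)
  also have "\<dots> = (\<Sum>s<p. g 0 s) * (\<Sum>R\<in>row_lists p r. \<Prod>i<r. g (Suc i) (R ! i))"
    by (simp add: sum.cartesian_product[symmetric] sum_product)
  finally show ?case unfolding prod.lessThan_Suc_shift Suc.IH by simp
qed

lemma minor_expand_columns:
  "minor R x = (\<Sum>\<pi> | \<pi> permutes {0..<length R}. signof \<pi> * (\<Prod>l<length R. x (R ! \<pi> l) l))"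
proof -
  have "(\<Prod>l<length R. mat (length R) (length R) (\<lambda>(j, l). x (R ! j) l) $$ (\<pi> l, l)) = (\<Prod>l<length R. x (R ! \<pi> l) l)"
    if "\<pi> permutes {0..<length R}" for \<pi>
  proof (rule prod.cong)
    fix l assume "l \<in> {..<length R}"
    moreover from this have "\<pi> l < length R" using permutes_in_image[OF that, of l] by simp
    ultimately show "mat (length R) (length R) (\<lambda>(j, l). x (R ! j) l) $$ (\<pi> l, l) = x (R ! \<pi> l) l" by simp
  qed simp
  then show ?thesis unfolding minor_def by (subst det_col) auto
qed

lemma minor_permute:
  assumes "\<pi> permutes {0..<length R}"
  shows "minor (map (\<lambda>i. R ! \<pi> i) [0..<length R]) x = signof \<pi> * minor R x"
proof -
  let ?r = "length R"
  let ?A = "mat ?r ?r (\<lambda>(j, l). x (R ! j) l)"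
  have "mat ?r ?r (\<lambda>(j, l). x (map (\<lambda>i. R ! \<pi> i) [0..<?r] ! j) l) = mat ?r ?r (\<lambda>(i, j). ?A $$ (\<pi> i, j))"
    using permutes_in_image[OF assms] by (intro eq_matI) auto
  then show ?thesis using det_permute_rows[of ?A ?r \<pi>] assms by (simp add: minor_def)
qed

definition gram :: "nat \<Rightarrow> (nat \<Rightarrow> nat \<Rightarrow> complex) \<Rightarrow> (nat \<Rightarrow> nat \<Rightarrow> complex) \<Rightarrow> nat \<Rightarrow> nat \<Rightarrow> complex" where
  "gram p y x = (\<lambda>i l. \<Sum>s<p. y s i * x s l)"

text \<open>The sum runs over all row lists instead of the increasing ones, whence the factor
  \<open>fact r\<close>. Expanding the left determinant pairs the entries of \<open>y\<close> with
  the identity permutation; reindexing the row lists by any \<pi> produces the sign from the minor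
  of \<open>x\<close>, and summing over \<pi> assembles the minor of \<open>y\<close>.\<close>

lemma Cauchy_Binet:
  "fact r * minor [0..<r] (gram p y x) = (\<Sum>R\<in>row_lists p r. minor R y * minor R x)"
proof -
  let ?P = "{\<pi>. \<pi> permutes {0..<r}}"
  let ?Y = "\<lambda>R \<pi>. \<Prod>l<r. y (R ! \<pi> l) l"
  have step: "minor [0..<r] (gram p y x) = (\<Sum>R\<in>row_lists p r. (\<Prod>i<r. y (R ! i) i) * minor R x)"
  proof -
    have "minor [0..<r] (gram p y x) =
        (\<Sum>\<pi>\<in>?P. \<Sum>R\<in>row_lists p r. signof \<pi> * (\<Prod>i<r. y (R ! i) i * x (R ! i) (\<pi> i)))"
      unfolding minor_expand gram_def
      by (simp add: atLeast0LessThan prod_sum_row_lists sum_distrib_left)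
    also have "\<dots> = (\<Sum>R\<in>row_lists p r. \<Sum>\<pi>\<in>?P. signof \<pi> * (\<Prod>i<r. y (R ! i) i * x (R ! i) (\<pi> i)))"
      by (rule sum.swap)
    also have "\<dots> = (\<Sum>R\<in>row_lists p r. (\<Prod>i<r. y (R ! i) i) * minor R x)"
      by (rule sum.cong)
        (auto simp: row_lists_def minor_expand prod.distrib sum_distrib_left mult_ac atLeast0LessThan)
    finally show ?thesis .
  qed
  have perm: "minor [0..<r] (gram p y x) = (\<Sum>R\<in>row_lists p r. signof \<pi> * ?Y R \<pi> * minor R x)"
    if pi: "\<pi> permutes {0..<r}" for \<pi>
  proof -
    define T where "T = (\<lambda>\<pi> (R :: nat list). map (\<lambda>i. R ! \<pi> i) [0..<r])"
    have lt: "\<pi> i < r" if "\<pi> permutes {0..<r}" "i < r" for \<pi> i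
      using permutes_in_image[OF that(1), of i] that(2) by simp
    have T: "T \<pi> R \<in> row_lists p r" if R: "R \<in> row_lists p r" and pi: "\<pi> permutes {0..<r}" for \<pi> R
    proof -
      have "R ! \<pi> i < p" if "i < r" for i
        using R lt[OF pi that] nth_mem[of "\<pi> i" R] by (simp add: row_lists_def subset_iff)
      then show ?thesis by (auto simp: T_def row_lists_def)
    qed
    have inv: "T (Hilbert_Choice.inv \<pi>) (T \<pi> R) = R" "T \<pi> (T (Hilbert_Choice.inv \<pi>) R) = R"
      if "R \<in> row_lists p r" for R
    proof -
      have len: "length R = r" using that by (simp add: row_lists_def)
      show "T (Hilbert_Choice.inv \<pi>) (T \<pi> R) = R"
        by (rule nth_equalityI) (simp_all add: T_def len lt[OF permutes_inv[OF pi]] permutes_inverses[OF pi])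
      show "T \<pi> (T (Hilbert_Choice.inv \<pi>) R) = R"
        by (rule nth_equalityI) (simp_all add: T_def len lt[OF pi] permutes_inverses[OF pi])
    qed
    have "(\<Sum>R\<in>row_lists p r. (\<Prod>i<r. y (R ! i) i) * minor R x) =
        (\<Sum>R\<in>row_lists p r. (\<Prod>i<r. y (T \<pi> R ! i) i) * minor (T \<pi> R) x)"
      by (rule sum.reindex_bij_witness[of _ "T \<pi>" "T (Hilbert_Choice.inv \<pi>)"])
        (simp_all only: T[OF _ pi] T[OF _ permutes_inv[OF pi]] inv)
    also have "\<dots> = (\<Sum>R\<in>row_lists p r. signof \<pi> * ?Y R \<pi> * minor R x)"
    proof (rule sum.cong)
      fix R assume "R \<in> row_lists p r"
      then have "length R = r" by (simp add: row_lists_def)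
      then have "minor (T \<pi> R) x = signof \<pi> * minor R x" using minor_permute[of \<pi> R x] pi by (simp add: T_def)
      then show "(\<Prod>i<r. y (T \<pi> R ! i) i) * minor (T \<pi> R) x = signof \<pi> * ?Y R \<pi> * minor R x"
        by (simp add: T_def)
    qed simp
    finally show ?thesis using step by simp
  qed
  have "fact r * minor [0..<r] (gram p y x) = (\<Sum>\<pi>\<in>?P. minor [0..<r] (gram p y x))"
    using card_permutations[of "{0..<r}" r] by simp
  also have "\<dots> = (\<Sum>\<pi>\<in>?P. \<Sum>R\<in>row_lists p r. signof \<pi> * ?Y R \<pi> * minor R x)"
    by (rule sum.cong[OF refl], rule perm) simp
  also have "\<dots> = (\<Sum>R\<in>row_lists p r. \<Sum>\<pi>\<in>?P. signof \<pi> * ?Y R \<pi> * minor R x)" by (rule sum.swap)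
  also have "\<dots> = (\<Sum>R\<in>row_lists p r. minor R y * minor R x)"
    by (rule sum.cong) (auto simp: minor_expand_columns[of _ y] row_lists_def sum_distrib_right)
  finally show ?thesis .
qed

definition tableaux :: "nat \<Rightarrow> nat list \<Rightarrow> nat list list set" where
  "tableaux p Ls = {Rs. map length Rs = Ls \<and> (\<forall>R\<in>set Rs. set R \<subseteq> {..<p})}"

lemma tableaux_Cons: "tableaux p (r # Ls) = (\<lambda>(R, Rs). R # Rs) ` (row_lists p r \<times> tableaux p Ls)"
  by (auto simp: tableaux_def row_lists_def image_iff map_eq_Cons_conv subset_iff)

lemma tableaux_Nil: "tableaux p [] = {[]}"
  by (auto simp: tableaux_def)

lemma finite_tableaux: "finite (tableaux p Ls)"
  by (induction Ls) (auto simp: tableaux_Nil tableaux_Cons finite_row_lists)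

text \<open>One Cauchy-Binet formula for each factor, with \<open>C\<close> the product of the
  factorials. That all coefficients on the right are 1 is the positivity on which the orthogonality
  arguments rest.\<close>

lemma kernel_expansion:
  "\<exists>C. C \<noteq> 0 \<and> (\<forall>x y. C * mprod (map (\<lambda>r. [0..<r]) Ls) (gram p y x) =
    (\<Sum>Rs\<in>tableaux p Ls. mprod Rs y * mprod Rs x))"
proof (induction Ls)
  case Nil
  show ?case by (rule exI[of _ 1]) (simp add: tableaux_Nil)
next
  case (Cons r Ls)
  then obtain C where C: "C \<noteq> 0" "\<And>x y. C * mprod (map (\<lambda>r. [0..<r]) Ls) (gram p y x) =
    (\<Sum>Rs\<in>tableaux p Ls. mprod Rs y * mprod Rs x)" by blast
  have inj: "inj_on (\<lambda>(R, Rs). R # Rs) (row_lists p r \<times> tableaux p Ls)" by (auto simp: inj_on_def)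
  have "(\<Sum>Rs\<in>tableaux p (r # Ls). mprod Rs y * mprod Rs x) =
      (\<Sum>(R, Rs)\<in>row_lists p r \<times> tableaux p Ls. (minor R y * minor R x) * (mprod Rs y * mprod Rs x))" for x y
    unfolding tableaux_Cons sum.reindex[OF inj] by (simp add: case_prod_unfold mult_ac)
  also have "\<dots> x y = (fact r * C) * mprod (map (\<lambda>r. [0..<r]) (r # Ls)) (gram p y x)" for x y
    by (simp add: sum.cartesian_product[symmetric] sum_product[symmetric] Cauchy_Binet[symmetric] C(2)[symmetric])
  finally have "\<forall>x y. (fact r * C) * mprod (map (\<lambda>r. [0..<r]) (r # Ls)) (gram p y x) =
    (\<Sum>Rs\<in>tableaux p (r # Ls). mprod Rs y * mprod Rs x)" by simp
  then show ?case using C(1) by (intro exI[of _ "fact r * C"]) simp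
qed

section \<open>Products of minors of one shape\<close>

text \<open>Sorted, so that products that differ in the order of their factors are indexed by
  tableaux with the same list of lengths.\<close>

definition shape :: "nat \<Rightarrow> (nat \<Rightarrow> nat) \<Rightarrow> nat list" where
  "shape k wt = sort (map length (lead_rows k wt))"

lemma mprod_mset: "mset Rs = mset Ss \<Longrightarrow> mprod Rs x = mprod Ss x"
  unfolding mprod_def by (metis mset_map prod_mset_prod_list)

lemma lead_rows_upt: "map (\<lambda>r. [0..<r]) (map length (lead_rows k wt)) = lead_rows k wt"
proof -
  have "map ((\<lambda>r. [0..<r]) \<circ> length) (lead_rows k wt) = map (\<lambda>R. R) (lead_rows k wt)"
    by (rule map_cong) (auto elim!: set_lead_rows simp del: upt_Suc)
  then show ?thesis by simp
qed

lemma mprod_shape: "mprod (map (\<lambda>r. [0..<r]) (shape k wt)) x = mprod (lead_rows k wt) x"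
proof (rule mprod_mset)
  have "mset (map (\<lambda>r. [0..<r]) (shape k wt)) = mset (map (\<lambda>r. [0..<r]) (map length (lead_rows k wt)))"
    by (simp only: shape_def mset_map mset_sort)
  then show "mset (map (\<lambda>r. [0..<r]) (shape k wt)) = mset (lead_rows k wt)"
    by (simp only: lead_rows_upt)
qed

text \<open>The number of lists of length \<open>c + 1\<close> is
  \<open>rlen Rs c - rlen Rs (c + 1)\<close>, so the weight determines the multiset of the nonzero
  lengths.\<close>

lemma sort_lengths_eq_shape:
  assumes len: "\<And>R. R \<in> set Rs \<Longrightarrow> length R \<le> k" and rl: "\<And>j. j < k \<Longrightarrow> rlen Rs j = wt j"
    and wt: "\<And>j. j < k \<Longrightarrow> wt (Suc j) \<le> wt j" "wt k = 0"
  shows "sort (map length (filter (\<lambda>R. R \<noteq> []) Rs)) = shape k wt"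
proof -
  have cnt: "count (mset (map length Ss)) r = length (filter (\<lambda>R. length R = r) Ss)" for Ss r
    by (induction Ss) auto
  have ge: "rlen Ss j = 0" if "\<And>R. R \<in> set Ss \<Longrightarrow> length R \<le> k" "k \<le> j" for Ss j
    using that by (simp add: rlen_def filter_empty_conv) (meson le_trans not_le)
  have lead_len: "length R \<le> k \<and> R \<noteq> []" if "R \<in> set (lead_rows k wt)" for R
    using that by (auto elim!: set_lead_rows simp del: upt_Suc)
  have "rlen Rs j = rlen (lead_rows k wt) j" for j
  proof (cases "j < k")
    case True
    then show ?thesis using rl rlen_lead_rows[of k wt j] wt by simp
  next
    case False
    then show ?thesis using ge[of Rs j] ge[of "lead_rows k wt" j] len lead_len by simp
  qed
  moreover have "rlen (filter (\<lambda>R. R \<noteq> []) Ss) j = rlen Ss j" for Ss j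
    by (induction Ss) auto
  ultimately have rlen: "rlen (filter (\<lambda>R. R \<noteq> []) Rs) j = rlen (lead_rows k wt) j" for j by simp
  have "mset (map length (filter (\<lambda>R. R \<noteq> []) Rs)) = mset (map length (lead_rows k wt))"
  proof (rule multiset_eqI)
    fix r
    show "count (mset (map length (filter (\<lambda>R. R \<noteq> []) Rs))) r = count (mset (map length (lead_rows k wt))) r"
    proof (cases r)
      case 0
      then show ?thesis unfolding cnt using lead_len by (auto simp: filter_empty_conv)
    next
      case (Suc c)
      then show ?thesis unfolding cnt
        using rlen_length_eq[of c "filter (\<lambda>R. R \<noteq> []) Rs"] rlen_length_eq[of c "lead_rows k wt"] rlen by simp
    qed
  qed
  then show ?thesis unfolding shape_def
    by (intro properties_for_sort) simp_all
qed

text \<open>Dropping empty lists and sorting by length moves every product into one finite index set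
  without changing its value; the coefficients of equal tableaux are then added up.\<close>

lemma minor_span_tableaux:
  assumes "minor_span 0 p k wt F" and wt: "\<And>j. j < k \<Longrightarrow> wt (Suc j) \<le> wt j" "wt k = 0"
  shows "\<exists>a. \<forall>x. F x = (\<Sum>Rs\<in>tableaux p (shape k wt). a Rs * mprod Rs x)"
proof -
  obtain ys where ys: "\<And>y R. y \<in> set ys \<Longrightarrow> R \<in> set (snd y) \<Longrightarrow> good_row 0 p R \<and> length R \<le> k"
    "\<And>y j. y \<in> set ys \<Longrightarrow> j < k \<Longrightarrow> rlen (snd y) j = wt j"
    "\<And>x. F x = (\<Sum>y\<leftarrow>ys. fst y * mprod (snd y) x)"
    using assms(1) unfolding minor_span_def by blast
  define nf where "nf = (\<lambda>Rs :: nat list list. sort_key length (filter (\<lambda>R. R \<noteq> []) Rs))"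
  have nf_mprod: "mprod (nf Rs) x = mprod Rs x" for Rs x
  proof -
    have "mprod (nf Rs) x = mprod (filter (\<lambda>R. R \<noteq> []) Rs) x" unfolding nf_def by (rule mprod_mset) simp
    also have "\<dots> = mprod Rs x" by (induction Rs) auto
    finally show ?thesis .
  qed
  have nf_in: "nf (snd y) \<in> tableaux p (shape k wt)" if y: "y \<in> set ys" for y
  proof -
    have "map length (nf (snd y)) = sort (map length (filter (\<lambda>R. R \<noteq> []) (snd y)))"
      by (rule properties_for_sort[symmetric]) (simp_all add: nf_def)
    also have "\<dots> = shape k wt" by (rule sort_lengths_eq_shape) (use ys(1,2)[OF y] wt in auto)
    finally have "map length (nf (snd y)) = shape k wt" .
    moreover have "set R \<subseteq> {..<p}" if "R \<in> set (snd y)" for R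
      using good_row_set[of 0 p R] ys(1)[OF y that] by simp
    ultimately show ?thesis by (auto simp: tableaux_def nf_def)
  qed
  have "set zs \<subseteq> set ys \<Longrightarrow> (\<Sum>y\<leftarrow>zs. fst y * mprod (snd y) x) =
      (\<Sum>Rs\<in>tableaux p (shape k wt). (\<Sum>y\<leftarrow>zs. if nf (snd y) = Rs then fst y else 0) * mprod Rs x)" for zs x
  proof (induction zs)
    case (Cons y zs)
    have "(\<Sum>Rs\<in>tableaux p (shape k wt). (if nf (snd y) = Rs then fst y else 0) * mprod Rs x) =
        (\<Sum>Rs\<in>tableaux p (shape k wt). if nf (snd y) = Rs then fst y * mprod Rs x else 0)"
      by (rule sum.cong) auto
    also have "\<dots> = fst y * mprod (snd y) x"
      using nf_in[of y] Cons.prems by (simp add: finite_tableaux nf_mprod)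
    finally show ?case using Cons by (simp add: distrib_right sum.distrib)
  qed simp
  from this[OF order_refl] show ?thesis unfolding ys(3)
    by (intro exI[of _ "\<lambda>Rs. \<Sum>y\<leftarrow>ys. if nf (snd y) = Rs then fst y else 0"]) simp
qed

section \<open>The coordinate algebras\<close>

definition arr :: "complex mat \<Rightarrow> nat \<Rightarrow> nat \<Rightarrow> complex" where
  "arr Q = (\<lambda>i j. Q $$ (i, j))"

text \<open>The opposite passage is composition with \<open>arr\<close> and restriction; on
  polynomial functions the two are inverse to each other.\<close>

definition lift :: "nat \<Rightarrow> nat \<Rightarrow> (complex mat \<Rightarrow> complex) \<Rightarrow> (nat \<Rightarrow> nat \<Rightarrow> complex) \<Rightarrow> complex" where
  "lift p k f x = f (mat p k (\<lambda>(i, j). x i j))"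

lemma mat_arr: "Q \<in> carrier_mat p k \<Longrightarrow> mat p k (\<lambda>(i, j). arr Q i j) = Q"
  by (intro eq_matI) (auto simp: arr_def)

lemma lift_arr: "Q \<in> carrier_mat p k \<Longrightarrow> lift p k f (arr Q) = f Q"
  by (simp add: lift_def mat_arr)

lemma lift_cong: "(\<And>i j. i < p \<Longrightarrow> j < k \<Longrightarrow> x i j = y i j) \<Longrightarrow> lift p k f x = lift p k f y"
  unfolding lift_def by (intro arg_cong[of _ _ f] eq_matI) auto

lemma poly_funs_extensional: "f \<in> poly_funs p k \<Longrightarrow> f \<in> extensional (carrier_mat p k)"
  by (erule poly_funs.cases) auto

lemma polyfn_lift: "f \<in> poly_funs p k \<Longrightarrow> polyfn p k (lift p k f)"
proof (induction rule: poly_funs.induct)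
  case (const c)
  show ?case using polyfn_const by (simp add: lift_def[abs_def])
next
  case (coord i j)
  then show ?case using polyfn_coord[of i p j k] by (simp add: lift_def[abs_def])
next
  case (add f g)
  then show ?case using polyfn_add[of p k "lift p k f" "lift p k g"] by (simp add: lift_def[abs_def])
next
  case (mult f g)
  then show ?case using polyfn_mult[of p k "lift p k f" "lift p k g"] by (simp add: lift_def[abs_def])
qed

lemma poly_funs_restrict:
  assumes "polyfn p k F" shows "(\<lambda>Q\<in>carrier_mat p k. F (arr Q)) \<in> poly_funs p k"
proof -
  have c: "(\<lambda>Q\<in>carrier_mat p k. c) \<in> poly_funs p k" for c by (rule poly_funs.const)
  have x: "(\<lambda>Q\<in>carrier_mat p k. arr Q i j) \<in> poly_funs p k" if "i < p" "j < k" for i j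
    using poly_funs.coord[OF that] by (simp add: arr_def)
  have a: "(\<lambda>Q\<in>carrier_mat p k. F Q + G Q) \<in> poly_funs p k"
    if "(\<lambda>Q\<in>carrier_mat p k. F Q) \<in> poly_funs p k" "(\<lambda>Q\<in>carrier_mat p k. G Q) \<in> poly_funs p k" for F G
    using poly_funs.add[OF that] by (simp cong: restrict_cong)
  have m: "(\<lambda>Q\<in>carrier_mat p k. F Q * G Q) \<in> poly_funs p k"
    if "(\<lambda>Q\<in>carrier_mat p k. F Q) \<in> poly_funs p k" "(\<lambda>Q\<in>carrier_mat p k. G Q) \<in> poly_funs p k" for F G
    using poly_funs.mult[OF that] by (simp cong: restrict_cong)
  show ?thesis
    using assms c x a m by (rule polyfn_closed[where P = "\<lambda>F. (\<lambda>Q\<in>carrier_mat p k. F Q) \<in> poly_funs p k" and Y = arr])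
qed

lemma lift_restrict:
  assumes "polyfn p k F" shows "lift p k (\<lambda>Q\<in>carrier_mat p k. F (arr Q)) x = F x"
  using polyfn_cong[OF assms, of "arr (mat p k (\<lambda>(i, j). x i j))" x] by (simp add: lift_def arr_def)

lemma ext_eqI:
  assumes "f \<in> extensional (carrier_mat p k)" "g \<in> extensional (carrier_mat p k)"
    "\<And>Q. Q \<in> carrier_mat p k \<Longrightarrow> f Q = g Q"
  shows "f = g"
  using assms by (rule extensionalityI)

lemma poly_funs_smult: "f \<in> poly_funs p k \<Longrightarrow> (\<lambda>Q\<in>carrier_mat p k. c * f Q) \<in> poly_funs p k"
  using poly_funs.mult[OF poly_funs.const[where c = c], of f] by (simp cong: restrict_cong)

lemma coord_alg_simps [simp]:
  "carrier (coord_alg p k) = poly_funs p k"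
  "f \<otimes>\<^bsub>coord_alg p k\<^esub> g = (\<lambda>Q\<in>carrier_mat p k. f Q * g Q)"
  "f \<oplus>\<^bsub>coord_alg p k\<^esub> g = (\<lambda>Q\<in>carrier_mat p k. f Q + g Q)"
  "\<one>\<^bsub>coord_alg p k\<^esub> = (\<lambda>Q\<in>carrier_mat p k. 1)"
  "\<zero>\<^bsub>coord_alg p k\<^esub> = (\<lambda>Q\<in>carrier_mat p k. 0)"
  "c \<odot>\<^bsub>coord_alg p k\<^esub> f = (\<lambda>Q\<in>carrier_mat p k. c * f Q)"
  by (simp_all add: coord_alg_def)

lemma restrict_eq_iff: "restrict f A = restrict g A \<longleftrightarrow> (\<forall>x\<in>A. f x = g x)"
  by (auto simp: restrict_def fun_eq_iff)

lemma cring_coord_alg: "cring (coord_alg p k)"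
proof (rule cringI)
  show "abelian_group (coord_alg p k)"
  proof (rule abelian_groupI)
    fix f assume f: "f \<in> carrier (coord_alg p k)"
    show "\<exists>g\<in>carrier (coord_alg p k). g \<oplus>\<^bsub>coord_alg p k\<^esub> f = \<zero>\<^bsub>coord_alg p k\<^esub>"
      using f poly_funs_smult[of f p k "-1"]
      by (intro bexI[of _ "\<lambda>Q\<in>carrier_mat p k. -1 * f Q"]) (auto simp: restrict_eq_iff)
    show "\<zero>\<^bsub>coord_alg p k\<^esub> \<oplus>\<^bsub>coord_alg p k\<^esub> f = f"
      using poly_funs_extensional[of f p k] f by (auto simp: extensional_def restrict_def fun_eq_iff)
  qed (auto simp: restrict_eq_iff algebra_simps intro: poly_funs.intros)
  show "comm_monoid (coord_alg p k)"
  proof (rule comm_monoidI)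
    fix f assume f: "f \<in> carrier (coord_alg p k)"
    show "\<one>\<^bsub>coord_alg p k\<^esub> \<otimes>\<^bsub>coord_alg p k\<^esub> f = f"
      using poly_funs_extensional[of f p k] f by (auto simp: extensional_def restrict_def fun_eq_iff)
  qed (auto simp: restrict_eq_iff algebra_simps intro: poly_funs.intros)
qed (auto simp: restrict_eq_iff algebra_simps)

lemma coord_alg_minus:
  assumes "f \<in> poly_funs p k" shows "\<ominus>\<^bsub>coord_alg p k\<^esub> f = (\<lambda>Q\<in>carrier_mat p k. - 1 * f Q)"
proof -
  interpret cring "coord_alg p k" by (rule cring_coord_alg)
  show ?thesis
    by (rule minus_equality) (use assms poly_funs_smult[OF assms, of "-1"] in \<open>auto simp: restrict_eq_iff\<close>)
qed

section \<open>Group actions on polynomial functions\<close>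

lemma act_in_carrier:
  assumes "g1 \<in> carrier_mat p p" "g2 \<in> carrier_mat k k" "Q \<in> carrier_mat p k"
  shows "transpose_mat g1 * Q * g2 \<in> carrier_mat p k"
  using assms by auto

lemma act_restrict_binop:
  assumes "g1 \<in> carrier_mat p p" "g2 \<in> carrier_mat k k"
  shows "act p k g1 g2 (\<lambda>Q\<in>carrier_mat p k. h (f Q) (g Q)) =
    (\<lambda>Q\<in>carrier_mat p k. h (act p k g1 g2 f Q) (act p k g1 g2 g Q))"
  using act_in_carrier[OF assms] by (auto simp: act_def restrict_def fun_eq_iff)

text \<open>Common to \<open>U_inv_alg\<close> and \<open>B_GL\<close>, which differ in the set
  \<open>G\<close> of pairs: the action is by substitution, so it commutes with pointwise
  operations.\<close>

lemma subring_act_invariant: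
  assumes G: "\<And>g1 g2. (g1, g2) \<in> G \<Longrightarrow> g1 \<in> carrier_mat p p \<and> g2 \<in> carrier_mat k k"
  shows "subring {f \<in> poly_funs p k. \<forall>(g1, g2)\<in>G. act p k g1 g2 f = f} (coord_alg p k)" (is "subring ?H _")
proof -
  interpret cring "coord_alg p k" by (rule cring_coord_alg)
  note binop = act_restrict_binop[OF G[THEN conjunct1] G[THEN conjunct2]]
  have inv: "act p k g1 g2 (\<lambda>Q\<in>carrier_mat p k. h (f Q) (g Q)) = (\<lambda>Q\<in>carrier_mat p k. h (f Q) (g Q))"
    if "f \<in> ?H" "g \<in> ?H" "(g1, g2) \<in> G" for f g g1 g2 and h :: "complex \<Rightarrow> complex \<Rightarrow> complex"
  proof -
    have "act p k g1 g2 f = f" "act p k g1 g2 g = g" using that by auto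
    with binop[OF that(3) that(3), of h f g] show ?thesis by simp
  qed
  have cl: "transpose_mat g1 * Q * g2 \<in> carrier_mat p k" if "(g1, g2) \<in> G" "Q \<in> carrier_mat p k" for g1 g2 Q
    using act_in_carrier that G by blast
  show ?thesis
  proof (rule subringI)
    show "?H \<subseteq> carrier (coord_alg p k)" by auto
    show "\<one>\<^bsub>coord_alg p k\<^esub> \<in> ?H"
      using cl by (auto simp: act_def restrict_eq_iff poly_funs.const)
    show "\<ominus>\<^bsub>coord_alg p k\<^esub> f \<in> ?H" if f: "f \<in> ?H" for f
      using inv[OF f f, of _ _ "\<lambda>x y. - 1 * x"] f poly_funs_smult[of f p k "-1"]
      by (auto simp: coord_alg_minus[of f p k])
    show "f \<otimes>\<^bsub>coord_alg p k\<^esub> g \<in> ?H" if "f \<in> ?H" "g \<in> ?H" for f g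
      using inv[OF that, of _ _ "(*)"] that by (auto intro: poly_funs.mult)
    show "f \<oplus>\<^bsub>coord_alg p k\<^esub> g \<in> ?H" if "f \<in> ?H" "g \<in> ?H" for f g
      using inv[OF that, of _ _ "(+)"] that by (auto intro: poly_funs.add)
  qed
qed

lemma unip_carrier: "g \<in> unip r \<Longrightarrow> g \<in> carrier_mat r r"
  by (simp add: unip_def)

lemma GL_embed_carrier: "g \<in> carrier_mat q q \<Longrightarrow> q \<le> p \<Longrightarrow> GL_embed p q g \<in> carrier_mat p p"
  unfolding GL_embed_def by (metis four_block_carrier_mat le_add_diff_inverse one_carrier_mat)

lemma U_inv_alg_simps [simp]:
  "f \<otimes>\<^bsub>U_inv_alg p m\<^esub> g = (\<lambda>Q\<in>carrier_mat p m. f Q * g Q)"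
  "f \<oplus>\<^bsub>U_inv_alg p m\<^esub> g = (\<lambda>Q\<in>carrier_mat p m. f Q + g Q)"
  "\<one>\<^bsub>U_inv_alg p m\<^esub> = (\<lambda>Q\<in>carrier_mat p m. 1)"
  "\<zero>\<^bsub>U_inv_alg p m\<^esub> = (\<lambda>Q\<in>carrier_mat p m. 0)"
  "c \<odot>\<^bsub>U_inv_alg p m\<^esub> f = (\<lambda>Q\<in>carrier_mat p m. c * f Q)"
  by (simp_all add: U_inv_alg_def coord_alg_def)

lemma B_GL_simps [simp]:
  "f \<otimes>\<^bsub>B_GL p q k\<^esub> g = (\<lambda>Q\<in>carrier_mat p k. f Q * g Q)"
  "f \<oplus>\<^bsub>B_GL p q k\<^esub> g = (\<lambda>Q\<in>carrier_mat p k. f Q + g Q)"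
  "\<one>\<^bsub>B_GL p q k\<^esub> = (\<lambda>Q\<in>carrier_mat p k. 1)"
  "\<zero>\<^bsub>B_GL p q k\<^esub> = (\<lambda>Q\<in>carrier_mat p k. 0)"
  "c \<odot>\<^bsub>B_GL p q k\<^esub> f = (\<lambda>Q\<in>carrier_mat p k. c * f Q)"
  by (simp_all add: B_GL_def coord_alg_def)

lemma carrier_U_inv_alg:
  "carrier (U_inv_alg p m) = {f \<in> poly_funs p m. \<forall>(g1, g2)\<in>{1\<^sub>m p} \<times> unip m. act p m g1 g2 f = f}"
  by (auto simp: U_inv_alg_def)

lemma carrier_B_GL:
  "carrier (B_GL p q k) =
    {f \<in> poly_funs p k. \<forall>(g1, g2)\<in>GL_embed p q ` unip q \<times> unip k. act p k g1 g2 f = f}"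
  by (auto simp: B_GL_def)

lemma ring_U_inv_alg: "ring (U_inv_alg p m)"
proof -
  interpret cring "coord_alg p m" by (rule cring_coord_alg)
  show ?thesis
    using subring_is_ring[OF subring_act_invariant[of "{1\<^sub>m p} \<times> unip m" p m]] unip_carrier
    unfolding U_inv_alg_def by (auto simp: Sigma_def)
qed

lemma ring_B_GL: assumes "q \<le> p" shows "ring (B_GL p q k)"
proof -
  interpret cring "coord_alg p k" by (rule cring_coord_alg)
  have "ring (coord_alg p k\<lparr>carrier := carrier (B_GL p q k)\<rparr>)"
    unfolding carrier_B_GL
    by (rule subring_is_ring[OF subring_act_invariant])
      (use unip_carrier GL_embed_carrier[OF _ assms] in auto)
  then show ?thesis by (simp add: B_GL_def)
qed

lemma U_inv_poly: "f \<in> carrier (U_inv_alg p m) \<Longrightarrow> f \<in> poly_funs p m"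
  by (simp add: carrier_U_inv_alg)

lemma lift_act_right:
  assumes "u \<in> carrier_mat k k"
  shows "lift p k (act p k (1\<^sub>m p) u f) x = lift p k f (\<lambda>i j. \<Sum>l<k. x i l * u $$ (l, j))"
proof -
  have "transpose_mat (1\<^sub>m p) * mat p k (\<lambda>(i, j). x i j) * u = mat p k (\<lambda>(i, j). \<Sum>l<k. x i l * u $$ (l, j))"
    using assms by (intro eq_matI) (auto simp: scalar_prod_def atLeast0LessThan intro!: sum.cong)
  then show ?thesis by (simp add: lift_def act_def)
qed

lemma lift_act_left:
  assumes "g \<in> carrier_mat p p"
  shows "lift p k (act p k g (1\<^sub>m k) f) x = lift p k f (\<lambda>i j. \<Sum>s<p. g $$ (s, i) * x s j)"
proof -
  have "transpose_mat g * mat p k (\<lambda>(i, j). x i j) * 1\<^sub>m k = mat p k (\<lambda>(i, j). \<Sum>s<p. g $$ (s, i) * x s j)"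
    using assms by (intro eq_matI) (auto simp: scalar_prod_def atLeast0LessThan intro!: sum.cong)
  then show ?thesis by (simp add: lift_def act_def)
qed

lemma sum_two_terms:
  fixes A B :: complex and a b n :: nat
  assumes "a < n" "b < n" "a \<noteq> b"
  shows "(\<Sum>l<n. if l = a then A else if l = b then B else 0) = A + B"
proof -
  have "(\<Sum>l<n. if l = a then A else if l = b then B else 0) =
      (\<Sum>l<n. (if l = a then A else 0) + (if l = b then B else 0))"
    by (rule sum.cong) (use assms in auto)
  then show ?thesis using assms by (simp add: sum.distrib)
qed

lemma unip_iff:
  "g \<in> unip r \<longleftrightarrow> g \<in> carrier_mat r r \<and> (\<forall>i<r. \<forall>j<i. g $$ (i, j) = 0) \<and> (\<forall>i<r. g $$ (i, i) = 1)"
  by (auto simp: unip_def upper_triangular_def)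

lemma mult_mat_entry:
  fixes A B :: "complex mat"
  assumes "A \<in> carrier_mat a b" "B \<in> carrier_mat b c" "i < a" "j < c"
  shows "(A * B) $$ (i, j) = (\<Sum>l<b. A $$ (i, l) * B $$ (l, j))"
  using assms by (auto simp: scalar_prod_def atLeast0LessThan intro!: sum.cong)

definition elem_unip :: "nat \<Rightarrow> nat \<Rightarrow> nat \<Rightarrow> complex \<Rightarrow> complex mat" where
  "elem_unip r c c' s = mat r r (\<lambda>(i, j). if i = j then 1 else if i = c \<and> j = c' then s else 0)"

lemma elem_unip_in: "c < c' \<Longrightarrow> elem_unip r c c' s \<in> unip r"
  by (auto simp: elem_unip_def unip_iff)

lemma one_unip: "1\<^sub>m r \<in> unip r"
  by (auto simp: unip_iff)

text \<open>\<open>cmul\<close> is right multiplication by \<open>u\<close>, and \<open>rmul\<close>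
  is left multiplication by the transpose of \<open>g\<close>: the substitution in
  \<open>act\<close>, transferred to arrays.\<close>

definition cmul :: "nat \<Rightarrow> complex mat \<Rightarrow> (nat \<Rightarrow> nat \<Rightarrow> complex) \<Rightarrow> nat \<Rightarrow> nat \<Rightarrow> complex" where
  "cmul k u x = (\<lambda>i j. \<Sum>l<k. x i l * u $$ (l, j))"

definition rmul :: "nat \<Rightarrow> complex mat \<Rightarrow> (nat \<Rightarrow> nat \<Rightarrow> complex) \<Rightarrow> nat \<Rightarrow> nat \<Rightarrow> complex" where
  "rmul p g x = (\<lambda>i j. \<Sum>s<p. g $$ (s, i) * x s j)"

lemma cmul_elem:
  assumes "c < c'" "c' < k" "j < k" shows "cmul k (elem_unip k c c' s) x i j = colop c c' s x i j"
proof (cases "j = c'")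
  case True
  have "cmul k (elem_unip k c c' s) x i j = (\<Sum>l<k. if l = c' then x i c' else if l = c then s * x i c else 0)"
    unfolding cmul_def by (rule sum.cong) (use assms True in \<open>auto simp: elem_unip_def\<close>)
  also have "\<dots> = x i c' + s * x i c"
    using assms by (intro sum_two_terms) auto
  finally show ?thesis using True by (simp add: colop_def)
next
  case False
  have "cmul k (elem_unip k c c' s) x i j = (\<Sum>l<k. if l = j then x i j else 0)"
    unfolding cmul_def by (rule sum.cong) (use assms False in \<open>auto simp: elem_unip_def\<close>)
  then show ?thesis using False assms by (simp add: colop_def)
qed

lemma GL_embed_index:
  assumes "a \<in> carrier_mat q q" "q \<le> p" "s < p" "i < p"
  shows "GL_embed p q a $$ (s, i) = (if s < q \<and> i < q then a $$ (s, i) else if s = i then 1 else 0)"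
  unfolding GL_embed_def using assms by (auto simp: index_mat_four_block)

lemma rmul_elem:
  assumes "c < c'" "c' < q" "q \<le> p" "i < p"
  shows "rmul p (GL_embed p q (elem_unip q c c' s)) x i j = rowop c c' s x i j"
proof (cases "i = c'")
  case True
  have "rmul p (GL_embed p q (elem_unip q c c' s)) x i j =
      (\<Sum>l<p. if l = c' then x c' j else if l = c then s * x c j else 0)"
    unfolding rmul_def
    by (rule sum.cong) (use assms True in \<open>auto simp: GL_embed_index elem_unip_def\<close>)
  also have "\<dots> = x c' j + s * x c j"
    using assms by (intro sum_two_terms) auto
  finally show ?thesis using True by (simp add: rowop_def)
next
  case False
  have "rmul p (GL_embed p q (elem_unip q c c' s)) x i j = (\<Sum>l<p. if l = i then x i j else 0)"
    unfolding rmul_def by (rule sum.cong) (use assms False in \<open>auto simp: GL_embed_index elem_unip_def\<close>)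
  then show ?thesis using False assms by (simp add: rowop_def)
qed

lemma GL_embed_one: "q \<le> p \<Longrightarrow> GL_embed p q (1\<^sub>m q) = 1\<^sub>m p"
  using GL_embed_carrier[of "1\<^sub>m q" q p] by (intro eq_matI) (auto simp: GL_embed_index)

lemma U_inv_lift: "f \<in> carrier (U_inv_alg p m) \<Longrightarrow> u \<in> unip m \<Longrightarrow> lift p m f (cmul m u x) = lift p m f x"
  using lift_act_right[of u m p f x] unip_carrier[of u m] by (simp add: carrier_U_inv_alg cmul_def)

lemma U_inv_col_inv:
  assumes "f \<in> carrier (U_inv_alg p m)" shows "col_inv m (lift p m f)"
  unfolding col_inv_def
proof (intro allI impI)
  fix c c' and s :: complex and x assume c: "c < c'" "c' < m"
  have "lift p m f (colop c c' s x) = lift p m f (cmul m (elem_unip m c c' s) x)"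
    by (rule lift_cong) (simp add: cmul_elem[OF c])
  also have "\<dots> = lift p m f x" by (rule U_inv_lift[OF assms elem_unip_in[OF c(1)]])
  finally show "lift p m f (colop c c' s x) = lift p m f x" .
qed

lemma B_GL_props:
  assumes f: "f \<in> carrier (B_GL p q k)" and "q \<le> p"
  shows "polyfn p k (lift p k f)" "col_inv k (lift p k f)" "row_inv q (lift p k f)"
proof -
  show "polyfn p k (lift p k f)" using f polyfn_lift by (simp add: carrier_B_GL)
  have inv: "act p k (GL_embed p q a) b f = f" if "a \<in> unip q" "b \<in> unip k" for a b
    using f that by (auto simp: carrier_B_GL)
  have "act p k (1\<^sub>m p) b f = f" if "b \<in> unip k" for b
    using inv[OF one_unip that] GL_embed_one[OF assms(2)] by simp
  then have "f \<in> carrier (U_inv_alg p k)" using f by (auto simp: carrier_B_GL carrier_U_inv_alg)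
  then show "col_inv k (lift p k f)" by (rule U_inv_col_inv)
  show "row_inv q (lift p k f)"
    unfolding row_inv_def
  proof (intro allI impI)
    fix c c' and s :: complex and x assume c: "c < c'" "c' < q"
    have E: "GL_embed p q (elem_unip q c c' s) \<in> carrier_mat p p"
      using GL_embed_carrier[OF unip_carrier[OF elem_unip_in[OF c(1)]] assms(2)] .
    have "lift p k f (rowop c c' s x) = lift p k f (rmul p (GL_embed p q (elem_unip q c c' s)) x)"
      by (rule lift_cong) (simp add: rmul_elem[OF c assms(2)])
    also have "\<dots> = lift p k (act p k (GL_embed p q (elem_unip q c c' s)) (1\<^sub>m k) f) x"
      by (simp add: lift_act_left[OF E] rmul_def)
    also have "\<dots> = lift p k f x" by (simp add: inv[OF elem_unip_in[OF c(1)] one_unip])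
    finally show "lift p k f (rowop c c' s x) = lift p k f x" .
  qed
qed

text \<open>As \<open>u\<close> is upper triangular, its first \<open>length R\<close> columns are
  supported in the first \<open>length R\<close> rows. The submatrix is therefore multiplied by a
  square unitriangular block of determinant 1.\<close>

lemma minor_cmul_unip:
  assumes u: "u \<in> unip k" and R: "length R \<le> k"
  shows "minor R (cmul k u x) = minor R x"
proof -
  let ?r = "length R"
  let ?A = "mat ?r ?r (\<lambda>(j, l). x (R ! j) l)" and ?B = "mat ?r ?r (\<lambda>(b, l). u $$ (b, l))"
  have "(\<Sum>b<k. x i b * u $$ (b, l)) = (\<Sum>b<?r. x i b * u $$ (b, l))" if "l < ?r" for i l
    using u R that by (intro sum.mono_neutral_right) (auto simp: unip_iff)
  then have "mat ?r ?r (\<lambda>(j, l). cmul k u x (R ! j) l) = ?A * ?B"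
    by (intro eq_matI) (auto simp: cmul_def scalar_prod_def atLeast0LessThan)
  moreover have "det ?B = 1"
  proof -
    have "upper_triangular ?B" using u R by (auto simp: unip_iff upper_triangular_def)
    then have "det ?B = prod_list (diag_mat ?B)" by (rule det_upper_triangular[of _ ?r]) simp
    also have "\<dots> = 1" using u R by (auto simp: prod_list_diag_prod unip_iff)
    finally show ?thesis .
  qed
  moreover have "det (?A * ?B) = det ?A * det ?B" by (rule det_mult[of _ ?r]) auto
  ultimately show ?thesis unfolding minor_def by (simp only: mult_1_right)
qed

text \<open>The submatrix is multiplied from the left by a block matrix: the transposed leading
  block of \<open>g\<close> on the initial rows and the identity on the rows from \<open>q\<close>
  on. The transpose is lower triangular, so an initial row receives only earlier rows, which again
  belong to the minor.\<close>

lemma minor_rmul_unip: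
  assumes g: "g \<in> unip q" and "q \<le> p" and R: "good_row q p R"
  shows "minor R (rmul p (GL_embed p q g) x) = minor R x"
proof -
  let ?r = "length R"
  obtain c Y where Y: "R = [0..<c] @ Y" "c \<le> q" "set Y \<subseteq> {q..<p}"
    using R unfolding good_row_def by auto
  let ?A = "mat ?r ?r (\<lambda>(a, b). if a < c \<and> b < c then g $$ (b, a) else if a = b then 1 else 0)"
  let ?B = "mat ?r ?r (\<lambda>(j, l). x (R ! j) l)"
  have gc: "g \<in> carrier_mat q q" using g by (rule unip_carrier)
  have row: "rmul p (GL_embed p q g) x (R ! a) l =
      (\<Sum>b<?r. (if a < c \<and> b < c then g $$ (b, a) else if a = b then 1 else 0) * x (R ! b) l)"
    if a: "a < ?r" for a l
  proof (cases "a < c")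
    case True
    then have Ra: "R ! a = a" using Y by (simp add: nth_append)
    have "rmul p (GL_embed p q g) x a l = (\<Sum>s<c. g $$ (s, a) * x s l)"
      unfolding rmul_def
      by (rule sum.mono_neutral_cong_right)
        (use Y assms(2) g True gc in \<open>auto simp: GL_embed_index unip_iff\<close>)
    also have "\<dots> = (\<Sum>b<?r. (if a < c \<and> b < c then g $$ (b, a) else if a = b then 1 else 0) * x (R ! b) l)"
      by (rule sum.mono_neutral_cong_left) (use Y True in \<open>auto simp: nth_append\<close>)
    finally show ?thesis using Ra by simp
  next
    case False
    then have "R ! a \<in> set Y" using Y a by (simp add: nth_append)
    then have Ra: "q \<le> R ! a" "R ! a < p" using Y(3) by auto
    have "rmul p (GL_embed p q g) x (R ! a) l = (\<Sum>s<p. if s = R ! a then x s l else 0)"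
      unfolding rmul_def
      by (rule sum.cong) (use Ra assms(2) gc in \<open>auto simp: GL_embed_index\<close>)
    also have "\<dots> = x (R ! a) l" using Ra by simp
    also have "\<dots> = (\<Sum>b<?r. if b = a then x (R ! b) l else 0)" using a by simp
    also have "\<dots> = (\<Sum>b<?r. (if a < c \<and> b < c then g $$ (b, a) else if a = b then 1 else 0) * x (R ! b) l)"
      by (rule sum.cong) (use False in auto)
    finally show ?thesis .
  qed
  then have "mat ?r ?r (\<lambda>(j, l). rmul p (GL_embed p q g) x (R ! j) l) = ?A * ?B"
    by (intro eq_matI) (auto simp: scalar_prod_def atLeast0LessThan)
  moreover have "det ?A = 1"
  proof -
    have "det ?A = prod_list (diag_mat ?A)"
      by (rule det_lower_triangular[of ?r]) (use g Y in \<open>auto simp: unip_iff\<close>)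
    also have "\<dots> = 1" using g Y by (auto simp: prod_list_diag_prod unip_iff intro!: prod.neutral)
    finally show ?thesis .
  qed
  moreover have "det (?A * ?B) = det ?A * det ?B" by (rule det_mult[of _ ?r]) auto
  ultimately show ?thesis unfolding minor_def by (simp only: mult_1_left)
qed

lemma arr_act:
  assumes "g \<in> carrier_mat p p" "u \<in> carrier_mat k k" "Q \<in> carrier_mat p k" "i < p" "j < k"
  shows "arr (transpose_mat g * Q * u) i j = cmul k u (rmul p g (arr Q)) i j"
proof -
  have "transpose_mat g * Q \<in> carrier_mat p k" using assms by auto
  then have "arr (transpose_mat g * Q * u) i j = (\<Sum>l<k. (transpose_mat g * Q) $$ (i, l) * u $$ (l, j))"
    unfolding arr_def using assms by (intro mult_mat_entry) auto
  also have "\<dots> = cmul k u (rmul p g (arr Q)) i j"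
    unfolding cmul_def
  proof (rule sum.cong)
    fix l assume "l \<in> {..<k}"
    then have "(transpose_mat g * Q) $$ (i, l) = (\<Sum>s<p. transpose_mat g $$ (i, s) * Q $$ (s, l))"
      using assms by (intro mult_mat_entry) auto
    also have "\<dots> = rmul p g (arr Q) i l" using assms by (simp add: rmul_def arr_def)
    finally show "(transpose_mat g * Q) $$ (i, l) * u $$ (l, j) = rmul p g (arr Q) i l * u $$ (l, j)" by simp
  qed simp
  finally show ?thesis .
qed

lemma act_restrict:
  assumes F: "polyfn p k F" and "g \<in> carrier_mat p p" "u \<in> carrier_mat k k"
  shows "act p k g u (\<lambda>Q\<in>carrier_mat p k. F (arr Q)) =
    (\<lambda>Q\<in>carrier_mat p k. F (cmul k u (rmul p g (arr Q))))"
proof -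
  have "F (arr (transpose_mat g * Q * u)) = F (cmul k u (rmul p g (arr Q)))" if "Q \<in> carrier_mat p k" for Q
    by (rule polyfn_cong[OF F]) (rule arr_act[OF assms(2,3) that])
  then show ?thesis using act_in_carrier[OF assms(2,3)] by (auto simp: act_def restrict_eq_iff)
qed

lemma rmul_one: "i < p \<Longrightarrow> rmul p (1\<^sub>m p) x i j = x i j"
proof -
  assume i: "i < p"
  have "rmul p (1\<^sub>m p) x i j = (\<Sum>s<p. if s = i then x s j else 0)"
    unfolding rmul_def by (rule sum.cong) (use i in auto)
  then show ?thesis using i by simp
qed

lemma restrict_in_U_inv:
  assumes F: "polyfn p m F" and inv: "\<And>u x. u \<in> unip m \<Longrightarrow> F (cmul m u x) = F x"
  shows "(\<lambda>Q\<in>carrier_mat p m. F (arr Q)) \<in> carrier (U_inv_alg p m)"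
proof -
  have "act p m (1\<^sub>m p) u (\<lambda>Q\<in>carrier_mat p m. F (arr Q)) = (\<lambda>Q\<in>carrier_mat p m. F (arr Q))" if u: "u \<in> unip m" for u
  proof -
    have "F (rmul p (1\<^sub>m p) x) = F x" for x by (rule polyfn_cong[OF F]) (rule rmul_one)
    then show ?thesis using inv[OF u] by (simp add: act_restrict[OF F _ unip_carrier[OF u]] restrict_eq_iff)
  qed
  then show ?thesis using poly_funs_restrict[OF F] by (auto simp: carrier_U_inv_alg)
qed

lemma mprod_in_U_inv:
  assumes "\<And>R. R \<in> set Rs \<Longrightarrow> set R \<subseteq> {..<p} \<and> length R \<le> m"
  shows "(\<lambda>Q\<in>carrier_mat p m. mprod Rs (arr Q)) \<in> carrier (U_inv_alg p m)"
proof (rule restrict_in_U_inv[OF polyfn_mprod[OF assms]])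
  show "mprod Rs (cmul m u x) = mprod Rs x" if "u \<in> unip m" for u x
    unfolding mprod_def using minor_cmul_unip[OF that] assms
    by (intro arg_cong[of _ _ prod_list] map_cong) auto
qed

lemma mprod_in_B_GL:
  assumes R: "\<And>R. R \<in> set Rs \<Longrightarrow> good_row q p R \<and> length R \<le> k" and "q \<le> p"
  shows "(\<lambda>Q\<in>carrier_mat p k. mprod Rs (arr Q)) \<in> carrier (B_GL p q k)"
proof -
  have poly: "polyfn p k (mprod Rs)" using R good_row_set[OF _ assms(2)] by (intro polyfn_mprod) blast
  have "act p k (GL_embed p q a) b (\<lambda>Q\<in>carrier_mat p k. mprod Rs (arr Q)) = (\<lambda>Q\<in>carrier_mat p k. mprod Rs (arr Q))"
    if a: "a \<in> unip q" and b: "b \<in> unip k" for a b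
  proof -
    have "mprod Rs (cmul k b (rmul p (GL_embed p q a) x)) = mprod Rs x" for x
      unfolding mprod_def using minor_cmul_unip[OF b] minor_rmul_unip[OF a assms(2)] R
      by (intro arg_cong[of _ _ prod_list] map_cong) auto
    then show ?thesis
      using act_restrict[OF poly GL_embed_carrier[OF unip_carrier[OF a] assms(2)] unip_carrier[OF b]] by simp
  qed
  then show ?thesis using poly_funs_restrict[OF poly] by (auto simp: carrier_B_GL)
qed

section \<open>Weight spaces of the invariant algebra\<close>

lemma rho_iff: "f \<in> rho p m F \<longleftrightarrow> f \<in> carrier (U_inv_alg p m) \<and> col_weight m F (lift p m f)"
proof (intro iffI conjI)
  assume f: "f \<in> rho p m F"
  then show U: "f \<in> carrier (U_inv_alg p m)" by (simp add: rho_def)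
  show "col_weight m F (lift p m f)"
    unfolding col_weight_def
  proof (intro allI impI)
    fix t :: "nat \<Rightarrow> complex" and x assume t: "\<forall>j<m. t j \<noteq> 0"
    define T where "T = mat m m (\<lambda>(i, j). if i = j then t i else 0)"
    have T: "T \<in> torus m" using t by (auto simp: T_def torus_def diagonal_mat_def)
    have "lift p m (act p m (1\<^sub>m p) T f) x = lift p m f (\<lambda>i j. \<Sum>l<m. x i l * T $$ (l, j))"
      by (rule lift_act_right) (simp add: T_def)
    also have "\<dots> = lift p m f (\<lambda>i j. x i j * t j)"
    proof (rule lift_cong)
      fix i j assume "j < m"
      then have "(\<Sum>l<m. x i l * T $$ (l, j)) = (\<Sum>l<m. if l = j then x i l * t l else 0)"
        by (intro sum.cong) (auto simp: T_def)
      then show "(\<Sum>l<m. x i l * T $$ (l, j)) = x i j * t j" using \<open>j < m\<close> by simp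
    qed
    finally have "lift p m f (\<lambda>i j. x i j * t j) = lift p m (act p m (1\<^sub>m p) T f) x" by simp
    also have "act p m (1\<^sub>m p) T f = torus_char m F T \<odot>\<^bsub>U_inv_alg p m\<^esub> f"
      using f T by (auto simp: rho_def)
    also have "lift p m \<dots> x = (\<Prod>j<m. t j ^ F j) * lift p m f x"
      by (simp add: lift_def torus_char_def T_def)
    finally show "lift p m f (\<lambda>i j. x i j * t j) = (\<Prod>j<m. t j ^ F j) * lift p m f x" .
  qed
next
  assume f: "f \<in> carrier (U_inv_alg p m) \<and> col_weight m F (lift p m f)"
  have "act p m (1\<^sub>m p) T f = torus_char m F T \<odot>\<^bsub>U_inv_alg p m\<^esub> f" if T: "T \<in> torus m" for T
  proof -
    have Tc: "T \<in> carrier_mat m m" using T by (simp add: torus_def)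
    have "act p m (1\<^sub>m p) T f Q = torus_char m F T * f Q" if Q: "Q \<in> carrier_mat p m" for Q
    proof -
      have "act p m (1\<^sub>m p) T f Q = lift p m (act p m (1\<^sub>m p) T f) (arr Q)" by (simp add: lift_arr Q)
      also have "\<dots> = lift p m f (\<lambda>i j. \<Sum>l<m. arr Q i l * T $$ (l, j))" by (rule lift_act_right[OF Tc])
      also have "\<dots> = lift p m f (\<lambda>i j. arr Q i j * T $$ (j, j))"
      proof (rule lift_cong)
        fix i j assume "j < m"
        then have "(\<Sum>l<m. arr Q i l * T $$ (l, j)) = (\<Sum>l<m. if l = j then arr Q i l * T $$ (l, l) else 0)"
          using T by (intro sum.cong) (auto simp: torus_def diagonal_mat_def)
        then show "(\<Sum>l<m. arr Q i l * T $$ (l, j)) = arr Q i j * T $$ (j, j)" using \<open>j < m\<close> by simp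
      qed
      also have "\<dots> = (\<Prod>j<m. T $$ (j, j) ^ F j) * lift p m f (arr Q)"
        by (rule f[THEN conjunct2, unfolded col_weight_def, rule_format]) (use T in \<open>simp add: torus_def\<close>)
      finally show ?thesis using Q by (simp add: torus_char_def lift_arr)
    qed
    then show ?thesis by (auto simp: act_def restrict_eq_iff)
  qed
  with f show "f \<in> rho p m F" by (auto simp: rho_def)
qed

text \<open>The components are obtained by scaling column \<open>j\<close> with
  \<open>s ^ N ^ j\<close> and comparing powers of \<open>s\<close>. They stay invariant because
  this scaling normalizes \<open>unip m\<close> and commutes with row operations; row invariance is
  recorded for the elements of \<open>B_GL\<close>. Only nonzero components are kept, since their
  weights are Young diagrams.\<close>

lemma weight_decomposition:
  assumes f: "f \<in> carrier (U_inv_alg p m)"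
  shows "\<exists>L. (\<forall>y\<in>set L. fst y \<in> young m \<and> snd y \<in> rho p m (fst y) \<and>
      (\<forall>q. row_inv q (lift p m f) \<longrightarrow> row_inv q (lift p m (snd y)))) \<and>
    (\<forall>Q\<in>carrier_mat p m. f Q = (\<Sum>y\<leftarrow>L. snd y Q))"
proof -
  let ?F = "lift p m f"
  have F: "polyfn p m ?F" using polyfn_lift[OF U_inv_poly[OF f]] .
  obtain xs where xs: "?F = peval p m xs" using F unfolding polyfn_def by auto
  obtain N where N: "\<And>c e j. (c, e) \<in> set xs \<Longrightarrow> j < m \<Longrightarrow> (\<Sum>i<p. e i j) < (N :: nat)"
    using ex_digit_bound[of xs m p "\<lambda>_. 0"] by metis
  define wt where "wt = (\<lambda>e j. if j < m then \<Sum>i<p. e i j else 0 :: nat)"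
  define D where "D = (\<lambda>b :: nat \<Rightarrow> nat. \<Sum>j<m. b j * N ^ j)"
  define wcomp where "wcomp = (\<lambda>w. peval p m (filter (\<lambda>y. wt (snd y) = w) xs))"
  have D_inj: "D (wt (snd y)) = D (wt (snd z)) \<longleftrightarrow> wt (snd y) = wt (snd z)" if "y \<in> set xs" "z \<in> set xs" for y z
  proof
    assume eq: "D (wt (snd y)) = D (wt (snd z))"
    have b: "wt (snd v) j < N" if "v \<in> set xs" "j < m" for v j
      using N[of "fst v" "snd v" j] that by (simp add: wt_def)
    have "wt (snd y) j = wt (snd z) j" if "j < m" for j
      using digits_inj[of m "wt (snd y)" N "wt (snd z)" j] b that \<open>y \<in> set xs\<close> \<open>z \<in> set xs\<close> eq by (simp add: D_def)
    then show "wt (snd y) = wt (snd z)" by (auto simp: wt_def)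
  qed simp
  have scale: "peval p m zs (\<lambda>i j. x i j * t j) =
      (\<Sum>y\<leftarrow>zs. (\<Prod>j<m. t j ^ wt (snd y) j) * (fst y * monomial_fun p m (snd y) x))" for zs x t
    unfolding peval_alt monomial_fun_col_scale by (simp add: wt_def mult_ac)
  have wcomp_alt: "wcomp w x = (\<Sum>y\<leftarrow>xs. if wt (snd y) = w then fst y * monomial_fun p m (snd y) x else 0)" for w x
    unfolding wcomp_def by (rule peval_filter)
  have weight: "col_weight m w (wcomp w)" for w
  proof -
    have "wcomp w (\<lambda>i j. x i j * t j) = (\<Sum>y\<leftarrow>filter (\<lambda>y. wt (snd y) = w) xs.
        (\<Prod>j<m. t j ^ w j) * (fst y * monomial_fun p m (snd y) x))" for x t
      unfolding wcomp_def scale by (intro arg_cong[of _ _ sum_list] map_cong) auto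
    then show ?thesis by (simp add: col_weight_def wcomp_def peval_alt sum_list_const_mult)
  qed
  \<comment> \<open>If the scaled values at \<open>x'\<close> and at \<open>x\<close> agree for all
    \<open>s\<close>, then so do their coefficients in \<open>s\<close>, which are the
    components.\<close>
  have transfer: "wcomp w x' = wcomp w x"
    if w: "w \<in> (\<lambda>y. wt (snd y)) ` set xs"
      and eq: "\<And>s. s \<noteq> 0 \<Longrightarrow> ?F (\<lambda>i j. x' i j * s ^ N ^ j) = ?F (\<lambda>i j. x i j * s ^ N ^ j)" for x x' w
  proof -
    obtain z where z: "z \<in> set xs" "w = wt (snd z)" using w by auto
    have "(\<Sum>y\<leftarrow>xs. if D (wt (snd y)) = D w then fst y * monomial_fun p m (snd y) x' else 0) =
      (\<Sum>y\<leftarrow>xs. if D (wt (snd y)) = D w then fst y * monomial_fun p m (snd y) x else 0)"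
    proof (rule power_sum_coeff)
      fix s :: complex assume s: "s \<noteq> 0"
      have ev: "?F (\<lambda>i j. y i j * s ^ N ^ j) = (\<Sum>z\<leftarrow>xs. fst z * monomial_fun p m (snd z) y * s ^ D (wt (snd z)))" for y
      proof -
        have "(\<Prod>j<m. (s ^ N ^ j) ^ b j) = s ^ D b" for b
          by (simp add: D_def power_sum mult.commute flip: power_mult)
        then show ?thesis unfolding xs scale by (simp add: mult.commute)
      qed
      show "(\<Sum>y\<leftarrow>xs. fst y * monomial_fun p m (snd y) x' * s ^ D (wt (snd y))) =
         (\<Sum>y\<leftarrow>xs. fst y * monomial_fun p m (snd y) x * s ^ D (wt (snd y)))"
        using eq[OF s] unfolding ev .
    qed
    moreover have "(\<Sum>y\<leftarrow>xs. if D (wt (snd y)) = D w then fst y * monomial_fun p m (snd y) v else 0) = wcomp w v" for v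
      unfolding wcomp_alt using D_inj[OF _ z(1)] z(2) by (intro arg_cong[of _ _ sum_list] map_cong) auto
    ultimately show ?thesis by simp
  qed
  have inv: "wcomp w (cmul m u x) = wcomp w x" if u: "u \<in> unip m" and w: "w \<in> (\<lambda>y. wt (snd y)) ` set xs" for u x w
  proof (rule transfer[OF w])
    fix s :: complex assume s: "s \<noteq> 0"
    \<comment> \<open>The conjugate of \<open>u\<close> by the diagonal matrix with entries
      \<open>s ^ N ^ j\<close>.\<close>
    define u' where "u' = mat m m (\<lambda>(l, j). u $$ (l, j) * s ^ N ^ j / s ^ N ^ l)"
    have u': "u' \<in> unip m" using u s by (auto simp: u'_def unip_iff)
    have "?F (\<lambda>i j. cmul m u x i j * s ^ N ^ j) = ?F (cmul m u' (\<lambda>i j. x i j * s ^ N ^ j))"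
      using s by (intro lift_cong) (auto simp: cmul_def u'_def sum_distrib_right intro!: sum.cong)
    also have "\<dots> = ?F (\<lambda>i j. x i j * s ^ N ^ j)" by (rule U_inv_lift[OF f u'])
    finally show "?F (\<lambda>i j. cmul m u x i j * s ^ N ^ j) = ?F (\<lambda>i j. x i j * s ^ N ^ j)" .
  qed
  have row: "row_inv q (wcomp w)" if r: "row_inv q ?F" and w: "w \<in> (\<lambda>y. wt (snd y)) ` set xs" for q w
    unfolding row_inv_def
  proof (intro allI impI)
    fix c c' and t :: complex and x assume c: "c < c'" "c' < q"
    show "wcomp w (rowop c c' t x) = wcomp w x"
    proof (rule transfer[OF w])
      fix s :: complex
      have "(\<lambda>i j. rowop c c' t x i j * s ^ N ^ j) = rowop c c' t (\<lambda>i j. x i j * s ^ N ^ j)"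
        by (auto simp: rowop_def fun_eq_iff algebra_simps)
      then show "?F (\<lambda>i j. rowop c c' t x i j * s ^ N ^ j) = ?F (\<lambda>i j. x i j * s ^ N ^ j)"
        using r c by (simp add: row_inv_def)
    qed
  qed
  define S where "S = {w \<in> (\<lambda>y. wt (snd y)) ` set xs. \<exists>x. wcomp w x \<noteq> 0}"
  have finS: "finite S" by (auto simp: S_def)
  define g where "g = (\<lambda>w. \<lambda>Q\<in>carrier_mat p m. wcomp w (arr Q))"
  have wcomp_poly: "polyfn p m (wcomp w)" for w unfolding wcomp_def polyfn_def by blast
  have gU: "g w \<in> carrier (U_inv_alg p m)" and lg: "lift p m (g w) = wcomp w" if "w \<in> S" for w
    unfolding g_def using restrict_in_U_inv[OF wcomp_poly inv] lift_restrict[OF wcomp_poly] that by (auto simp: S_def)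
  have g: "g w \<in> rho p m w" if "w \<in> S" for w
    using gU[OF that] lg[OF that] weight by (simp add: rho_iff)
  have young: "w \<in> young m" if w: "w \<in> S" for w
  proof -
    obtain x where x: "wcomp w x \<noteq> 0" using w by (auto simp: S_def)
    have z: "w j = 0" if "m \<le> j" for j using w that by (auto simp: S_def wt_def)
    have "w (Suc j) \<le> w j" for j
    proof (cases "Suc j < m")
      case True
      then show ?thesis
        using col_weight_dominant[OF wcomp_poly _ weight True, of w x] U_inv_col_inv[OF gU[OF w]] lg[OF w] x
        by (metis not_le)
    qed (use z in simp)
    then show ?thesis using z by (auto simp: young_def intro!: decseq_SucI)
  qed
  have lgw: "lift p m (g w) = wcomp w" "w \<in> (\<lambda>y. wt (snd y)) ` set xs" if "w \<in> S" for w
    using lg[OF that] that by (auto simp: S_def fun_eq_iff)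
  obtain W where W: "set W = S" "distinct W" using finite_distinct_list[OF finS] by auto
  have sum: "?F x = (\<Sum>w\<in>S. wcomp w x)" for x
  proof -
    have "(\<Sum>w\<in>(\<lambda>y. wt (snd y)) ` set xs. wcomp w x) = (\<Sum>w\<in>S. wcomp w x)"
      by (rule sum.mono_neutral_right) (auto simp: S_def)
    moreover have "finite T \<Longrightarrow> (\<lambda>y. wt (snd y)) ` set zs \<subseteq> T \<Longrightarrow>
      (\<Sum>w\<in>T. \<Sum>y\<leftarrow>zs. if wt (snd y) = w then fst y * monomial_fun p m (snd y) x else 0) = peval p m zs x" for T zs
      by (induction zs) (auto simp: peval_alt sum.distrib)
    ultimately show ?thesis unfolding xs wcomp_alt by simp
  qed
  show ?thesis
  proof (intro exI[of _ "map (\<lambda>w. (w, g w)) W"] conjI ballI)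
    fix Q :: "complex mat" assume Q: "Q \<in> carrier_mat p m"
    have "f Q = (\<Sum>w\<in>S. wcomp w (arr Q))" using sum[of "arr Q"] by (simp add: lift_arr Q)
    also have "\<dots> = (\<Sum>w\<leftarrow>W. g w Q)" using Q W by (simp add: sum_list_distinct_conv_sum_set g_def)
    finally show "f Q = (\<Sum>y\<leftarrow>map (\<lambda>w. (w, g w)) W. snd y Q)" by (simp add: o_def)
  qed (use W g young row lgw in auto)
qed

section \<open>The orthogonal group\<close>

lemma antidiag_carrier [simp]: "antidiag p \<in> carrier_mat p p"
  by (simp add: antidiag_def)

lemma antidiag_dim [simp]: "dim_row (antidiag p) = p" "dim_col (antidiag p) = p"
  by (simp_all add: antidiag_def)

lemma antidiag_one [simp]: "1\<^sub>m p * antidiag p = antidiag p" "antidiag p * 1\<^sub>m p = antidiag p"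
  by (rule left_mult_one_mat[OF antidiag_carrier], rule right_mult_one_mat[OF antidiag_carrier])

lemma square_mult: "A \<in> carrier_mat p p \<Longrightarrow> B \<in> carrier_mat p p \<Longrightarrow> A * B \<in> carrier_mat p p"
  by simp

lemma square_assoc:
  fixes A B C :: "complex mat"
  shows "A \<in> carrier_mat p p \<Longrightarrow> B \<in> carrier_mat p p \<Longrightarrow> C \<in> carrier_mat p p \<Longrightarrow> A * B * C = A * (B * C)"
  by (rule assoc_mult_mat)

lemma antidiag_square: "antidiag p * antidiag p = 1\<^sub>m p"
proof (rule eq_matI)
  fix i j assume ij: "i < dim_row (1\<^sub>m p :: complex mat)" "j < dim_col (1\<^sub>m p :: complex mat)"
  then have "(antidiag p * antidiag p) $$ (i, j) = (\<Sum>l<p. antidiag p $$ (i, l) * antidiag p $$ (l, j))"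
    by (intro mult_mat_entry) auto
  also have "\<dots> = (\<Sum>l<p. if l = p - 1 - i then if i = j then 1 else 0 else 0)"
    by (rule sum.cong) (use ij in \<open>auto simp: antidiag_def\<close>)
  also have "\<dots> = 1\<^sub>m p $$ (i, j)" using ij by auto
  finally show "(antidiag p * antidiag p) $$ (i, j) = 1\<^sub>m p $$ (i, j)" .
qed (auto simp: antidiag_def)

lemma orth_carrier: "g \<in> orth_group p \<Longrightarrow> g \<in> carrier_mat p p"
  by (simp add: orth_group_def)

lemma orth_one: "1\<^sub>m p \<in> orth_group p"
  by (simp add: orth_group_def)

lemma orth_mult:
  assumes "g \<in> orth_group p" "h \<in> orth_group p" shows "g * h \<in> orth_group p"
proof -
  have c: "g \<in> carrier_mat p p" "h \<in> carrier_mat p p" using assms by (auto simp: orth_carrier)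
  have "transpose_mat (g * h) * antidiag p * (g * h) =
      transpose_mat h * (transpose_mat g * antidiag p * g) * h"
    using c by (simp add: transpose_mult[of g p p h p] square_assoc[of _ p] square_mult[of _ p])
  also have "\<dots> = antidiag p" using assms by (simp add: orth_group_def)
  finally show ?thesis using c by (simp add: orth_group_def)
qed

text \<open>Since \<open>J\<^sup>2 = 1\<close>, the inverse of \<open>g\<close> is
  \<open>J g\<^sup>t J\<close>; multiplying in the other order gives
  \<open>g J g\<^sup>t = J\<close>.\<close>

lemma orth_transpose:
  assumes "g \<in> orth_group p" shows "transpose_mat g \<in> orth_group p"
proof -
  let ?J = "antidiag p"
  have c: "g \<in> carrier_mat p p" "transpose_mat g \<in> carrier_mat p p" using assms by (auto simp: orth_carrier)
  have "(?J * transpose_mat g * ?J) * g = ?J * (transpose_mat g * ?J * g)"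
    using c by (simp add: square_assoc[of _ p] square_mult[of _ p])
  also have "\<dots> = 1\<^sub>m p" using assms by (simp add: orth_group_def antidiag_square)
  finally have "g * (?J * transpose_mat g * ?J) = 1\<^sub>m p"
    using c by (intro mat_mult_left_right_inverse[of _ p g]) (simp_all add: square_mult)
  then have "g * (?J * transpose_mat g * ?J) * ?J = ?J" using c by simp
  moreover have "g * (?J * transpose_mat g * ?J) * ?J = g * ?J * transpose_mat g * (?J * ?J)"
    using c by (simp add: square_assoc[of _ p] square_mult[of _ p])
  ultimately have "g * ?J * transpose_mat g = ?J" using c by (simp add: antidiag_square square_mult[of _ p])
  then show ?thesis using c by (simp add: orth_group_def)
qed

text \<open>The matrix of the form is real. This closure under conjugation is what turns the
  bilinear kernel into a Hermitian one.\<close>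

lemma orth_cnj:
  assumes "g \<in> orth_group p" shows "map_mat cnj g \<in> orth_group p"
proof -
  let ?J = "antidiag p"
  have c: "g \<in> carrier_mat p p" using assms by (auto simp: orth_carrier)
  have mult: "map_mat cnj (A * B) = map_mat cnj A * map_mat cnj B" if "A \<in> carrier_mat p p" "B \<in> carrier_mat p p" for A B
    using that by (intro eq_matI) (auto simp: scalar_prod_def)
  have J: "map_mat cnj ?J = ?J" by (intro eq_matI) (auto simp: antidiag_def)
  have "transpose_mat (map_mat cnj g) = map_mat cnj (transpose_mat g)" by (intro eq_matI) auto
  then have "transpose_mat (map_mat cnj g) * ?J * map_mat cnj g = map_mat cnj (transpose_mat g * ?J * g)"
    using c J by (simp add: mult)
  then show ?thesis using assms J by (auto simp: orth_group_def)
qed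

text \<open>Diagonal entries \<open>s ^ (2 i - (p - 1))\<close>, written as quotients to avoid
  negative exponents; entries \<open>i\<close> and \<open>p - 1 - i\<close> are inverse to each
  other, as the form requires. Up to a common scalar, row \<open>i\<close> is scaled by
  \<open>s ^ (2 i)\<close>.\<close>

definition principal_torus :: "nat \<Rightarrow> complex \<Rightarrow> complex mat" where
  "principal_torus p s = mat p p (\<lambda>(i, j). if i = j then s ^ (2 * i) / s ^ (p - 1) else 0)"

lemma principal_torus_orth:
  assumes "s \<noteq> 0" shows "principal_torus p s \<in> orth_group p"
proof -
  let ?T = "principal_torus p s" and ?J = "antidiag p"
  define t where "t = (\<lambda>i. s ^ (2 * i) / s ^ (p - 1))"
  have T: "?T \<in> carrier_mat p p" "transpose_mat ?T \<in> carrier_mat p p" by (auto simp: principal_torus_def)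
  have "(transpose_mat ?T * ?J * ?T) $$ (i, j) = ?J $$ (i, j)" if ij: "i < p" "j < p" for i j
  proof -
    have "(transpose_mat ?T * ?J * ?T) $$ (i, j) = (\<Sum>l<p. (transpose_mat ?T * ?J) $$ (i, l) * ?T $$ (l, j))"
      using T ij by (intro mult_mat_entry) auto
    also have "\<dots> = (\<Sum>l<p. if l = j then (transpose_mat ?T * ?J) $$ (i, j) * t j else 0)"
      by (rule sum.cong) (use ij in \<open>auto simp: principal_torus_def t_def\<close>)
    also have "\<dots> = (transpose_mat ?T * ?J) $$ (i, j) * t j" using ij by simp
    also have "(transpose_mat ?T * ?J) $$ (i, j) = (\<Sum>l<p. transpose_mat ?T $$ (i, l) * ?J $$ (l, j))"
      using T ij by (intro mult_mat_entry) auto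
    also have "\<dots> = (\<Sum>l<p. if l = i then t i * ?J $$ (i, j) else 0)"
      by (rule sum.cong) (use ij in \<open>auto simp: principal_torus_def t_def\<close>)
    also have "\<dots> = t i * ?J $$ (i, j)" using ij by simp
    also have "t i * ?J $$ (i, j) * t j = ?J $$ (i, j)"
    proof (cases "i + j + 1 = p")
      case True
      have "t i * t j = s ^ (2 * i + 2 * j) / s ^ ((p - 1) + (p - 1))" by (simp add: t_def power_add)
      also have "2 * i + 2 * j = (p - 1) + (p - 1)" using True by simp
      finally have "t i * t j = 1" using assms by simp
      then show ?thesis using ij True by (simp add: antidiag_def mult.commute)
    qed (use ij in \<open>simp add: antidiag_def\<close>)
    finally show ?thesis .
  qed
  then have "transpose_mat ?T * ?J * ?T = ?J"
  proof (intro eq_matI)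
    show "dim_row (transpose_mat ?T * ?J * ?T) = dim_row ?J" "dim_col (transpose_mat ?T * ?J * ?T) = dim_col ?J"
      by (simp_all add: principal_torus_def)
  qed (simp only: antidiag_dim)
  then show ?thesis using T by (simp add: orth_group_def)
qed

lemma O_submodule_iff:
  "O_submodule p m S \<longleftrightarrow> S \<subseteq> carrier (U_inv_alg p m) \<and> (\<lambda>Q\<in>carrier_mat p m. 0) \<in> S \<and>
    (\<forall>f\<in>S. \<forall>g\<in>S. (\<lambda>Q\<in>carrier_mat p m. f Q + g Q) \<in> S) \<and>
    (\<forall>c. \<forall>f\<in>S. (\<lambda>Q\<in>carrier_mat p m. c * f Q) \<in> S) \<and>
    (\<forall>g\<in>orth_group p. \<forall>f\<in>S. act p m g (1\<^sub>m m) f \<in> S)" (is "_ \<longleftrightarrow> ?R")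
proof
  assume S: "O_submodule p m S"
  interpret submodule S complex_ring "U_inv_alg p m" using S by (simp add: O_submodule_def)
  have "(\<lambda>Q\<in>carrier_mat p m. c * f Q) \<in> S" if "f \<in> S" for c f
    using smult_closed[of c f] that by (simp add: ring_of_type_algebra_def)
  then show ?R using S subset m_closed one_closed by (auto simp: O_submodule_def)
next
  assume R: ?R
  interpret ring "U_inv_alg p m" by (rule ring_U_inv_alg)
  have "inv\<^bsub>add_monoid (U_inv_alg p m)\<^esub> f \<in> S" if f: "f \<in> S" for f
  proof -
    have "\<ominus>\<^bsub>U_inv_alg p m\<^esub> f = (\<lambda>Q\<in>carrier_mat p m. - 1 * f Q)"
    proof (rule minus_equality)
      show "f \<in> carrier (U_inv_alg p m)" "(\<lambda>Q\<in>carrier_mat p m. - 1 * f Q) \<in> carrier (U_inv_alg p m)"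
        using R f by blast+
    qed (auto simp: restrict_eq_iff)
    moreover have "(\<lambda>Q\<in>carrier_mat p m. - 1 * f Q) \<in> S" using R f by blast
    ultimately show ?thesis by (simp add: a_inv_def)
  qed
  then have "submodule S complex_ring (U_inv_alg p m)"
    using R by unfold_locales auto
  then show "O_submodule p m S" using R by (simp add: O_submodule_def)
qed

text \<open>A substitute for the Vandermonde determinant: the sum at \<open>2 s\<close> minus
  \<open>2 ^ M\<close> times the sum at \<open>s\<close> loses its top term, while the other terms
  acquire the nonzero factors \<open>2 ^ D - 2 ^ M\<close>.\<close>

lemma coeff_in_subspace:
  fixes f :: "nat \<Rightarrow> 'a \<Rightarrow> complex"
  assumes zero: "restrict (\<lambda>_. 0) A \<in> S"
    and comb: "\<And>f g c. restrict f A \<in> S \<Longrightarrow> restrict g A \<in> S \<Longrightarrow> restrict (\<lambda>Q. f Q + c * g Q) A \<in> S"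
    and sums: "\<And>s. s \<noteq> 0 \<Longrightarrow> restrict (\<lambda>Q. \<Sum>D<M. s ^ D * f D Q) A \<in> S"
    and "D < M"
  shows "restrict (f D) A \<in> S"
  using sums \<open>D < M\<close>
proof (induction M arbitrary: f D)
  case (Suc M)
  have less: "restrict (f D) A \<in> S" if "D < M" for D
  proof -
    have "restrict (\<lambda>Q. \<Sum>D<M. s ^ D * ((2 ^ D - 2 ^ M) * f D Q)) A \<in> S" if "s \<noteq> 0" for s
    proof -
      have s: "2 * s \<noteq> 0" using that by simp
      have "(\<lambda>Q. (\<Sum>D<Suc M. (2 * s) ^ D * f D Q) + (- (2 ^ M)) * (\<Sum>D<Suc M. s ^ D * f D Q)) =
          (\<lambda>Q. \<Sum>D<M. s ^ D * ((2 ^ D - 2 ^ M) * f D Q))"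
        unfolding sum_distrib_left sum.distrib[symmetric]
        by (simp add: power_mult_distrib algebra_simps)
      with comb[OF Suc.prems(1)[OF s] Suc.prems(1)[OF that], of "- (2 ^ M)"] show ?thesis
        by (simp only:)
    qed
    from Suc.IH[OF this that] have *: "restrict (\<lambda>Q. (2 ^ D - 2 ^ M) * f D Q) A \<in> S" .
    have "(2 :: complex) ^ D \<noteq> 2 ^ M"
    proof
      assume "(2 :: complex) ^ D = 2 ^ M"
      then have "norm ((2 :: complex) ^ D) = norm ((2 :: complex) ^ M)" by simp
      then show False using that by (simp add: norm_power)
    qed
    then have "(\<lambda>Q. 0 + (1 / (2 ^ D - 2 ^ M)) * ((2 ^ D - 2 ^ M) * f D Q)) = f D"
      by (simp add: fun_eq_iff)
    with comb[OF zero *, of "1 / (2 ^ D - 2 ^ M)"] show ?thesis by (simp only:)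
  qed
  have part: "restrict (\<lambda>Q. \<Sum>D<N. f D Q) A \<in> S" if "N \<le> M" for N
    using that
  proof (induction N)
    case 0
    show ?case using zero by (simp only: lessThan_0 sum.empty)
  next
    case (Suc N)
    then have "restrict (\<lambda>Q. \<Sum>D<N. f D Q) A \<in> S" "restrict (f N) A \<in> S" using less[of N] by (simp_all del: restrict_apply)
    from comb[OF this, of 1] show ?case by (simp only: mult_1 sum.lessThan_Suc)
  qed
  have "(\<lambda>Q. (\<Sum>D<Suc M. 1 ^ D * f D Q) + (- 1) * (\<Sum>D<M. f D Q)) = f M" by (simp add: fun_eq_iff)
  with comb[OF Suc.prems(1)[of 1] part[OF order_refl], of "- 1"] have "restrict (f M) A \<in> S"
    by (simp only: one_neq_zero not_False_eq_True simp_thms)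
  then show ?case using less Suc.prems(2) less_Suc_eq by (auto simp del: restrict_apply)
qed simp

section \<open>Highest weight vectors\<close>

definition hw_vector :: "nat \<Rightarrow> nat \<Rightarrow> (nat \<Rightarrow> nat) \<Rightarrow> complex mat \<Rightarrow> complex" where
  "hw_vector p m F = (\<lambda>Q\<in>carrier_mat p m. mprod (lead_rows m F) (arr Q))"

lemma young_dest: "F \<in> young m \<Longrightarrow> F (Suc j) \<le> F j" "F \<in> young m \<Longrightarrow> m \<le> j \<Longrightarrow> F j = 0"
  by (auto simp: young_def antimono_def)

lemma rlen_lead_young: "F \<in> young m \<Longrightarrow> j < m \<Longrightarrow> rlen (lead_rows m F) j = F j"
  using rlen_lead_rows[of m F j] young_dest[of F m] by simp

lemma lead_rows_bound: "m \<le> p \<Longrightarrow> R \<in> set (lead_rows m F) \<Longrightarrow> set R \<subseteq> {..<p} \<and> length R \<le> m"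
  by (auto elim!: set_lead_rows simp del: upt_Suc)

lemma lead_col_weight: "F \<in> young m \<Longrightarrow> col_weight m F (mprod (lead_rows m F))"
  using lead_rows_bound[of m m] by (intro col_weight_mprod) (auto simp: rlen_lead_young)

lemma polyfn_lead: "m \<le> p \<Longrightarrow> polyfn p m (mprod (lead_rows m F))"
  by (rule polyfn_mprod) (rule lead_rows_bound)

lemma lift_hw_vector: "m \<le> p \<Longrightarrow> lift p m (hw_vector p m F) x = mprod (lead_rows m F) x"
  unfolding hw_vector_def by (rule lift_restrict[OF polyfn_lead])

lemma hw_vector_rho:
  assumes "m \<le> p" "F \<in> young m" shows "hw_vector p m F \<in> rho p m F"
proof -
  have "lift p m (hw_vector p m F) = mprod (lead_rows m F)"
    by (rule ext) (rule lift_hw_vector[OF assms(1)])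
  moreover have "hw_vector p m F \<in> carrier (U_inv_alg p m)"
    unfolding hw_vector_def by (rule mprod_in_U_inv) (rule lead_rows_bound[OF assms(1)])
  ultimately show ?thesis using lead_col_weight[OF assms(2)] by (simp add: rho_iff)
qed

text \<open>The degree when row \<open>i\<close> is scaled by \<open>s ^ (2 i)\<close>, that is, the
  weight for \<open>principal_torus\<close> up to a shift.\<close>

definition row_degree :: "nat \<Rightarrow> nat \<Rightarrow> (nat \<Rightarrow> nat \<Rightarrow> nat) \<Rightarrow> nat" where
  "row_degree p m e = (\<Sum>i<p. \<Sum>j<m. 2 * i * e i j)"

lemma peval_row_scale:
  "peval p m xs (\<lambda>i j. s ^ (2 * i) * x i j) =
    (\<Sum>y\<leftarrow>xs. fst y * monomial_fun p m (snd y) x * s ^ row_degree p m (snd y))"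
proof -
  have "monomial_fun p m e (\<lambda>i j. s ^ (2 * i) * x i j) = monomial_fun p m e x * s ^ row_degree p m e" for e
    by (simp add: monomial_fun_def row_degree_def power_mult_distrib prod.distrib power_sum mult.commute
        flip: power_mult)
  then show ?thesis by (simp add: peval_alt mult.assoc)
qed

text \<open>A generic matrix is brought to lower triangular form \<open>y\<close> by column operations; then
  \<open>f (s\<^bsup>2i\<^esup> y\<^sub>i\<^sub>j) = s\<^bsup>d\<^esup> f (s\<^bsup>2(i-j)\<^esup> y\<^sub>i\<^sub>j)\<close> where \<open>d\<close> is the degree below, and the second factor tends to
  the value at the diagonal part of \<open>y\<close>.\<close>

lemma lowest_coefficient:
  assumes f: "f \<in> rho p m F" and F: "F \<in> young m" and "m \<le> p" and xs: "lift p m f = peval p m xs"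
  shows "(\<Sum>y\<leftarrow>xs. if row_degree p m (snd y) = (\<Sum>j<m. 2 * j * F j) then fst y * monomial_fun p m (snd y) x else 0) =
    lift p m f E_arr * mprod (lead_rows m F) x"
proof -
  let ?D = "\<Sum>j<m. 2 * j * F j" and ?L = "lift p m f"
  have L: "polyfn p m ?L" "col_inv m ?L" "col_weight m F ?L"
    using f polyfn_lift[OF U_inv_poly] U_inv_col_inv by (auto simp: rho_iff)
  define H where "H = (\<lambda>x. peval p m (filter (\<lambda>y. row_degree p m (snd y) = ?D) xs) x -
    ?L E_arr * mprod (lead_rows m F) x)"
  have pf: "peval p m (filter (\<lambda>y. row_degree p m (snd y) = ?D) xs) x =
      (\<Sum>y\<leftarrow>xs. if row_degree p m (snd y) = ?D then fst y * monomial_fun p m (snd y) x else 0)" for x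
    by (rule peval_filter)
  have Hp: "polyfn p m H"
    unfolding H_def
    by (rule polyfn_diff[OF _ polyfn_mult[OF polyfn_const polyfn_lead[OF \<open>m \<le> p\<close>]]]) (auto simp: polyfn_def)
  have "H x = 0"
  proof (rule eq_zero_generic[OF Hp \<open>m \<le> p\<close>])
    fix x assume "\<And>j. j \<le> m \<Longrightarrow> minor [0..<j] x \<noteq> 0"
    then obtain y where y: "\<And>H. col_inv m H \<Longrightarrow> H y = H x" "\<And>i j. i < j \<Longrightarrow> j < m \<Longrightarrow> y i j = 0"
      "\<And>j. j < m \<Longrightarrow> y j j \<noteq> 0" by (rule col_elimination[of m x]) auto
    define q where "q = (\<lambda>s. ?L (\<lambda>i j. if j \<le> i then s ^ (2 * (i - j)) * y i j else 0))"
    have "upoly q" unfolding q_def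
      by (rule upoly_polyfn[OF L(1)]) (intro upoly_if upoly_mult upoly_power upoly_id upoly_const)
    then obtain P where P: "\<And>s. q s = poly P s" unfolding upoly_def by auto
    have q0: "q 0 = (\<Prod>j<m. y j j ^ F j) * ?L E_arr"
    proof -
      have "q 0 = ?L (\<lambda>i j. E_arr i j * y j j)"
        unfolding q_def by (rule lift_cong) (auto simp: E_arr_def power_0_left)
      also have "\<dots> = (\<Prod>j<m. y j j ^ F j) * ?L E_arr"
        by (rule L(3)[unfolded col_weight_def, rule_format]) (rule y(3))
      finally show ?thesis .
    qed
    have lead: "mprod (lead_rows m F) x = (\<Prod>j<m. y j j ^ F j)"
    proof -
      have "minor R y = minor R (\<lambda>i j. E_arr i j * y j j)" if R: "R \<in> set (lead_rows m F)" for R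
      proof -
        obtain n where n: "n < m" "R = [0..<Suc n]" by (rule set_lead_rows[OF R])
        have "minor R y = (\<Prod>i<Suc n. y i i)"
          unfolding n(2) by (rule minor_lower_triangular) (use y(2) n(1) in auto)
        also have "\<dots> = minor R (\<lambda>i j. E_arr i j * y j j)"
          unfolding n(2) by (subst minor_lower_triangular) (auto simp: E_arr_def)
        finally show ?thesis .
      qed
      then have "mprod (lead_rows m F) y = mprod (lead_rows m F) (\<lambda>i j. E_arr i j * y j j)"
        unfolding mprod_def by (intro arg_cong[of _ _ prod_list] map_cong) auto
      also have "\<dots> = (\<Prod>j<m. y j j ^ F j) * mprod (lead_rows m F) E_arr"
        by (rule lead_col_weight[OF F, unfolded col_weight_def, rule_format]) (rule y(3))
      finally show ?thesis using y(1)[OF col_inv_mprod] by (simp add: mprod_lead_rows_E)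
    qed
    have G: "?L (\<lambda>i j. s ^ (2 * i) * x i j) = s ^ ?D * q s" if s: "s \<noteq> 0" for s
    proof -
      have "(\<lambda>i j. s ^ (2 * i) * colop c c' t x i j) = colop c c' t (\<lambda>i j. s ^ (2 * i) * x i j)" for c c' t x
        by (auto simp: colop_def fun_eq_iff algebra_simps)
      then have "col_inv m (\<lambda>x. ?L (\<lambda>i j. s ^ (2 * i) * x i j))"
        using L(2) by (simp add: col_inv_def)
      then have "?L (\<lambda>i j. s ^ (2 * i) * x i j) = ?L (\<lambda>i j. s ^ (2 * i) * y i j)"
        by (rule y(1)[symmetric])
      also have "\<dots> = ?L (\<lambda>i j. (if j \<le> i then s ^ (2 * (i - j)) * y i j else 0) * s ^ (2 * j))"
      proof (rule lift_cong)
        fix i j assume ij: "i < p" "j < m"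
        show "s ^ (2 * i) * y i j = (if j \<le> i then s ^ (2 * (i - j)) * y i j else 0) * s ^ (2 * j)"
        proof (cases "j \<le> i")
          case True
          then have "2 * i = 2 * (i - j) + 2 * j" by simp
          then have "s ^ (2 * i) = s ^ (2 * (i - j)) * s ^ (2 * j)" by (metis power_add)
          then show ?thesis using True by simp
        qed (use y(2) ij in simp)
      qed
      also have "\<dots> = (\<Prod>j<m. (s ^ (2 * j)) ^ F j) * q s"
        unfolding q_def by (rule L(3)[unfolded col_weight_def, rule_format]) (use s in simp)
      also have "(\<Prod>j<m. (s ^ (2 * j)) ^ F j) = s ^ ?D" by (simp add: power_sum flip: power_mult)
      finally show ?thesis .
    qed
    have "(\<Sum>y\<leftarrow>xs. if row_degree p m (snd y) = ?D then fst y * monomial_fun p m (snd y) x else 0) =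
        (\<Sum>i\<leftarrow>[0..<Suc (Polynomial.degree P)]. if ?D + i = ?D then Polynomial.coeff P i else 0)"
    proof (rule power_sum_coeff)
      fix s :: complex assume s: "s \<noteq> 0"
      have "(\<Sum>i\<leftarrow>[0..<Suc (Polynomial.degree P)]. Polynomial.coeff P i * s ^ (?D + i)) = s ^ ?D * poly P s"
      proof -
        have "(\<Sum>i\<leftarrow>[0..<Suc (Polynomial.degree P)]. Polynomial.coeff P i * s ^ (?D + i)) =
            (\<Sum>i\<le>Polynomial.degree P. Polynomial.coeff P i * s ^ (?D + i))"
          by (simp add: interv_sum_list_conv_sum_set_nat atLeast0AtMost atLeastLessThanSuc_atLeastAtMost del: upt_Suc)
        also have "\<dots> = s ^ ?D * poly P s"
          unfolding poly_altdef sum_distrib_left by (rule sum.cong) (simp_all add: power_add)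
        finally show ?thesis .
      qed
      then show "(\<Sum>y\<leftarrow>xs. fst y * monomial_fun p m (snd y) x * s ^ row_degree p m (snd y)) =
          (\<Sum>i\<leftarrow>[0..<Suc (Polynomial.degree P)]. Polynomial.coeff P i * s ^ (?D + i))"
        using G[OF s] P by (simp add: xs peval_row_scale del: upt_Suc)
    qed
    also have "\<dots> = Polynomial.coeff P 0"
      by (simp add: interv_sum_list_conv_sum_set_nat del: upt_Suc)
    also have "\<dots> = q 0" by (simp add: P poly_0_coeff_0)
    finally show "H x = 0" by (simp add: H_def pf q0 lead)
  qed
  then show ?thesis by (simp add: H_def pf)
qed

text \<open>The principal torus lies in the orthogonal group, so \<open>I\<close> contains all
  homogeneous parts of \<open>f\<close> for \<open>row_degree\<close>. The lowest part is the
  highest weight vector times the value of \<open>f\<close> at \<open>E_arr\<close>.\<close>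

lemma hw_vector_in_submodule:
  assumes I: "O_submodule p m I" "I \<subseteq> rho p m F" and F: "F \<in> young m" "m \<le> p"
    and f: "f \<in> I" "lift p m f E_arr \<noteq> 0"
  shows "hw_vector p m F \<in> I"
proof -
  let ?A = "carrier_mat p m" and ?D = "\<Sum>j<m. 2 * j * F j" and ?L = "lift p m f"
  have sub: "I \<subseteq> carrier (U_inv_alg p m)" "(\<lambda>Q\<in>?A. 0) \<in> I"
    "\<And>f g. f \<in> I \<Longrightarrow> g \<in> I \<Longrightarrow> (\<lambda>Q\<in>?A. f Q + g Q) \<in> I"
    "\<And>c f. f \<in> I \<Longrightarrow> (\<lambda>Q\<in>?A. c * f Q) \<in> I"
    "\<And>g f. g \<in> orth_group p \<Longrightarrow> f \<in> I \<Longrightarrow> act p m g (1\<^sub>m m) f \<in> I"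
    using I(1) unfolding O_submodule_iff by blast+
  have frho: "f \<in> rho p m F" using f I by blast
  then have L: "polyfn p m ?L" "col_weight m F ?L"
    using polyfn_lift[OF U_inv_poly] by (auto simp: rho_iff)
  obtain xs where xs: "?L = peval p m xs" using L(1) unfolding polyfn_def by auto
  define M where "M = Suc (?D + (\<Sum>y\<leftarrow>xs. row_degree p m (snd y)))"
  define fD where "fD = (\<lambda>D Q. \<Sum>y\<leftarrow>xs. if row_degree p m (snd y) = D then fst y * monomial_fun p m (snd y) (arr Q) else 0)"
  have comb: "restrict (\<lambda>Q. f Q + c * g Q) ?A \<in> I" if "restrict f ?A \<in> I" "restrict g ?A \<in> I" for f g c
  proof -
    have "(\<lambda>Q\<in>?A. restrict f ?A Q + (\<lambda>Q\<in>?A. c * restrict g ?A Q) Q) \<in> I"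
      by (rule sub(3)[OF that(1) sub(4)[OF that(2)]])
    moreover have "(\<lambda>Q\<in>?A. restrict f ?A Q + (\<lambda>Q\<in>?A. c * restrict g ?A Q) Q) = restrict (\<lambda>Q. f Q + c * g Q) ?A"
      by (rule restrict_ext) simp
    ultimately show ?thesis by (simp only:)
  qed
  have sums: "restrict (\<lambda>Q. \<Sum>D<M. s ^ D * fD D Q) ?A \<in> I" if s: "s \<noteq> 0" for s
  proof -
    \<comment> \<open>The common factor \<open>1 / s ^ (p - 1)\<close> of the torus entries, carried
      through the column weight \<open>F\<close>.\<close>
    define K where "K = (\<Prod>j<m. (1 / s ^ (p - 1)) ^ F j)"
    have K: "K \<noteq> 0" using s by (simp add: K_def)
    have "(\<Sum>D<M. s ^ D * fD D Q) = (1 / K) * act p m (principal_torus p s) (1\<^sub>m m) f Q"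
      if Q: "Q \<in> ?A" for Q
    proof -
      have T: "principal_torus p s \<in> carrier_mat p p" by (simp add: principal_torus_def)
      have "act p m (principal_torus p s) (1\<^sub>m m) f Q = lift p m (act p m (principal_torus p s) (1\<^sub>m m) f) (arr Q)"
        by (simp add: lift_arr Q)
      also have "\<dots> = ?L (\<lambda>i j. (s ^ (2 * i) * arr Q i j) * (1 / s ^ (p - 1)))"
        unfolding lift_act_left[OF T]
      proof (rule lift_cong)
        fix i j assume i: "i < p"
        have "(\<Sum>l<p. principal_torus p s $$ (l, i) * arr Q l j) =
            (\<Sum>l<p. if l = i then s ^ (2 * l) * arr Q l j / s ^ (p - 1) else 0)"
          by (rule sum.cong) (use i in \<open>auto simp: principal_torus_def\<close>)
        then show "(\<Sum>l<p. principal_torus p s $$ (l, i) * arr Q l j) = (s ^ (2 * i) * arr Q i j) * (1 / s ^ (p - 1))"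
          using i by simp
      qed
      also have "\<dots> = K * ?L (\<lambda>i j. s ^ (2 * i) * arr Q i j)"
        unfolding K_def by (rule L(2)[unfolded col_weight_def, rule_format]) (use s in simp)
      also have "?L (\<lambda>i j. s ^ (2 * i) * arr Q i j) = (\<Sum>D<M. s ^ D * fD D Q)"
      proof -
        have "(\<Sum>D<M. s ^ D * (\<Sum>y\<leftarrow>ys. if row_degree p m (snd y) = D then fst y * monomial_fun p m (snd y) (arr Q) else 0)) =
            (\<Sum>y\<leftarrow>ys. fst y * monomial_fun p m (snd y) (arr Q) * s ^ row_degree p m (snd y))"
          if "\<And>y. y \<in> set ys \<Longrightarrow> row_degree p m (snd y) < M" for ys
          using that
        proof (induction ys)
          case (Cons y ys)
          have "(\<Sum>D<M. s ^ D * (if row_degree p m (snd y) = D then fst y * monomial_fun p m (snd y) (arr Q) else 0)) =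
              (\<Sum>D<M. if D = row_degree p m (snd y) then fst y * monomial_fun p m (snd y) (arr Q) * s ^ D else 0)"
            by (rule sum.cong) auto
          with Cons show ?case by (simp add: distrib_left sum.distrib)
        qed simp
        moreover have "row_degree p m (snd y) < M" if "y \<in> set xs" for y
          using member_le_sum_list[of "row_degree p m (snd y)" "map (\<lambda>y. row_degree p m (snd y)) xs"] that
          by (auto simp: M_def)
        ultimately show ?thesis by (simp add: xs peval_row_scale fD_def)
      qed
      finally show ?thesis using K by simp
    qed
    then have "restrict (\<lambda>Q. \<Sum>D<M. s ^ D * fD D Q) ?A = (\<lambda>Q\<in>?A. (1 / K) * act p m (principal_torus p s) (1\<^sub>m m) f Q)"
      by (intro restrict_ext)
    with sub(4)[OF sub(5)[OF principal_torus_orth[OF s] f(1)]] show ?thesis by (simp only:)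
  qed
  have "restrict (fD ?D) ?A \<in> I"
    by (rule coeff_in_subspace[OF sub(2) comb sums]) (simp_all only: M_def, simp)
  from sub(4)[OF this, of "1 / ?L E_arr"]
  have "(\<lambda>Q\<in>?A. 1 / ?L E_arr * restrict (fD ?D) ?A Q) \<in> I" .
  moreover have "(\<lambda>Q\<in>?A. 1 / ?L E_arr * restrict (fD ?D) ?A Q) = hw_vector p m F"
    unfolding hw_vector_def
    by (rule restrict_ext) (simp add: fD_def lowest_coefficient[OF frho F xs] f(2))
  ultimately show ?thesis by (simp only:)
qed

text \<open>Under the diagonal matrix with entries \<open>s ^ (2 i)\<close> the vector is
  homogeneous of the lowest possible degree. It is therefore equal to its lowest coefficient, which
  is proportional to its value at \<open>E_arr\<close>.\<close>

lemma highest_weight_unique: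
  assumes v: "GL_highest_weight p m F v" "v \<in> rho p m F" and F: "F \<in> young m" "m \<le> p"
  shows "lift p m v E_arr \<noteq> 0"
proof
  assume v0: "lift p m v E_arr = 0"
  let ?L = "lift p m v" and ?D = "\<Sum>j<m. 2 * j * F j"
  have L: "polyfn p m ?L" using v(2) polyfn_lift[OF U_inv_poly] by (auto simp: rho_iff)
  obtain xs where xs: "?L = peval p m xs" using L unfolding polyfn_def by auto
  have "?L x = 0" for x
  proof -
    have "(\<Sum>y\<leftarrow>xs. if row_degree p m (snd y) = ?D then fst y * monomial_fun p m (snd y) x else 0) =
      (\<Sum>z\<leftarrow>[()]. if ?D = ?D then ?L x else 0)"
    proof (rule power_sum_coeff)
      fix s :: complex assume s: "s \<noteq> 0"
      define T where "T = mat p p (\<lambda>(i, j). if i = j then s ^ (2 * i) else 0)"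
      have T: "T \<in> torus p" "T \<in> carrier_mat p p" using s by (auto simp: T_def torus_def diagonal_mat_def)
      have "(\<Sum>y\<leftarrow>xs. fst y * monomial_fun p m (snd y) x * s ^ row_degree p m (snd y)) = ?L (\<lambda>i j. s ^ (2 * i) * x i j)"
        by (simp add: xs peval_row_scale)
      also have "\<dots> = lift p m (act p m T (1\<^sub>m m) v) x"
        unfolding lift_act_left[OF T(2)]
      proof (rule lift_cong)
        fix i j assume i: "i < p"
        have "(\<Sum>l<p. T $$ (l, i) * x l j) = (\<Sum>l<p. if l = i then s ^ (2 * l) * x l j else 0)"
          by (rule sum.cong) (use i in \<open>auto simp: T_def\<close>)
        then show "s ^ (2 * i) * x i j = (\<Sum>l<p. T $$ (l, i) * x l j)" using i by simp
      qed
      also have "act p m T (1\<^sub>m m) v = torus_char p F T \<odot>\<^bsub>U_inv_alg p m\<^esub> v"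
        using v(1) T(1) by (auto simp: GL_highest_weight_def)
      also have "lift p m \<dots> x = torus_char p F T * ?L x" by (simp add: lift_def)
      also have "torus_char p F T = (\<Prod>i<m. (s ^ (2 * i)) ^ F i)"
        unfolding torus_char_def
        by (rule prod.mono_neutral_cong_right) (use F young_dest[OF F(1)] in \<open>auto simp: T_def\<close>)
      also have "\<dots> = s ^ ?D" by (simp add: power_sum flip: power_mult)
      finally show "(\<Sum>y\<leftarrow>xs. fst y * monomial_fun p m (snd y) x * s ^ row_degree p m (snd y)) = (\<Sum>z\<leftarrow>[()]. ?L x * s ^ ?D)"
        by simp
    qed
    then show ?thesis using lowest_coefficient[OF v(2) F xs, of x] v0 by simp
  qed
  then have "v = \<zero>\<^bsub>U_inv_alg p m\<^esub>"
    using poly_funs_extensional[of v p m] U_inv_poly[of v p m] v(2) lift_arr[of _ p m v]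
    by (intro ext_eqI[of v p m]) (auto simp: rho_iff)
  then show False using v(1) by (simp add: GL_highest_weight_def)
qed

text \<open>A leading minor uses equally many first rows and first columns, so scaling the rows has
  the same effect on it as scaling the columns, and the torus of \<open>GL\<^sub>p\<close> acts by
  the column weight.\<close>

lemma hw_vector_highest_weight:
  assumes F: "F \<in> young m" "m \<le> p"
  shows "GL_highest_weight p m F (hw_vector p m F)"
proof -
  let ?L = "mprod (lead_rows m F)"
  have poly: "polyfn p m ?L" by (rule polyfn_lead[OF F(2)])
  have one: "cmul m (1\<^sub>m m) x i j = x i j" if "j < m" for x i j
  proof -
    have "cmul m (1\<^sub>m m) x i j = (\<Sum>l<m. if l = j then x i l else 0)"
      unfolding cmul_def by (rule sum.cong) (use that in auto)
    then show ?thesis using that by simp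
  qed
  have actL: "act p m g (1\<^sub>m m) (hw_vector p m F) = (\<lambda>Q\<in>carrier_mat p m. ?L (rmul p g (arr Q)))"
    if "g \<in> carrier_mat p p" for g
  proof -
    have "?L (cmul m (1\<^sub>m m) x) = ?L x" for x by (rule polyfn_cong[OF poly]) (rule one)
    then show ?thesis unfolding hw_vector_def by (simp add: act_restrict[OF poly that])
  qed
  have "hw_vector p m F \<noteq> \<zero>\<^bsub>U_inv_alg p m\<^esub>"
  proof
    assume "hw_vector p m F = \<zero>\<^bsub>U_inv_alg p m\<^esub>"
    then have "lift p m (hw_vector p m F) E_arr = 0" by (simp add: lift_def)
    then show False by (simp add: lift_hw_vector[OF F(2)] mprod_lead_rows_E)
  qed
  moreover have "act p m g (1\<^sub>m m) (hw_vector p m F) = hw_vector p m F" if g: "g \<in> unip p" for g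
  proof -
    have gc: "g \<in> carrier_mat p p" using g by (rule unip_carrier)
    have ge: "GL_embed p p g = g"
      using GL_embed_carrier[OF gc order_refl] gc by (intro eq_matI) (auto simp: GL_embed_index)
    have "?L (rmul p g x) = ?L x" for x
      unfolding mprod_def
    proof (intro arg_cong[of _ _ prod_list] map_cong refl)
      fix R assume "R \<in> set (lead_rows m F)"
      then obtain n where "n < m" "R = [0..<Suc n]" by (erule set_lead_rows)
      then have "good_row p p R" using F(2) by (auto intro!: good_row_upt simp del: upt_Suc)
      from minor_rmul_unip[OF g order_refl this] show "minor R (rmul p g x) = minor R x" by (simp add: ge)
    qed
    then show ?thesis unfolding actL[OF gc] by (simp add: hw_vector_def)
  qed
  moreover have "act p m t (1\<^sub>m m) (hw_vector p m F) = torus_char p F t \<odot>\<^bsub>U_inv_alg p m\<^esub> hw_vector p m F"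
    if t: "t \<in> torus p" for t
  proof -
    have tc: "t \<in> carrier_mat p p" using t by (simp add: torus_def)
    define d where "d = (\<lambda>i. t $$ (i, i))"
    have d: "d j \<noteq> 0" if "j < m" for j using t that F(2) by (simp add: d_def torus_def)
    have "?L (rmul p t x) = torus_char p F t * ?L x" for x
    proof -
      have "rmul p t x i j = d i * x i j" if "i < p" for i j
      proof -
        have "rmul p t x i j = (\<Sum>l<p. if l = i then d l * x l j else 0)"
          unfolding rmul_def by (rule sum.cong) (use t that in \<open>auto simp: torus_def diagonal_mat_def d_def\<close>)
        then show ?thesis using that by simp
      qed
      then have "?L (rmul p t x) = ?L (\<lambda>i j. d i * x i j)" by (intro polyfn_cong[OF poly])
      also have "\<dots> = ?L (\<lambda>i j. x i j * d j)"
        unfolding mprod_def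
      proof (intro arg_cong[of _ _ prod_list] map_cong refl)
        fix R assume "R \<in> set (lead_rows m F)"
        then obtain n where "n < m" "R = [0..<Suc n]" by (erule set_lead_rows)
        then show "minor R (\<lambda>i j. d i * x i j) = minor R (\<lambda>i j. x i j * d j)"
          by (simp add: minor_row_scale minor_col_scale prod.list_conv_set_nth atLeast0LessThan del: upt_Suc)
      qed
      also have "\<dots> = (\<Prod>j<m. d j ^ F j) * ?L x"
        by (rule lead_col_weight[OF F(1), unfolded col_weight_def, rule_format]) (rule d)
      also have "(\<Prod>j<m. d j ^ F j) = torus_char p F t"
        unfolding torus_char_def d_def
        by (rule prod.mono_neutral_left) (use F young_dest[OF F(1)] in auto)
      finally show ?thesis .
    qed
    then show ?thesis unfolding actL[OF tc] by (auto simp: hw_vector_def restrict_eq_iff)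
  qed
  ultimately show ?thesis by (simp add: GL_highest_weight_def)
qed

section \<open>The orbit of the highest weight vector\<close>

lemma rmul_rmul:
  assumes "g \<in> carrier_mat p p" "h \<in> carrier_mat p p" "i < p"
  shows "rmul p g (rmul p h x) i j = rmul p (h * g) x i j"
proof -
  have "rmul p g (rmul p h x) i j = (\<Sum>s<p. \<Sum>r<p. h $$ (r, s) * g $$ (s, i) * x r j)"
    by (simp add: rmul_def sum_distrib_left mult_ac)
  also have "\<dots> = (\<Sum>r<p. \<Sum>s<p. h $$ (r, s) * g $$ (s, i) * x r j)" by (rule sum.swap)
  also have "\<dots> = rmul p (h * g) x i j"
    unfolding rmul_def
  proof (rule sum.cong)
    fix r assume "r \<in> {..<p}"
    then have "(h * g) $$ (r, i) = (\<Sum>s<p. h $$ (r, s) * g $$ (s, i))"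
      using assms by (intro mult_mat_entry) auto
    then show "(\<Sum>s<p. h $$ (r, s) * g $$ (s, i) * x r j) = (h * g) $$ (r, i) * x r j"
      by (simp add: sum_distrib_right)
  qed simp
  finally show ?thesis .
qed

lemma rmul_cmul: "rmul p g (cmul m u x) = cmul m u (rmul p g x)"
proof (intro ext)
  fix i j
  have "rmul p g (cmul m u x) i j = (\<Sum>s<p. \<Sum>l<m. g $$ (s, i) * x s l * u $$ (l, j))"
    by (simp add: rmul_def cmul_def sum_distrib_left mult_ac)
  also have "\<dots> = (\<Sum>l<m. \<Sum>s<p. g $$ (s, i) * x s l * u $$ (l, j))" by (rule sum.swap)
  also have "\<dots> = cmul m u (rmul p g x) i j" by (simp add: rmul_def cmul_def sum_distrib_right)
  finally show "rmul p g (cmul m u x) i j = cmul m u (rmul p g x) i j" .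
qed

lemma lift_act: "g \<in> carrier_mat p p \<Longrightarrow> lift p k (act p k g (1\<^sub>m k) f) x = lift p k f (rmul p g x)"
  by (simp add: lift_act_left rmul_def)

lemma rmul_E: "g \<in> carrier_mat p p \<Longrightarrow> i < p \<Longrightarrow> j < p \<Longrightarrow> rmul p (transpose_mat g) E_arr i j = arr g i j"
proof -
  assume g: "g \<in> carrier_mat p p" "i < p" "j < p"
  have "rmul p (transpose_mat g) E_arr i j = (\<Sum>s<p. if s = j then g $$ (i, s) else 0)"
    unfolding rmul_def by (rule sum.cong) (use g in \<open>auto simp: E_arr_def\<close>)
  then show ?thesis using g by (simp add: arr_def)
qed

lemma rmul_arr:
  assumes "g \<in> carrier_mat p p" "h \<in> carrier_mat p p" "i < p" "j < p"
  shows "rmul p g (arr h) i j = arr (transpose_mat g * h) i j"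
proof -
  have "(transpose_mat g * h) $$ (i, j) = (\<Sum>s<p. transpose_mat g $$ (i, s) * h $$ (s, j))"
    using assms by (intro mult_mat_entry) auto
  then show ?thesis using assms by (simp add: arr_def rmul_def)
qed

text \<open>A combination of translates of the highest weight vector; lists make sums, multiples and
  translations of such combinations into list operations.\<close>

definition orbit_fun :: "nat \<Rightarrow> nat \<Rightarrow> (nat \<Rightarrow> nat) \<Rightarrow> (complex \<times> complex mat) list \<Rightarrow>
    (nat \<Rightarrow> nat \<Rightarrow> complex) \<Rightarrow> complex" where
  "orbit_fun p m F gs x = (\<Sum>y\<leftarrow>gs. fst y * mprod (lead_rows m F) (rmul p (snd y) x))"

definition orbit_span :: "nat \<Rightarrow> nat \<Rightarrow> (nat \<Rightarrow> nat) \<Rightarrow> (complex mat \<Rightarrow> complex) set" where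
  "orbit_span p m F = {\<lambda>Q\<in>carrier_mat p m. orbit_fun p m F gs (arr Q) | gs. \<forall>y\<in>set gs. snd y \<in> orth_group p}"

text \<open>\<open>lift p m f\<close> reads the first \<open>m\<close> columns of \<open>g\<close>,
  that is, the matrix \<open>g E\<close>. The diagonal factor \<open>t\<close> is absorbed by the
  weight.\<close>

definition orbit_vanishing :: "nat \<Rightarrow> nat \<Rightarrow> (nat \<Rightarrow> nat) \<Rightarrow> (complex mat \<Rightarrow> complex) set" where
  "orbit_vanishing p m F = {f \<in> rho p m F. \<forall>g\<in>orth_group p. lift p m f (arr g) = 0}"

context
  fixes p m :: nat and F :: "nat \<Rightarrow> nat"
  assumes F: "F \<in> young m" and mp: "m \<le> p"
begin

lemma polyfn_orbit_fun: "polyfn p m (orbit_fun p m F gs)"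
proof -
  have "polyfn p m (\<lambda>x. mprod (lead_rows m F) (rmul p g x))" for g
  proof (rule polyfn_compose[OF polyfn_lead[OF mp]])
    fix i j assume "j < m"
    then show "polyfn p m (\<lambda>x. rmul p g x i j)"
      unfolding rmul_def by (intro polyfn_sum polyfn_mult[OF polyfn_const] polyfn_coord) auto
  qed
  then show ?thesis unfolding orbit_fun_def[abs_def]
    by (intro polyfn_sum_list polyfn_mult[OF polyfn_const])
qed

lemma lift_orbit_fun: "lift p m (\<lambda>Q\<in>carrier_mat p m. orbit_fun p m F gs (arr Q)) x = orbit_fun p m F gs x"
  by (rule lift_restrict[OF polyfn_orbit_fun])

lemma orbit_fun_rho: "(\<lambda>Q\<in>carrier_mat p m. orbit_fun p m F gs (arr Q)) \<in> rho p m F"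
proof -
  have "orbit_fun p m F gs (cmul m u x) = orbit_fun p m F gs x" if "u \<in> unip m" for u x
  proof -
    have "mprod (lead_rows m F) (cmul m u x) = mprod (lead_rows m F) x" for x
      unfolding mprod_def using minor_cmul_unip[OF that] lead_rows_bound[of m m]
      by (intro arg_cong[of _ _ prod_list] map_cong) auto
    then show ?thesis by (simp add: orbit_fun_def rmul_cmul)
  qed
  then have "(\<lambda>Q\<in>carrier_mat p m. orbit_fun p m F gs (arr Q)) \<in> carrier (U_inv_alg p m)"
    by (intro restrict_in_U_inv polyfn_orbit_fun)
  moreover have "col_weight m F (orbit_fun p m F gs)"
    unfolding col_weight_def
  proof (intro allI impI)
    fix t :: "nat \<Rightarrow> complex" and x assume t: "\<forall>j<m. t j \<noteq> 0"
    have "rmul p g (\<lambda>i j. x i j * t j) = (\<lambda>i j. rmul p g x i j * t j)" for g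
      by (auto simp: rmul_def sum_distrib_right fun_eq_iff mult.assoc)
    moreover have "mprod (lead_rows m F) (\<lambda>i j. x i j * t j) = (\<Prod>j<m. t j ^ F j) * mprod (lead_rows m F) x" for x
      by (rule lead_col_weight[OF F, unfolded col_weight_def, rule_format]) (use t in auto)
    ultimately have "orbit_fun p m F gs (\<lambda>i j. x i j * t j) =
        (\<Sum>y\<leftarrow>gs. (\<Prod>j<m. t j ^ F j) * (fst y * mprod (lead_rows m F) (rmul p (snd y) x)))"
      unfolding orbit_fun_def by (intro arg_cong[of _ _ sum_list] map_cong) auto
    then show "orbit_fun p m F gs (\<lambda>i j. x i j * t j) = (\<Prod>j<m. t j ^ F j) * orbit_fun p m F gs x"
      by (simp add: orbit_fun_def sum_list_const_mult)
  qed
  moreover have "lift p m (\<lambda>Q\<in>carrier_mat p m. orbit_fun p m F gs (arr Q)) = orbit_fun p m F gs"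
    by (rule ext) (rule lift_orbit_fun)
  ultimately show ?thesis by (simp add: rho_iff)
qed

lemma orbit_span_rho: "orbit_span p m F \<subseteq> rho p m F"
  unfolding orbit_span_def using orbit_fun_rho by blast

lemma orbit_span_I: "(\<And>y. y \<in> set gs \<Longrightarrow> snd y \<in> orth_group p) \<Longrightarrow>
    (\<And>Q. Q \<in> carrier_mat p m \<Longrightarrow> f Q = orbit_fun p m F gs (arr Q)) \<Longrightarrow> restrict f (carrier_mat p m) \<in> orbit_span p m F"
  unfolding orbit_span_def by (intro CollectI exI[of _ gs] conjI restrict_ext) auto

lemma orbit_span_submodule: "O_submodule p m (orbit_span p m F)"
  unfolding O_submodule_iff
proof (intro conjI ballI allI)
  show "orbit_span p m F \<subseteq> carrier (U_inv_alg p m)"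
    using orbit_span_rho by (auto simp: rho_iff)
  show "(\<lambda>Q\<in>carrier_mat p m. 0) \<in> orbit_span p m F"
    by (rule orbit_span_I[of "[]"]) (auto simp: orbit_fun_def)
next
  fix f g assume "f \<in> orbit_span p m F" "g \<in> orbit_span p m F"
  then obtain gs hs where f: "f = (\<lambda>Q\<in>carrier_mat p m. orbit_fun p m F gs (arr Q))" "\<forall>y\<in>set gs. snd y \<in> orth_group p"
    and g: "g = (\<lambda>Q\<in>carrier_mat p m. orbit_fun p m F hs (arr Q))" "\<forall>y\<in>set hs. snd y \<in> orth_group p"
    unfolding orbit_span_def by blast
  show "(\<lambda>Q\<in>carrier_mat p m. f Q + g Q) \<in> orbit_span p m F"
    by (rule orbit_span_I[of "gs @ hs"]) (use f g in \<open>auto simp: orbit_fun_def\<close>)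
next
  fix c f assume "f \<in> orbit_span p m F"
  then obtain gs where f: "f = (\<lambda>Q\<in>carrier_mat p m. orbit_fun p m F gs (arr Q))" "\<forall>y\<in>set gs. snd y \<in> orth_group p"
    unfolding orbit_span_def by blast
  show "(\<lambda>Q\<in>carrier_mat p m. c * f Q) \<in> orbit_span p m F"
    by (rule orbit_span_I[of "map (\<lambda>y. (c * fst y, snd y)) gs"])
      (use f in \<open>auto simp: orbit_fun_def o_def mult.assoc sum_list_const_mult\<close>)
next
  fix h f assume h: "h \<in> orth_group p" and "f \<in> orbit_span p m F"
  then obtain gs where f: "f = (\<lambda>Q\<in>carrier_mat p m. orbit_fun p m F gs (arr Q))" "\<forall>y\<in>set gs. snd y \<in> orth_group p"
    unfolding orbit_span_def by blast
  have hc: "h \<in> carrier_mat p p" by (rule orth_carrier[OF h])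
  have "act p m h (1\<^sub>m m) f Q = orbit_fun p m F (map (\<lambda>y. (fst y, h * snd y)) gs) (arr Q)" if Q: "Q \<in> carrier_mat p m" for Q
  proof -
    have "act p m h (1\<^sub>m m) f Q = lift p m f (rmul p h (arr Q))"
      using lift_act[OF hc, of m f "arr Q"] by (simp add: lift_arr Q)
    also have "\<dots> = orbit_fun p m F gs (rmul p h (arr Q))" by (simp add: f(1) lift_orbit_fun)
    also have "\<dots> = orbit_fun p m F (map (\<lambda>y. (fst y, h * snd y)) gs) (arr Q)"
    proof -
      have "mprod (lead_rows m F) (rmul p (snd y) (rmul p h (arr Q))) = mprod (lead_rows m F) (rmul p (h * snd y) (arr Q))"
        if "y \<in> set gs" for y
        by (rule polyfn_cong[OF polyfn_lead[OF mp]], rule rmul_rmul) (use f(2) that hc orth_carrier in auto)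
      then show ?thesis unfolding orbit_fun_def
        by (simp add: o_def) (intro arg_cong[of _ _ sum_list] map_cong, auto)
    qed
    finally show ?thesis .
  qed
  then have "restrict (act p m h (1\<^sub>m m) f) (carrier_mat p m) \<in> orbit_span p m F"
    by (intro orbit_span_I[of "map (\<lambda>y. (fst y, h * snd y)) gs"]) (use f(2) orth_mult[OF h] in auto)
  moreover have "restrict (act p m h (1\<^sub>m m) f) (carrier_mat p m) = act p m h (1\<^sub>m m) f"
    by (simp add: act_def)
  ultimately show "act p m h (1\<^sub>m m) f \<in> orbit_span p m F" by (simp only:)
qed

lemma hw_vector_orbit_span: "hw_vector p m F \<in> orbit_span p m F"
  unfolding hw_vector_def
proof (rule orbit_span_I[of "[(1, 1\<^sub>m p)]"])
  fix Q :: "complex mat"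
  have "mprod (lead_rows m F) (rmul p (1\<^sub>m p) (arr Q)) = mprod (lead_rows m F) (arr Q)"
    by (rule polyfn_cong[OF polyfn_lead[OF mp]], rule rmul_one)
  then show "mprod (lead_rows m F) (arr Q) = orbit_fun p m F [(1, 1\<^sub>m p)] (arr Q)"
    by (simp add: orbit_fun_def)
qed (simp add: orth_one)

lemma orbit_span_minimal:
  assumes I: "O_submodule p m I" "hw_vector p m F \<in> I"
  shows "orbit_span p m F \<subseteq> I"
proof
  fix f assume "f \<in> orbit_span p m F"
  then obtain gs where f: "f = (\<lambda>Q\<in>carrier_mat p m. orbit_fun p m F gs (arr Q))" "\<forall>y\<in>set gs. snd y \<in> orth_group p"
    unfolding orbit_span_def by blast
  have sub: "(\<lambda>Q\<in>carrier_mat p m. 0) \<in> I"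
    "\<And>f g. f \<in> I \<Longrightarrow> g \<in> I \<Longrightarrow> (\<lambda>Q\<in>carrier_mat p m. f Q + g Q) \<in> I"
    "\<And>c f. f \<in> I \<Longrightarrow> (\<lambda>Q\<in>carrier_mat p m. c * f Q) \<in> I"
    "\<And>g f. g \<in> orth_group p \<Longrightarrow> f \<in> I \<Longrightarrow> act p m g (1\<^sub>m m) f \<in> I"
    using I(1) unfolding O_submodule_iff by blast+
  from f(2) have "(\<lambda>Q\<in>carrier_mat p m. orbit_fun p m F gs (arr Q)) \<in> I"
  proof (induction gs)
    case Nil
    then show ?case using sub(1) by (simp only: orbit_fun_def list.map sum_list.Nil)
  next
    case (Cons y gs)
    have y: "snd y \<in> orth_group p" using Cons.prems by simp
    have "act p m (snd y) (1\<^sub>m m) (hw_vector p m F) Q = mprod (lead_rows m F) (rmul p (snd y) (arr Q))"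
      if Q: "Q \<in> carrier_mat p m" for Q
      using lift_act[OF orth_carrier[OF y], of m "hw_vector p m F" "arr Q"]
      by (simp add: lift_arr Q lift_hw_vector[OF mp])
    then have "(\<lambda>Q\<in>carrier_mat p m. (\<lambda>Q\<in>carrier_mat p m. fst y * act p m (snd y) (1\<^sub>m m) (hw_vector p m F) Q) Q +
        (\<lambda>Q\<in>carrier_mat p m. orbit_fun p m F gs (arr Q)) Q) =
      (\<lambda>Q\<in>carrier_mat p m. orbit_fun p m F (y # gs) (arr Q))"
      by (intro restrict_ext) (simp add: orbit_fun_def)
    moreover have "(\<lambda>Q\<in>carrier_mat p m. orbit_fun p m F gs (arr Q)) \<in> I"
      by (rule Cons.IH) (use Cons.prems in simp)
    ultimately show ?case
      using sub(2)[OF sub(3)[OF sub(4)[OF y I(2)], of "fst y"], of "\<lambda>Q\<in>carrier_mat p m. orbit_fun p m F gs (arr Q)"]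
      by (simp only:)
  qed
  then show "f \<in> I" by (simp only: f(1))
qed

text \<open>Evaluation at a point of the orbit is evaluation of a translate at \<open>E_arr\<close>,
  and translates stay in a submodule.\<close>

lemma lift_act_transpose:
  assumes "g \<in> orth_group p"
  shows "lift p m (act p m (transpose_mat g) (1\<^sub>m m) f) E_arr = lift p m f (arr g)"
  unfolding lift_act[OF orth_carrier[OF orth_transpose[OF assms]]]
  by (rule lift_cong, rule rmul_E) (use mp orth_carrier[OF assms] in auto)

text \<open>If a function in \<open>I\<close> is nonzero at some \<open>g\<close>, then a translate
  is nonzero at \<open>E_arr\<close>, and the torus extracts the highest weight vector. This
  dichotomy yields irreducibility and the uniqueness of the complement.\<close>

lemma submodule_vanishing_or_hw:
  assumes I: "O_submodule p m I" "I \<subseteq> rho p m F" and "hw_vector p m F \<notin> I"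
  shows "I \<subseteq> orbit_vanishing p m F"
proof
  fix f assume f: "f \<in> I"
  have "lift p m f (arr g) = 0" if g: "g \<in> orth_group p" for g
  proof (rule ccontr)
    assume "lift p m f (arr g) \<noteq> 0"
    then have "lift p m (act p m (transpose_mat g) (1\<^sub>m m) f) E_arr \<noteq> 0"
      by (simp only: lift_act_transpose[OF g] not_False_eq_True)
    moreover have "act p m (transpose_mat g) (1\<^sub>m m) f \<in> I"
      using I(1) f orth_transpose[OF g] unfolding O_submodule_iff by blast
    ultimately have "hw_vector p m F \<in> I" by (intro hw_vector_in_submodule[OF I F mp])
    then show False using assms(3) by simp
  qed
  then show "f \<in> orbit_vanishing p m F" using f I(2) by (auto simp: orbit_vanishing_def)
qed

lemma lift_combination:
  "lift p m (\<lambda>Q\<in>carrier_mat p m. a * f Q + b * g Q) x = a * lift p m f x + b * lift p m g x"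
  by (simp add: lift_def)

lemma rho_combination:
  assumes "f \<in> rho p m F" "g \<in> rho p m F" shows "(\<lambda>Q\<in>carrier_mat p m. a * f Q + b * g Q) \<in> rho p m F"
proof -
  have fg: "f \<in> carrier (U_inv_alg p m)" "g \<in> carrier (U_inv_alg p m)" using assms by (auto simp: rho_iff)
  then have pf: "polyfn p m (lift p m f)" "polyfn p m (lift p m g)" using polyfn_lift U_inv_poly by auto
  have "(\<lambda>Q\<in>carrier_mat p m. (\<lambda>x. a * lift p m f x + b * lift p m g x) (arr Q)) \<in> carrier (U_inv_alg p m)"
    using U_inv_lift[OF fg(1)] U_inv_lift[OF fg(2)]
    by (intro restrict_in_U_inv polyfn_add polyfn_mult[OF polyfn_const] pf) auto
  moreover have "(\<lambda>Q\<in>carrier_mat p m. (\<lambda>x. a * lift p m f x + b * lift p m g x) (arr Q)) = (\<lambda>Q\<in>carrier_mat p m. a * f Q + b * g Q)"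
    by (rule restrict_ext) (simp add: lift_arr)
  ultimately show ?thesis
    using assms by (auto simp: rho_iff col_weight_def lift_combination algebra_simps)
qed

lemma orbit_vanishing_submodule: "O_submodule p m (orbit_vanishing p m F)"
proof -
  let ?A = "carrier_mat p m"
  have comb: "(\<lambda>Q\<in>?A. a * f Q + b * g Q) \<in> orbit_vanishing p m F"
    if "f \<in> orbit_vanishing p m F" "g \<in> orbit_vanishing p m F" for f g a b
    using that by (auto simp: orbit_vanishing_def lift_combination intro!: rho_combination)
  have act: "act p m h (1\<^sub>m m) f \<in> orbit_vanishing p m F"
    if h: "h \<in> orth_group p" and f: "f \<in> orbit_vanishing p m F" for h f
  proof -
    have hc: "h \<in> carrier_mat p p" by (rule orth_carrier[OF h])
    have fr: "f \<in> carrier (U_inv_alg p m)" "col_weight m F (lift p m f)"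
      using f by (auto simp: orbit_vanishing_def rho_iff)
    have pf: "polyfn p m (lift p m f)" using polyfn_lift U_inv_poly fr by blast
    have la: "lift p m (act p m h (1\<^sub>m m) f) x = lift p m f (rmul p h x)" for x by (rule lift_act[OF hc])
    have eq: "act p m h (1\<^sub>m m) f = (\<lambda>Q\<in>?A. (\<lambda>x. lift p m f (rmul p h x)) (arr Q))"
      by (rule ext_eqI) (auto simp: act_def la[symmetric] lift_arr)
    have "polyfn p m (\<lambda>x. lift p m f (rmul p h x))"
      unfolding rmul_def
      by (rule polyfn_compose[OF pf], intro polyfn_sum polyfn_mult[OF polyfn_const] polyfn_coord) auto
    then have "act p m h (1\<^sub>m m) f \<in> carrier (U_inv_alg p m)"
      unfolding eq by (rule restrict_in_U_inv) (simp add: rmul_cmul U_inv_lift[OF fr(1)])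
    moreover have "col_weight m F (lift p m (act p m h (1\<^sub>m m) f))"
    proof -
      have "rmul p h (\<lambda>i j. x i j * t j) = (\<lambda>i j. rmul p h x i j * t j)" for x t
        by (auto simp: rmul_def sum_distrib_right fun_eq_iff mult.assoc)
      then show ?thesis using fr(2) by (simp add: col_weight_def la)
    qed
    moreover have "lift p m (act p m h (1\<^sub>m m) f) (arr g) = 0" if g: "g \<in> orth_group p" for g
    proof -
      have "lift p m f (rmul p h (arr g)) = lift p m f (arr (transpose_mat h * g))"
        by (rule lift_cong, rule rmul_arr) (use mp hc orth_carrier[OF g] in auto)
      then show ?thesis using f orth_mult[OF orth_transpose[OF h] g] by (simp add: la orbit_vanishing_def)
    qed
    ultimately show ?thesis by (simp add: orbit_vanishing_def rho_iff)
  qed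
  have zero: "(\<lambda>Q\<in>?A. 0) \<in> orbit_vanishing p m F"
  proof -
    have "(\<lambda>Q\<in>?A. 0 * hw_vector p m F Q + 0 * hw_vector p m F Q) \<in> rho p m F"
      using hw_vector_rho[OF mp F] by (intro rho_combination)
    then show ?thesis by (simp add: orbit_vanishing_def lift_def orth_group_def)
  qed
  have "(\<lambda>Q\<in>?A. f Q + g Q) \<in> orbit_vanishing p m F"
    if "f \<in> orbit_vanishing p m F" "g \<in> orbit_vanishing p m F" for f g
    using comb[OF that, of 1 1] by simp
  moreover have "(\<lambda>Q\<in>?A. c * f Q) \<in> orbit_vanishing p m F" if "f \<in> orbit_vanishing p m F" for c f
    using comb[OF that that, of c 0] by simp
  ultimately show ?thesis
    unfolding O_submodule_iff using zero act by (auto simp: orbit_vanishing_def rho_iff)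
qed

section \<open>Orthogonal complements in the space of minors\<close>

lemma minor_cnj: "minor R (\<lambda>i j. cnj (x i j)) = cnj (minor R x)"
  by (simp add: minor_expand)

lemma mprod_cnj: "mprod Rs (\<lambda>i j. cnj (x i j)) = cnj (mprod Rs x)"
  by (induction Rs) (simp_all add: minor_cnj)

text \<open>By the Cauchy-Binet formula \<open>\<phi>(g\<^sup>t x)\<close>, for the highest weight vector \<open>\<phi>\<close>, is a positive
  combination of the products \<open>\<phi>\<^sub>T(g) \<phi>\<^sub>T(x)\<close> of minors. As the orthogonal group is stable under complex
  conjugation, the span of the orbit of \<open>\<phi>\<close> and the functions vanishing on the orbit are orthogonal
  complements.\<close>

lemma orbit_kernel:
  "\<exists>C. C \<noteq> 0 \<and> (\<forall>gs x. C * orbit_fun p m F gs x =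
    (\<Sum>T\<in>tableaux p (shape m F). (\<Sum>y\<leftarrow>gs. fst y * mprod T (arr (snd y))) * mprod T x))"
proof -
  obtain C where C0: "C \<noteq> 0" "\<forall>x y. C * mprod (lead_rows m F) (gram p y x) =
    (\<Sum>T\<in>tableaux p (shape m F). mprod T y * mprod T x)"
    using kernel_expansion[of "shape m F" p] unfolding mprod_shape by (elim exE conjE)
  note C = C0(1) C0(2)[rule_format]
  have "rmul p g x = gram p (arr g) x" for g x by (simp add: rmul_def gram_def arr_def)
  then have "C * orbit_fun p m F gs x =
    (\<Sum>T\<in>tableaux p (shape m F). (\<Sum>y\<leftarrow>gs. fst y * mprod T (arr (snd y))) * mprod T x)" for gs x
  proof (induction gs)
    case (Cons y gs)
    have "C * orbit_fun p m F (y # gs) x = fst y * (C * mprod (lead_rows m F) (gram p (arr (snd y)) x)) + C * orbit_fun p m F gs x"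
      using Cons.prems by (simp add: orbit_fun_def algebra_simps)
    also have "\<dots> = (\<Sum>T\<in>tableaux p (shape m F). fst y * (mprod T (arr (snd y)) * mprod T x) +
        (\<Sum>y\<leftarrow>gs. fst y * mprod T (arr (snd y))) * mprod T x)"
      unfolding C(2) Cons.IH[OF Cons.prems] by (simp add: sum_distrib_left sum.distrib)
    finally show ?case by (simp add: algebra_simps)
  qed (simp add: orbit_fun_def)
  then show ?thesis by (intro exI[of _ C] conjI C(1) allI)
qed

text \<open>By the kernel expansion the coefficient vector \<open>w\<close> is a combination of the
  vectors of minors of the matrices in \<open>gs\<close>. That \<open>f\<close> vanishes at the
  conjugate of \<open>g\<close> says that \<open>w\<close> is orthogonal to the vector of
  \<open>g\<close>; hence \<open>w\<close> is orthogonal to itself.\<close>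

lemma orbit_span_vanishing_zero:
  assumes "f \<in> orbit_span p m F" "f \<in> orbit_vanishing p m F"
  shows "f = (\<lambda>Q\<in>carrier_mat p m. 0)"
proof -
  let ?T = "tableaux p (shape m F)"
  obtain gs where f: "f = (\<lambda>Q\<in>carrier_mat p m. orbit_fun p m F gs (arr Q))" "\<forall>y\<in>set gs. snd y \<in> orth_group p"
    using assms(1) unfolding orbit_span_def by blast
  obtain C where C0: "C \<noteq> 0" "\<forall>gs x. C * orbit_fun p m F gs x =
    (\<Sum>T\<in>?T. (\<Sum>y\<leftarrow>gs. fst y * mprod T (arr (snd y))) * mprod T x)"
    using orbit_kernel by (elim exE conjE)
  note C = C0(1) C0(2)[rule_format]
  define w where "w = (\<lambda>T. \<Sum>y\<leftarrow>gs. fst y * mprod T (arr (snd y)))"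
  have van: "(\<Sum>T\<in>?T. w T * cnj (mprod T (arr g))) = 0" if g: "g \<in> orth_group p" for g
  proof -
    have gc: "g \<in> carrier_mat p p" by (rule orth_carrier[OF g])
    have "(\<Sum>T\<in>?T. w T * cnj (mprod T (arr g))) = (\<Sum>T\<in>?T. w T * mprod T (\<lambda>i j. cnj (arr g i j)))"
      by (simp add: mprod_cnj)
    also have "\<dots> = C * orbit_fun p m F gs (\<lambda>i j. cnj (arr g i j))" by (simp add: C(2) w_def)
    also have "orbit_fun p m F gs (\<lambda>i j. cnj (arr g i j)) = lift p m f (arr (map_mat cnj g))"
      unfolding f(1) lift_orbit_fun
      by (rule polyfn_cong[OF polyfn_orbit_fun]) (use gc mp in \<open>auto simp: arr_def\<close>)
    also have "\<dots> = 0" using assms(2) orth_cnj[OF g] by (simp add: orbit_vanishing_def)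
    finally show ?thesis by simp
  qed
  have "(\<Sum>T\<in>?T. w T * cnj (w T)) = (\<Sum>y\<leftarrow>gs. cnj (fst y) * (\<Sum>T\<in>?T. w T * cnj (mprod T (arr (snd y)))))"
  proof -
    have "(\<Sum>T\<in>?T. w T * cnj (\<Sum>y\<leftarrow>hs. fst y * mprod T (arr (snd y)))) =
        (\<Sum>y\<leftarrow>hs. cnj (fst y) * (\<Sum>T\<in>?T. w T * cnj (mprod T (arr (snd y)))))" for hs
      by (induction hs) (simp_all add: distrib_left sum.distrib sum_distrib_left mult_ac)
    then show ?thesis by (simp add: w_def)
  qed
  also have "\<dots> = (\<Sum>y\<leftarrow>gs. 0)"
    using van f(2) by (intro arg_cong[of _ _ sum_list] map_cong) auto
  finally have "(\<Sum>T\<in>?T. w T * cnj (w T)) = 0" by simp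
  moreover have "(\<Sum>T\<in>?T. w T * cnj (w T)) = of_real (\<Sum>T\<in>?T. (cmod (w T))\<^sup>2)"
    by (simp only: complex_norm_square[symmetric] of_real_sum)
  ultimately have "(\<Sum>T\<in>?T. (cmod (w T))\<^sup>2) = 0" by (metis of_real_eq_0_iff)
  then have w: "w T = 0" if "T \<in> ?T" for T
    using that by (simp add: sum_nonneg_eq_0_iff finite_tableaux)
  have "orbit_fun p m F gs x = 0" for x
    using C(1) C(2)[of gs x] w by (simp add: w_def)
  then show ?thesis by (simp add: f(1))
qed

text \<open>Products of minors span \<open>rho p m F\<close>. The coefficient vector of
  \<open>f\<close> is projected to the span \<open>W\<close> of the vectors of orthogonal matrices:
  the projection belongs to a function in the orbit span, and the rest, tested against the conjugate
  of \<open>g\<close>, gives a function vanishing at \<open>g\<close>.\<close>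

lemma rho_decomposition:
  assumes f: "f \<in> rho p m F"
  obtains s v where "s \<in> orbit_span p m F" "v \<in> orbit_vanishing p m F" "f = (\<lambda>Q\<in>carrier_mat p m. s Q + v Q)"
proof -
  let ?T = "tableaux p (shape m F)" and ?A = "carrier_mat p m"
  have fp: "f \<in> carrier (U_inv_alg p m)" "col_weight m F (lift p m f)" using f by (auto simp: rho_iff)
  have "minor_span 0 p m F (lift p m f)"
    by (rule minor_span_invariant)
      (use polyfn_lift[OF U_inv_poly[OF fp(1)]] U_inv_col_inv[OF fp(1)] fp(2) in \<open>auto simp: row_inv_def\<close>)
  from minor_span_tableaux[OF this] obtain a where a: "\<And>x. lift p m f x = (\<Sum>T\<in>?T. a T * mprod T x)"
    using young_dest[OF F] by auto
  obtain C where C0: "C \<noteq> 0" "\<forall>gs x. C * orbit_fun p m F gs x =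
    (\<Sum>T\<in>?T. (\<Sum>y\<leftarrow>gs. fst y * mprod T (arr (snd y))) * mprod T x)"
    using orbit_kernel by (elim exE conjE)
  note C = C0(1) C0(2)[rule_format]
  define w where "w = (\<lambda>gs :: (complex \<times> complex mat) list. \<lambda>T. \<Sum>y\<leftarrow>gs. fst y * mprod T (arr (snd y)))"
  define W where "W = {w gs | gs. \<forall>y\<in>set gs. snd y \<in> orth_group p}"
  have W0: "(\<lambda>_. 0) \<in> W" unfolding W_def w_def by (intro CollectI exI[of _ "[]"]) auto
  have Wc: "(\<lambda>T. f T + c * g T) \<in> W" if fg: "f \<in> W" "g \<in> W" for f g c
  proof -
    obtain gs hs where "f = w gs" "g = w hs" "\<forall>y\<in>set gs. snd y \<in> orth_group p" "\<forall>y\<in>set hs. snd y \<in> orth_group p"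
      using fg unfolding W_def by blast
    then show ?thesis unfolding W_def
      by (intro CollectI exI[of _ "gs @ map (\<lambda>y. (c * fst y, snd y)) hs"])
        (auto simp: w_def o_def mult.assoc sum_list_const_mult)
  qed
  have "\<exists>u\<in>W. \<forall>x\<in>W. (\<Sum>T\<in>?T. (a T - u T) * cnj (x T)) = 0"
    by (rule orthogonal_projection_exists[OF finite_tableaux W0]) (rule Wc)
  then obtain u where u: "u \<in> W" "\<forall>x\<in>W. (\<Sum>T\<in>?T. (a T - u T) * cnj (x T)) = 0"
    by (elim bexE)
  then obtain gs where gs: "u = w gs" "\<forall>y\<in>set gs. snd y \<in> orth_group p" unfolding W_def by blast
  \<comment> \<open>The kernel expansion carries the factor \<open>C\<close>, so \<open>C\<close>
    times the orbit function has the coefficient vector \<open>u\<close>.\<close>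
  define s where "s = (\<lambda>Q\<in>?A. C * (\<lambda>Q\<in>?A. orbit_fun p m F gs (arr Q)) Q)"
  have "(\<lambda>Q\<in>?A. orbit_fun p m F gs (arr Q)) \<in> orbit_span p m F"
    by (rule orbit_span_I[of gs]) (use gs(2) in auto)
  then have s: "s \<in> orbit_span p m F"
    using orbit_span_submodule unfolding O_submodule_iff s_def by blast
  define v where "v = (\<lambda>Q\<in>?A. 1 * f Q + (- 1) * s Q)"
  have ls: "lift p m s x = (\<Sum>T\<in>?T. u T * mprod T x)" for x
  proof -
    have "lift p m s x = C * lift p m (\<lambda>Q\<in>?A. orbit_fun p m F gs (arr Q)) x" by (simp add: s_def lift_def)
    then show ?thesis by (simp add: lift_orbit_fun C(2) gs(1) w_def)
  qed
  have "lift p m v (arr g) = 0" if g: "g \<in> orth_group p" for g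
  proof -
    have gc: "g \<in> carrier_mat p p" by (rule orth_carrier[OF g])
    have "w [(1, map_mat cnj g)] \<in> W" unfolding W_def using orth_cnj[OF g] by auto
    then have "(\<Sum>T\<in>?T. (a T - u T) * cnj (mprod T (arr (map_mat cnj g)))) = 0" using u(2) by (auto simp: w_def)
    moreover have "cnj (mprod T (arr (map_mat cnj g))) = mprod T (arr g)" if T: "T \<in> ?T" for T
    proof -
      have "mprod T (arr (map_mat cnj g)) = mprod T (\<lambda>i j. cnj (arr g i j))"
      proof (rule mprod_cong)
        fix R i j assume R: "R \<in> set T" "i \<in> set R" "j < length R"
        have mT: "map length T = shape m F" using T by (simp add: tableaux_def)
        have "length R \<in> set (shape m F)" unfolding mT[symmetric] using R(1) by simp
        then have "length R \<le> m" using lead_rows_bound[of m m] by (auto simp: shape_def)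
        then have "i < p" "j < p" using R T mp by (auto simp: tableaux_def subset_iff)
        then show "arr (map_mat cnj g) i j = cnj (arr g i j)" using gc by (simp add: arr_def)
      qed
      then show ?thesis by (simp add: mprod_cnj)
    qed
    ultimately have "(\<Sum>T\<in>?T. (a T - u T) * mprod T (arr g)) = 0" by simp
    then show ?thesis
      unfolding v_def lift_combination a ls by (simp add: left_diff_distrib sum_subtractf)
  qed
  moreover have "v \<in> rho p m F"
    unfolding v_def using orbit_span_rho s f by (intro rho_combination) auto
  ultimately have "v \<in> orbit_vanishing p m F" by (simp add: orbit_vanishing_def)
  moreover have "f = (\<lambda>Q\<in>?A. s Q + v Q)"
    by (rule ext_eqI[OF poly_funs_extensional[OF U_inv_poly[OF fp(1)]]]) (simp_all add: v_def)
  ultimately show thesis using s that by blast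
qed

section \<open>Identification of the two modules\<close>

text \<open>A submodule that contains the highest weight vector contains its orbit; any other one
  vanishes on the orbit, and the orbit span contains no such function except zero.\<close>

lemma O_irreducible_orbit_span: "O_irreducible p m (orbit_span p m F)"
proof -
  have "T = {\<lambda>Q\<in>carrier_mat p m. 0} \<or> T = orbit_span p m F"
    if T: "T \<subseteq> orbit_span p m F" "O_submodule p m T" for T
  proof (cases "hw_vector p m F \<in> T")
    case True
    then show ?thesis using orbit_span_minimal[OF T(2)] T(1) by blast
  next
    case False
    then have "T \<subseteq> orbit_vanishing p m F"
      using submodule_vanishing_or_hw[OF T(2)] T(1) orbit_span_rho by blast
    then have "T \<subseteq> {\<lambda>Q\<in>carrier_mat p m. 0}" using orbit_span_vanishing_zero T(1) by blast
    moreover have "(\<lambda>Q\<in>carrier_mat p m. 0) \<in> T" using T(2) by (simp add: O_submodule_iff)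
    ultimately show ?thesis by blast
  qed
  moreover have "orbit_span p m F \<noteq> {\<lambda>Q\<in>carrier_mat p m. 0}"
    using hw_vector_orbit_span hw_vector_highest_weight[OF F mp]
    by (auto simp: GL_highest_weight_def simp del: U_inv_alg_simps simp flip: U_inv_alg_simps(4))
  ultimately show ?thesis using orbit_span_submodule by (auto simp: O_irreducible_def)
qed

text \<open>A candidate contains some highest weight vector, so the torus produces the standard one
  in it, and with it the orbit span; irreducibility then forces equality.\<close>

lemma sigma_eq: "sigma p m F = orbit_span p m F"
  unfolding sigma_def
proof (rule the_equality)
  show "O_irreducible p m (orbit_span p m F) \<and> orbit_span p m F \<subseteq> rho p m F \<and>
      (\<exists>v\<in>orbit_span p m F. GL_highest_weight p m F v)"
    using O_irreducible_orbit_span orbit_span_rho hw_vector_orbit_span hw_vector_highest_weight[OF F mp] by blast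
next
  fix S assume S: "O_irreducible p m S \<and> S \<subseteq> rho p m F \<and> (\<exists>v\<in>S. GL_highest_weight p m F v)"
  then obtain v where v: "v \<in> S" "GL_highest_weight p m F v" by blast
  have sub: "O_submodule p m S" "S \<subseteq> rho p m F" using S by (auto simp: O_irreducible_def)
  have "hw_vector p m F \<in> S"
    using hw_vector_in_submodule[OF sub F mp v(1)] highest_weight_unique[OF v(2) _ F mp] sub(2) v(1) by blast
  then have "orbit_span p m F \<subseteq> S" by (rule orbit_span_minimal[OF sub(1)])
  moreover have "orbit_span p m F \<noteq> {\<zero>\<^bsub>U_inv_alg p m\<^esub>}" using O_irreducible_orbit_span by (simp add: O_irreducible_def)
  ultimately show "S = orbit_span p m F" using S orbit_span_submodule by (auto simp: O_irreducible_def)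
qed

lemma zero_in_orbit_span: "(\<lambda>Q\<in>carrier_mat p m. 0) \<in> orbit_span p m F"
  by (rule orbit_span_submodule[unfolded O_submodule_iff, THEN conjunct2, THEN conjunct1])

lemma zero_in_orbit_vanishing: "(\<lambda>Q\<in>carrier_mat p m. 0) \<in> orbit_vanishing p m F"
  by (rule orbit_vanishing_submodule[unfolded O_submodule_iff, THEN conjunct2, THEN conjunct1])

text \<open>A complement cannot contain the highest weight vector, so its functions vanish on the
  orbit. Two complements of the same submodule, one inside the other, coincide.\<close>

lemma I_comp_eq: "I_comp p m F = orbit_vanishing p m F"
  unfolding I_comp_def sigma_eq
proof (rule the_equality)
  have "orbit_span p m F <+>\<^bsub>U_inv_alg p m\<^esub> orbit_vanishing p m F = rho p m F"
  proof
    show "orbit_span p m F <+>\<^bsub>U_inv_alg p m\<^esub> orbit_vanishing p m F \<subseteq> rho p m F"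
    proof
      fix f assume "f \<in> orbit_span p m F <+>\<^bsub>U_inv_alg p m\<^esub> orbit_vanishing p m F"
      then obtain s v where "s \<in> orbit_span p m F" "v \<in> orbit_vanishing p m F" "f = (\<lambda>Q\<in>carrier_mat p m. s Q + v Q)"
        by (auto simp: set_add_def')
      then show "f \<in> rho p m F"
        using rho_combination[of s v 1 1] orbit_span_rho by (auto simp: orbit_vanishing_def)
    qed
    show "rho p m F \<subseteq> orbit_span p m F <+>\<^bsub>U_inv_alg p m\<^esub> orbit_vanishing p m F"
    proof
      fix f assume "f \<in> rho p m F"
      then obtain s v where sv: "s \<in> orbit_span p m F" "v \<in> orbit_vanishing p m F"
        "f = (\<lambda>Q\<in>carrier_mat p m. s Q + v Q)" by (rule rho_decomposition)
      show "f \<in> orbit_span p m F <+>\<^bsub>U_inv_alg p m\<^esub> orbit_vanishing p m F"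
        unfolding set_add_def'
        by (rule UN_I[OF sv(1)], rule UN_I[OF sv(2)]) (simp only: sv(3) U_inv_alg_simps singleton_iff)
    qed
  qed
  then show "O_submodule p m (orbit_vanishing p m F) \<and>
      orbit_span p m F \<inter> orbit_vanishing p m F = {\<zero>\<^bsub>U_inv_alg p m\<^esub>} \<and>
      orbit_span p m F <+>\<^bsub>U_inv_alg p m\<^esub> orbit_vanishing p m F = rho p m F"
  proof (intro conjI orbit_vanishing_submodule)
    show "orbit_span p m F \<inter> orbit_vanishing p m F = {\<zero>\<^bsub>U_inv_alg p m\<^esub>}"
      using orbit_span_vanishing_zero zero_in_orbit_span zero_in_orbit_vanishing
      unfolding U_inv_alg_simps by blast
  qed
next
  fix I assume I: "O_submodule p m I \<and> orbit_span p m F \<inter> I = {\<zero>\<^bsub>U_inv_alg p m\<^esub>} \<and>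
      orbit_span p m F <+>\<^bsub>U_inv_alg p m\<^esub> I = rho p m F"
  have IU: "I \<subseteq> carrier (U_inv_alg p m)" using I by (simp add: O_submodule_iff)
  have "I \<subseteq> rho p m F"
  proof
    fix f assume f: "f \<in> I"
    have "(\<lambda>Q\<in>carrier_mat p m. (\<lambda>Q\<in>carrier_mat p m. 0) Q + f Q) \<in> orbit_span p m F <+>\<^bsub>U_inv_alg p m\<^esub> I"
      unfolding set_add_def' by (rule UN_I[OF zero_in_orbit_span], rule UN_I[OF f]) (simp only: U_inv_alg_simps singleton_iff)
    moreover have "(\<lambda>Q\<in>carrier_mat p m. (\<lambda>Q\<in>carrier_mat p m. 0) Q + f Q) = f"
      using IU f by (intro ext_eqI[OF _ poly_funs_extensional[OF U_inv_poly]]) auto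
    ultimately show "f \<in> rho p m F" using I by simp
  qed
  moreover have "hw_vector p m F \<notin> I"
  proof
    assume "hw_vector p m F \<in> I"
    then have "hw_vector p m F \<in> orbit_span p m F \<inter> I" using hw_vector_orbit_span by (rule IntI[rotated])
    also have "\<dots> = {\<zero>\<^bsub>U_inv_alg p m\<^esub>}" using I by (elim conjE)
    finally have "hw_vector p m F = \<zero>\<^bsub>U_inv_alg p m\<^esub>" by (rule singletonD)
    then show False using hw_vector_highest_weight[OF F mp] unfolding GL_highest_weight_def by (elim conjE notE)
  qed
  ultimately have sub: "I \<subseteq> orbit_vanishing p m F" using submodule_vanishing_or_hw I by blast
  moreover have "orbit_vanishing p m F \<subseteq> I"
  proof
    fix f assume f: "f \<in> orbit_vanishing p m F"
    then have "f \<in> orbit_span p m F <+>\<^bsub>U_inv_alg p m\<^esub> I" using I by (simp add: orbit_vanishing_def)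
    then obtain s v where sv: "s \<in> orbit_span p m F" "v \<in> I" "f = (\<lambda>Q\<in>carrier_mat p m. s Q + v Q)"
      by (auto simp: set_add_def')
    have ext: "s \<in> extensional (carrier_mat p m)" "v \<in> extensional (carrier_mat p m)"
      using sv(1,2) orbit_span_rho IU poly_funs_extensional U_inv_poly by (auto simp: rho_iff)
    have vv: "v \<in> orbit_vanishing p m F" using sub sv(2) by blast
    have closed: "\<forall>f\<in>orbit_vanishing p m F. \<forall>g\<in>orbit_vanishing p m F. (\<lambda>Q\<in>carrier_mat p m. f Q + g Q) \<in> orbit_vanishing p m F"
      "\<forall>c. \<forall>f\<in>orbit_vanishing p m F. (\<lambda>Q\<in>carrier_mat p m. c * f Q) \<in> orbit_vanishing p m F"
      by (rule orbit_vanishing_submodule[unfolded O_submodule_iff, THEN conjunct2, THEN conjunct2, THEN conjunct1],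
          rule orbit_vanishing_submodule[unfolded O_submodule_iff, THEN conjunct2, THEN conjunct2, THEN conjunct2, THEN conjunct1])
    have "(\<lambda>Q\<in>carrier_mat p m. f Q + (\<lambda>Q\<in>carrier_mat p m. - 1 * v Q) Q) \<in> orbit_vanishing p m F"
      by (rule closed(1)[rule_format, OF f closed(2)[rule_format, OF vv]])
    moreover have "(\<lambda>Q\<in>carrier_mat p m. f Q + (\<lambda>Q\<in>carrier_mat p m. - 1 * v Q) Q) = s"
      by (rule ext_eqI[OF _ ext(1)]) (auto simp: sv(3))
    ultimately have "s = (\<lambda>Q\<in>carrier_mat p m. 0)" using orbit_span_vanishing_zero sv(1) by simp
    then have "f = v" by (intro ext_eqI[OF _ ext(2)]) (auto simp: sv(3))
    then show "f \<in> I" using sv(2) by simp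
  qed
  ultimately show "I = orbit_vanishing p m F" by blast
qed

end

section \<open>The ideal and the quotient\<close>

context
  fixes p m :: nat
  assumes mp: "m \<le> p"
begin

lemma I_O_generate: "I_O p m = generate (add_monoid (U_inv_alg p m)) (\<Union>F\<in>young m. orbit_vanishing p m F)"
  unfolding I_O_def using I_comp_eq[OF _ mp] by (intro arg_cong2[of _ _ _ _ generate]) auto

lemma vanishing_U_inv: "(\<Union>F\<in>young m. orbit_vanishing p m F) \<subseteq> carrier (U_inv_alg p m)"
  by (auto simp: orbit_vanishing_def rho_iff)

lemma subgroup_I_O: "subgroup (I_O p m) (add_monoid (U_inv_alg p m))"
proof -
  interpret ring "U_inv_alg p m" by (rule ring_U_inv_alg)
  show ?thesis unfolding I_O_generate
    by (rule add.generate_is_subgroup) (use vanishing_U_inv in simp)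
qed

lemma zero_in_I_O: "\<zero>\<^bsub>U_inv_alg p m\<^esub> \<in> I_O p m"
  using subgroup.one_closed[OF subgroup_I_O] by simp

text \<open>A generator has a column weight, so scaling the columns by \<open>t\<close> only
  multiplies its value at \<open>g\<close>, which is zero. The freedom in \<open>t\<close> later
  provides arbitrary nonzero diagonal entries.\<close>

lemma I_O_vanishes:
  assumes f: "f \<in> I_O p m" and g: "g \<in> orth_group p" and t: "\<And>j. j < m \<Longrightarrow> t j \<noteq> 0"
  shows "lift p m f (\<lambda>i j. arr g i j * t j) = 0"
proof -
  interpret ring "U_inv_alg p m" by (rule ring_U_inv_alg)
  have gen: "lift p m h (\<lambda>i j. arr g i j * t j) = 0" if "h \<in> orbit_vanishing p m F" for h F
  proof -
    have cw: "col_weight m F (lift p m h)" using that by (simp add: orbit_vanishing_def rho_iff)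
    have "lift p m h (\<lambda>i j. arr g i j * t j) = (\<Prod>j<m. t j ^ F j) * lift p m h (arr g)"
      by (rule cw[unfolded col_weight_def, rule_format]) (rule t)
    then show ?thesis using that g by (simp add: orbit_vanishing_def)
  qed
  from f show ?thesis unfolding I_O_generate
  proof (induction rule: generate.induct)
    case one
    then show ?case by (simp add: lift_def)
  next
    case (incl h)
    then show ?case using gen by blast
  next
    case (inv h)
    then have h: "h \<in> carrier (U_inv_alg p m)" using vanishing_U_inv by blast
    have "h \<oplus>\<^bsub>U_inv_alg p m\<^esub> inv\<^bsub>add_monoid (U_inv_alg p m)\<^esub> h = \<zero>\<^bsub>U_inv_alg p m\<^esub>"
      using r_neg[OF h] by (simp only: a_inv_def)
    then have "lift p m h x + lift p m (inv\<^bsub>add_monoid (U_inv_alg p m)\<^esub> h) x = 0" for x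
      by (simp add: lift_def restrict_eq_iff)
    from this[of "\<lambda>i j. arr g i j * t j"] show ?case using gen inv by auto
  next
    case (eng h1 h2)
    then show ?case by (simp add: lift_def)
  qed
qed

lemma rho_mult:
  assumes "f \<in> rho p m F" "g \<in> rho p m G"
  shows "(\<lambda>Q\<in>carrier_mat p m. f Q * g Q) \<in> rho p m (\<lambda>j. F j + G j)"
proof -
  interpret ring "U_inv_alg p m" by (rule ring_U_inv_alg)
  have "f \<otimes>\<^bsub>U_inv_alg p m\<^esub> g \<in> carrier (U_inv_alg p m)" using assms by (intro m_closed) (auto simp: rho_iff)
  moreover have "lift p m (\<lambda>Q\<in>carrier_mat p m. f Q * g Q) x = lift p m f x * lift p m g x" for x
    by (simp add: lift_def)
  ultimately show ?thesis using assms
    by (auto simp: rho_iff col_weight_def power_add prod.distrib)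
qed

text \<open>Split \<open>f\<close> into weight vectors. A product of weight vectors has the sum of
  the two Young diagrams as its weight, and it vanishes on the orbit as soon as one factor
  does.\<close>

lemma vanishing_mult_in_I_O:
  assumes h: "h \<in> orbit_vanishing p m F" "F \<in> young m" and f: "f \<in> carrier (U_inv_alg p m)"
  shows "(\<lambda>Q\<in>carrier_mat p m. f Q * h Q) \<in> I_O p m"
proof -
  obtain L where L: "\<forall>y\<in>set L. fst y \<in> young m \<and> snd y \<in> rho p m (fst y) \<and>
      (\<forall>q. row_inv q (lift p m f) \<longrightarrow> row_inv q (lift p m (snd y)))"
    "\<forall>Q\<in>carrier_mat p m. f Q = (\<Sum>y\<leftarrow>L. snd y Q)"
    using weight_decomposition[OF f] by (elim exE conjE)
  have one: "(\<lambda>Q\<in>carrier_mat p m. snd y Q * h Q) \<in> I_O p m" if "y \<in> set L" for y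
  proof -
    have y: "fst y \<in> young m" "snd y \<in> rho p m (fst y)" using L(1) that by auto
    have "(\<lambda>Q\<in>carrier_mat p m. snd y Q * h Q) \<in> rho p m (\<lambda>j. fst y j + F j)"
      using y(2) h(1) by (intro rho_mult) (auto simp: orbit_vanishing_def)
    then have "(\<lambda>Q\<in>carrier_mat p m. snd y Q * h Q) \<in> orbit_vanishing p m (\<lambda>j. fst y j + F j)"
      using h(1) by (simp add: orbit_vanishing_def) (simp add: lift_def)
    moreover have "(\<lambda>j. fst y j + F j) \<in> young m"
      using y(1) h(2) by (auto simp: young_def antimono_def intro: add_mono)
    ultimately show ?thesis unfolding I_O_generate by (intro generate.incl) blast
  qed
  have "set K \<subseteq> set L \<Longrightarrow> (\<lambda>Q\<in>carrier_mat p m. (\<Sum>y\<leftarrow>K. snd y Q) * h Q) \<in> I_O p m" for K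
  proof (induction K)
    case Nil
    show ?case using zero_in_I_O by (simp only: U_inv_alg_simps list.map sum_list.Nil mult_zero_left)
  next
    case (Cons y K)
    have "(\<lambda>Q\<in>carrier_mat p m. snd y Q * h Q) \<oplus>\<^bsub>U_inv_alg p m\<^esub> (\<lambda>Q\<in>carrier_mat p m. (\<Sum>y\<leftarrow>K. snd y Q) * h Q) \<in> I_O p m"
      using subgroup.m_closed[OF subgroup_I_O one[of y] Cons.IH] Cons.prems by simp
    moreover have "(\<lambda>Q\<in>carrier_mat p m. snd y Q * h Q) \<oplus>\<^bsub>U_inv_alg p m\<^esub> (\<lambda>Q\<in>carrier_mat p m. (\<Sum>y\<leftarrow>K. snd y Q) * h Q) =
        (\<lambda>Q\<in>carrier_mat p m. (\<Sum>y\<leftarrow>y # K. snd y Q) * h Q)"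
      by (simp add: restrict_eq_iff distrib_right)
    ultimately show ?case by (simp only:)
  qed
  from this[OF order_refl]
  have "(\<lambda>Q\<in>carrier_mat p m. (\<Sum>y\<leftarrow>L. snd y Q) * h Q) \<in> I_O p m" .
  moreover have "(\<lambda>Q\<in>carrier_mat p m. (\<Sum>y\<leftarrow>L. snd y Q) * h Q) = (\<lambda>Q\<in>carrier_mat p m. f Q * h Q)"
    using L(2) by (intro restrict_ext) simp
  ultimately show ?thesis by (simp only:)
qed

lemma U_inv_mult_commute: "f \<otimes>\<^bsub>U_inv_alg p m\<^esub> g = g \<otimes>\<^bsub>U_inv_alg p m\<^esub> f"
  by (simp add: restrict_eq_iff mult.commute)

lemma ideal_I_O: "ideal (I_O p m) (U_inv_alg p m)"
proof -
  interpret ring "U_inv_alg p m" by (rule ring_U_inv_alg)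
  have closed: "x \<otimes>\<^bsub>U_inv_alg p m\<^esub> a \<in> I_O p m" if a: "a \<in> I_O p m" and x: "x \<in> carrier (U_inv_alg p m)" for a x
  proof -
    have sub: "I_O p m \<subseteq> carrier (U_inv_alg p m)" using subgroup.subset[OF subgroup_I_O] by simp
    from a show ?thesis unfolding I_O_generate
    proof (induction rule: generate.induct)
      case one
      show ?case using zero_in_I_O by (simp only: monoid.simps r_null[OF x] I_O_generate[symmetric])
    next
      case (incl h)
      then show ?case using vanishing_mult_in_I_O[OF _ _ x] unfolding I_O_generate U_inv_alg_simps by blast
    next
      case (inv h)
      have h: "h \<in> carrier (U_inv_alg p m)" using inv vanishing_U_inv by blast
      have "x \<otimes>\<^bsub>U_inv_alg p m\<^esub> h \<in> I_O p m"
        using inv vanishing_mult_in_I_O[OF _ _ x] unfolding U_inv_alg_simps by blast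
      then have "\<ominus>\<^bsub>U_inv_alg p m\<^esub> (x \<otimes>\<^bsub>U_inv_alg p m\<^esub> h) \<in> I_O p m"
        using subgroup.m_inv_closed[OF subgroup_I_O] by (simp only: a_inv_def)
      moreover have "x \<otimes>\<^bsub>U_inv_alg p m\<^esub> (\<ominus>\<^bsub>U_inv_alg p m\<^esub> h) = \<ominus>\<^bsub>U_inv_alg p m\<^esub> (x \<otimes>\<^bsub>U_inv_alg p m\<^esub> h)"
        by (rule r_minus[OF x h])
      ultimately show ?case by (simp only: a_inv_def[symmetric] I_O_generate[symmetric])
    next
      case (eng h1 h2)
      have h: "h1 \<in> carrier (U_inv_alg p m)" "h2 \<in> carrier (U_inv_alg p m)"
        using eng(1,2) sub unfolding I_O_generate by blast+
      have "x \<otimes>\<^bsub>U_inv_alg p m\<^esub> (h1 \<oplus>\<^bsub>U_inv_alg p m\<^esub> h2) =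
          x \<otimes>\<^bsub>U_inv_alg p m\<^esub> h1 \<oplus>\<^bsub>U_inv_alg p m\<^esub> x \<otimes>\<^bsub>U_inv_alg p m\<^esub> h2"
        by (rule r_distr[OF h x])
      then show ?case using generate.eng[OF eng(3,4)] by (simp only: monoid.simps)
    qed
  qed
  show ?thesis
  proof (rule idealI[OF ring_U_inv_alg subgroup_I_O closed])
    fix a x assume "a \<in> I_O p m" "x \<in> carrier (U_inv_alg p m)"
    from closed[OF this] show "a \<otimes>\<^bsub>U_inv_alg p m\<^esub> x \<in> I_O p m"
      by (simp only: U_inv_mult_commute[of a x])
  qed
qed

section \<open>The quotient algebra\<close>

lemma F_SO_simps:
  "carrier (F_SO p m) = carrier (U_inv_alg p m Quot I_O p m)"
  "monoid.mult (F_SO p m) = monoid.mult (U_inv_alg p m Quot I_O p m)"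
  "\<one>\<^bsub>F_SO p m\<^esub> = \<one>\<^bsub>U_inv_alg p m Quot I_O p m\<^esub>"
  "\<zero>\<^bsub>F_SO p m\<^esub> = \<zero>\<^bsub>U_inv_alg p m Quot I_O p m\<^esub>"
  "add (F_SO p m) = add (U_inv_alg p m Quot I_O p m)"
  by (simp_all add: F_SO_def quot_alg_def)

lemma ring_F_SO: "ring (F_SO p m)"
proof -
  interpret Q: ring "U_inv_alg p m Quot I_O p m" by (rule ideal.quotient_is_ring[OF ideal_I_O])
  show ?thesis
  proof (rule ringI)
    show "abelian_group (F_SO p m)"
    proof (rule abelian_groupI)
      fix x assume "x \<in> carrier (F_SO p m)"
      then show "\<exists>y\<in>carrier (F_SO p m). y \<oplus>\<^bsub>F_SO p m\<^esub> x = \<zero>\<^bsub>F_SO p m\<^esub>"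
        unfolding F_SO_simps by (intro bexI[of _ "\<ominus>\<^bsub>U_inv_alg p m Quot I_O p m\<^esub> x"]) (rule Q.l_neg, assumption, rule Q.a_inv_closed)
    qed (unfold F_SO_simps, (rule Q.a_closed Q.zero_closed Q.a_assoc Q.a_comm Q.l_zero; assumption)+)
    show "monoid (F_SO p m)"
      by (rule monoidI; unfold F_SO_simps; (rule Q.m_closed Q.one_closed Q.m_assoc Q.l_one Q.r_one; assumption))
  qed (unfold F_SO_simps, (rule Q.l_distr Q.r_distr; assumption)+)
qed

abbreviation coset :: "(complex mat \<Rightarrow> complex) \<Rightarrow> (complex mat \<Rightarrow> complex) set" where
  "coset f \<equiv> I_O p m +>\<^bsub>U_inv_alg p m\<^esub> f"

lemma coset_hom: "coset \<in> Ring.ring_hom (U_inv_alg p m) (F_SO p m)"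
  using ideal.rcos_ring_hom[OF ideal_I_O]
  unfolding Ring.ring_hom_def F_SO_simps .

text \<open>In \<open>quot_alg\<close> a scalar acts by a union over the coset. All members of the
  union agree, because \<open>c i\<close> is the product of \<open>i\<close> with a constant
  function and so stays in the ideal.\<close>

lemma coset_smult:
  assumes f: "f \<in> carrier (U_inv_alg p m)"
  shows "c \<odot>\<^bsub>F_SO p m\<^esub> coset f = coset (c \<odot>\<^bsub>U_inv_alg p m\<^esub> f)"
proof -
  interpret ring "U_inv_alg p m" by (rule ring_U_inv_alg)
  interpret I: ideal "I_O p m" "U_inv_alg p m" by (rule ideal_I_O)
  have one: "\<one>\<^bsub>U_inv_alg p m\<^esub> \<in> carrier (U_inv_alg p m)" by (rule one_closed)
  have cU: "c \<odot>\<^bsub>U_inv_alg p m\<^esub> h \<in> carrier (U_inv_alg p m)" if h: "h \<in> carrier (U_inv_alg p m)" for h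
  proof -
    have inv: "act p m g1 g2 h = h" if "(g1, g2) \<in> {1\<^sub>m p} \<times> unip m" for g1 g2
      using h that by (auto simp: carrier_U_inv_alg)
    have "act p m (1\<^sub>m p) u (\<lambda>Q\<in>carrier_mat p m. c * h Q) = (\<lambda>Q\<in>carrier_mat p m. c * h Q)" if u: "u \<in> unip m" for u
      using act_restrict_binop[OF one_carrier_mat unip_carrier[OF u], where f = h and g = h and h = "\<lambda>x y. c * x"]
        inv[of "1\<^sub>m p" u] u by simp
    then show ?thesis using h poly_funs_smult[of h p m c] by (auto simp: carrier_U_inv_alg)
  qed
  have same: "coset (c \<odot>\<^bsub>U_inv_alg p m\<^esub> h) = coset (c \<odot>\<^bsub>U_inv_alg p m\<^esub> f)" if h: "h \<in> coset f" for h
  proof -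
    obtain i where i: "i \<in> I_O p m" "h = i \<oplus>\<^bsub>U_inv_alg p m\<^esub> f" using h by (auto simp: a_r_coset_def')
    have ic: "i \<in> carrier (U_inv_alg p m)" by (rule I.Icarr[OF i(1)])
    have ci: "c \<odot>\<^bsub>U_inv_alg p m\<^esub> i \<in> I_O p m"
    proof -
      have "(c \<odot>\<^bsub>U_inv_alg p m\<^esub> \<one>\<^bsub>U_inv_alg p m\<^esub>) \<otimes>\<^bsub>U_inv_alg p m\<^esub> i \<in> I_O p m"
        by (rule I.I_l_closed[OF i(1) cU[OF one]])
      moreover have "(c \<odot>\<^bsub>U_inv_alg p m\<^esub> \<one>\<^bsub>U_inv_alg p m\<^esub>) \<otimes>\<^bsub>U_inv_alg p m\<^esub> i = c \<odot>\<^bsub>U_inv_alg p m\<^esub> i"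
        unfolding U_inv_alg_simps by (rule restrict_ext) simp
      ultimately show ?thesis by (simp only:)
    qed
    have "c \<odot>\<^bsub>U_inv_alg p m\<^esub> h = c \<odot>\<^bsub>U_inv_alg p m\<^esub> i \<oplus>\<^bsub>U_inv_alg p m\<^esub> c \<odot>\<^bsub>U_inv_alg p m\<^esub> f"
      unfolding i(2) U_inv_alg_simps by (rule restrict_ext) (simp add: distrib_left)
    then have "c \<odot>\<^bsub>U_inv_alg p m\<^esub> h \<in> coset (c \<odot>\<^bsub>U_inv_alg p m\<^esub> f)"
      unfolding a_r_coset_def' by (intro UN_I[OF ci]) (simp only: singleton_iff)
    then show ?thesis by (rule I.a_repr_independence'[OF _ cU[OF f], symmetric])
  qed
  have self: "f \<in> coset f"
    by (rule I.a_rcos_self[OF f])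
  have "c \<odot>\<^bsub>F_SO p m\<^esub> coset f = (\<Union>h\<in>coset f. coset (c \<odot>\<^bsub>U_inv_alg p m\<^esub> h))"
    unfolding F_SO_def quot_alg_def by (simp only: module.simps)
  also have "\<dots> = (\<Union>h\<in>coset f. coset (c \<odot>\<^bsub>U_inv_alg p m\<^esub> f))"
    using same by (intro SUP_cong refl)
  also have "\<dots> = coset (c \<odot>\<^bsub>U_inv_alg p m\<^esub> f)" using self by blast
  finally show ?thesis .
qed

end

section \<open>Restriction to the isotropic matrices\<close>

text \<open>The matrix is the exponential of \<open>M\<close>, as \<open>M\<^sup>3 = 0\<close>. The
  adjoint of \<open>M\<close> for the antidiagonal form is \<open>- M\<close>, so the adjoint of the
  exponential is its inverse. The vanishing of single triple products kills all sums of degree at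
  least 3.\<close>

lemma exp_nilpotent_orth:
  fixes M :: "nat \<Rightarrow> nat \<Rightarrow> complex"
  assumes skew: "\<And>i j. i < p \<Longrightarrow> j < p \<Longrightarrow> M (p - 1 - i) j = - M (p - 1 - j) i"
    and nil: "\<And>i r s j. i < p \<Longrightarrow> r < p \<Longrightarrow> s < p \<Longrightarrow> j < p \<Longrightarrow> M i r * M r s * M s j = 0"
  shows "mat p p (\<lambda>(i, j). E_arr i j + M i j + (\<Sum>r<p. M i r * M r j) / 2) \<in> orth_group p" (is "?g \<in> _")
proof -
  define B where "B = (\<lambda>i j. (\<Sum>r<p. M i r * M r j) / 2)"
  define g where "g = (\<lambda>i j. E_arr i j + M i j + B i j)"
  have rev: "(\<Sum>r<p. f (p - 1 - r)) = (\<Sum>r<p. f r)" for f :: "nat \<Rightarrow> complex"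
    using sum.nat_diff_reindex[of f p] by simp
  have Bx: "B i j = (\<Sum>r<p. M i r * M r j) / 2" for i j by (simp add: B_def)
  have MB: "(\<Sum>r<p. M i r * B r j) = 0" if "i < p" "j < p" for i j
  proof (rule sum.neutral, intro ballI)
    fix r assume "r \<in> {..<p}"
    then have "(\<Sum>s<p. M i r * M r s * M s j) = 0" using nil that by (intro sum.neutral) auto
    then show "M i r * B r j = 0" unfolding Bx by (simp add: sum_distrib_left mult.assoc flip: sum_distrib_left)
  qed
  have BM: "(\<Sum>r<p. B i r * M r j) = 0" if "i < p" "j < p" for i j
  proof (rule sum.neutral, intro ballI)
    fix r assume "r \<in> {..<p}"
    then have "(\<Sum>s<p. M i s * M s r * M r j) = 0" using nil that by (intro sum.neutral) auto
    then show "B i r * M r j = 0" unfolding Bx by (simp flip: sum_distrib_right)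
  qed
  have BB: "(\<Sum>r<p. B i r * B r j) = 0" if "i < p" "j < p" for i j
  proof -
    have "B i r * B r j = (\<Sum>s<p. B i r * M r s * M s j / 2)" for r
      unfolding Bx[of r j] by (simp add: sum_distrib_left sum_divide_distrib mult.assoc)
    then have "(\<Sum>r<p. B i r * B r j) = (\<Sum>r<p. \<Sum>s<p. B i r * M r s * M s j / 2)" by (simp only:)
    also have "\<dots> = (\<Sum>s<p. \<Sum>r<p. B i r * M r s * M s j / 2)" by (rule sum.swap)
    also have "\<dots> = (\<Sum>s<p. (\<Sum>r<p. B i r * M r s) * M s j / 2)"
      by (simp only: sum_distrib_right sum_divide_distrib)
    also have "\<dots> = 0" using BM that by simp
    finally show ?thesis .
  qed
  have skewr: "M (p - 1 - r) i = - M (p - 1 - i) r" if "r < p" "i < p" for r i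
    using skew[OF that] .
  have Bsym: "B (p - 1 - j) i = B (p - 1 - i) j" if "i < p" "j < p" for i j
  proof -
    have "(\<Sum>r<p. M (p - 1 - j) r * M r i) = (\<Sum>r<p. M (p - 1 - j) (p - 1 - r) * M (p - 1 - r) i)"
      by (rule rev[symmetric])
    also have "\<dots> = (\<Sum>r<p. M (p - 1 - i) r * M r j)"
    proof (rule sum.cong)
      fix r assume "r \<in> {..<p}"
      then have r: "r < p" by simp
      have "M (p - 1 - j) (p - 1 - r) = - M (p - 1 - (p - 1 - r)) j"
        using skew[of j "p - 1 - r"] that r by simp
      also have "p - 1 - (p - 1 - r) = r" using r by simp
      finally show "M (p - 1 - j) (p - 1 - r) * M (p - 1 - r) i = M (p - 1 - i) r * M r j"
        using skew[OF r that(1)] by simp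
    qed simp
    finally show ?thesis by (simp add: B_def)
  qed
  have form: "(\<Sum>r<p. g (p - 1 - r) i * g r j) = (if i + j + 1 = p then 1 else 0)" if ij: "i < p" "j < p" for i j
  proof -
    let ?i = "p - 1 - i"
    have Er: "E_arr (p - 1 - r) i = E_arr r ?i" if "r < p" for r using that ij by (auto simp: E_arr_def)
    have E1: "(\<Sum>r<p. E_arr r a * f r) = f a" if "a < p" for a and f :: "nat \<Rightarrow> complex"
    proof -
      have "(\<Sum>r<p. E_arr r a * f r) = (\<Sum>r<p. if r = a then f r else 0)"
        by (rule sum.cong) (auto simp: E_arr_def)
      then show ?thesis using that by simp
    qed
    have Brev: "B (p - 1 - r) i = B ?i r" if "r < p" for r using Bsym[OF ij(1) that] .
    \<comment> \<open>Reversing the row index turns the first factor into row \<open>?i\<close> of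
      \<open>1 - M + M\<^sup>2 / 2\<close>, the exponential of \<open>- M\<close>.\<close>
    have "(\<Sum>r<p. g (p - 1 - r) i * g r j) = (\<Sum>r<p. (E_arr r ?i - M ?i r + B ?i r) * (E_arr r j + M r j + B r j))"
    proof (rule sum.cong)
      fix r assume "r \<in> {..<p}"
      then have r: "r < p" by simp
      show "g (p - 1 - r) i * g r j = (E_arr r ?i - M ?i r + B ?i r) * (E_arr r j + M r j + B r j)"
        unfolding g_def Er[OF r] skewr[OF r ij(1)] Brev[OF r] by (simp only: diff_conv_add_uminus)
    qed simp
    also have "\<dots> = (\<Sum>r<p. E_arr r ?i * (E_arr r j + M r j + B r j)) + (\<Sum>r<p. E_arr r j * (B ?i r - M ?i r))
        - (\<Sum>r<p. M ?i r * M r j) - (\<Sum>r<p. M ?i r * B r j) + (\<Sum>r<p. B ?i r * M r j) + (\<Sum>r<p. B ?i r * B r j)"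
      unfolding sum.distrib[symmetric] sum_subtractf[symmetric] by (rule sum.cong) (simp_all add: algebra_simps)
    also have "(\<Sum>r<p. M ?i r * M r j) = 2 * B ?i j" by (simp add: B_def)
    also have "(\<Sum>r<p. E_arr r ?i * (E_arr r j + M r j + B r j)) = E_arr ?i j + M ?i j + B ?i j"
      by (rule E1) (use ij in simp)
    also have "(\<Sum>r<p. E_arr r j * (B ?i r - M ?i r)) = B ?i j - M ?i j" by (rule E1[OF ij(2)])
    finally have "(\<Sum>r<p. g (p - 1 - r) i * g r j) = E_arr ?i j" using MB[of ?i j] BM[of ?i j] BB[of ?i j] ij by simp
    then show ?thesis using ij by (auto simp: E_arr_def)
  qed
  have gm: "?g = mat p p (\<lambda>(i, j). g i j)" by (simp add: g_def B_def)
  let ?J = "antidiag p" and ?G = "mat p p (\<lambda>(i, j). g i j)"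
  have "(transpose_mat ?G * ?J * ?G) $$ (i, j) = ?J $$ (i, j)" if ij: "i < p" "j < p" for i j
  proof -
    have tJ: "transpose_mat ?G * ?J \<in> carrier_mat p p" by (rule square_mult) auto
    have "(transpose_mat ?G * ?J * ?G) $$ (i, j) = (\<Sum>r<p. (transpose_mat ?G * ?J) $$ (i, r) * ?G $$ (r, j))"
      by (rule mult_mat_entry[OF tJ _ ij]) simp
    also have "\<dots> = (\<Sum>r<p. g (p - 1 - r) i * g r j)"
    proof (rule sum.cong)
      fix r assume "r \<in> {..<p}"
      then have r: "r < p" by simp
      have "(transpose_mat ?G * ?J) $$ (i, r) = (\<Sum>s<p. transpose_mat ?G $$ (i, s) * ?J $$ (s, r))"
        by (rule mult_mat_entry[OF _ _ ij(1) r]) auto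
      also have "\<dots> = (\<Sum>s<p. if s = p - 1 - r then g s i else 0)"
        by (rule sum.cong) (use ij r in \<open>auto simp: antidiag_def\<close>)
      finally show "(transpose_mat ?G * ?J) $$ (i, r) * ?G $$ (r, j) = g (p - 1 - r) i * g r j"
        using r ij by simp
    qed simp
    also have "\<dots> = ?J $$ (i, j)" using form[OF ij] ij by (simp add: antidiag_def)
    finally show ?thesis .
  qed
  then have "transpose_mat ?G * ?J * ?G = ?J"
  proof (intro eq_matI)
    show "dim_row (transpose_mat ?G * ?J * ?G) = dim_row ?J" "dim_col (transpose_mat ?G * ?J * ?G) = dim_col ?J"
      by simp_all
  qed (simp only: antidiag_dim)
  then show ?thesis unfolding gm orth_group_def by simp
qed

text \<open>\<open>M\<close> carries \<open>W\<close> in the middle rows of the first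
  \<open>k\<close> columns, and skewness forces a mirror image in the last \<open>k\<close> rows of
  the middle columns. Then \<open>M\<^sup>2\<close> is supported in the last \<open>k\<close> rows
  and the first \<open>k\<close> columns, so \<open>M\<^sup>3 = 0\<close>. In the first
  \<open>k\<close> columns the rows above \<open>p - n\<close> therefore show only the unit matrix
  and \<open>W\<close>.\<close>

lemma orth_with_prescribed_block:
  fixes W :: "nat \<Rightarrow> nat \<Rightarrow> complex"
  assumes "k \<le> n" "2 * n \<le> p"
  obtains g where "g \<in> orth_group p" "\<And>i j. i < n \<Longrightarrow> j < k \<Longrightarrow> arr g i j = E_arr i j"
    "\<And>i j. n \<le> i \<Longrightarrow> i < p - n \<Longrightarrow> j < k \<Longrightarrow> arr g i j = W i j"
proof -
  define M where "M = (\<lambda>a b. if n \<le> a \<and> a < p - n \<and> b < k then W a b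
    else if p - k \<le> a \<and> a < p \<and> n \<le> b \<and> b < p - n then - W (p - 1 - b) (p - 1 - a) else 0)"
  have skew: "M (p - 1 - i) j = - M (p - 1 - j) i" if "i < p" "j < p" for i j
    using that assms by (auto simp: M_def)
  have two: "M i r * M r s = 0 \<or> (p - k \<le> i \<and> s < k)" if "i < p" "r < p" "s < p" for i r s
    using that assms by (auto simp: M_def)
  have M0: "M s j = 0" if "s < k" for s j using that assms by (auto simp: M_def)
  have nil: "M i r * M r s * M s j = 0" if "i < p" "r < p" "s < p" "j < p" for i r s j
    using two[OF that(1-3)] M0[of s j] by auto
  let ?g = "mat p p (\<lambda>(i, j). E_arr i j + M i j + (\<Sum>r<p. M i r * M r j) / 2)"
  have low: "(\<Sum>r<p. M i r * M r j) = 0" if "i < p - n" for i j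
  proof (rule sum.neutral, intro ballI)
    fix r assume "r \<in> {..<p}"
    then show "M i r * M r j = 0" using that assms by (auto simp: M_def)
  qed
  have in_orth: "?g \<in> orth_group p" using skew nil by (rule exp_nilpotent_orth)
  show thesis
  proof (rule that[OF in_orth])
    show "arr ?g i j = E_arr i j" if "i < n" "j < k" for i j
      using that assms low[of i j] by (auto simp: arr_def M_def)
    show "arr ?g i j = W i j" if "n \<le> i" "i < p - n" "j < k" for i j
      using that assms low[of i j] by (auto simp: arr_def M_def E_arr_def)
  qed
qed

lemma B_GL_in_U_inv:
  assumes "f \<in> carrier (B_GL p q k)" "q \<le> p" shows "f \<in> carrier (U_inv_alg p k)"
  using assms(1) one_unip[of q] GL_embed_one[OF assms(2)] by (force simp: carrier_B_GL carrier_U_inv_alg)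

text \<open>The weight components keep the row invariance, so each of them is a combination of
  products of minors with good rows.\<close>

lemma B_GL_spanned:
  assumes f: "f \<in> carrier (B_GL p q k)" and "k \<le> q" "q \<le> p"
  shows "\<exists>zs. (\<forall>z\<in>set zs. \<forall>R\<in>set (snd z). good_row q p R \<and> length R \<le> k) \<and>
    (\<forall>Q\<in>carrier_mat p k. f Q = (\<Sum>z\<leftarrow>zs. fst z * mprod (snd z) (arr Q)))"
proof -
  have fU: "f \<in> carrier (U_inv_alg p k)" by (rule B_GL_in_U_inv[OF f assms(3)])
  have row: "row_inv q (lift p k f)" by (rule B_GL_props(3)[OF f assms(3)])
  obtain L where L: "\<forall>y\<in>set L. fst y \<in> young k \<and> snd y \<in> rho p k (fst y) \<and>
      (\<forall>q. row_inv q (lift p k f) \<longrightarrow> row_inv q (lift p k (snd y)))"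
    "\<forall>Q\<in>carrier_mat p k. f Q = (\<Sum>y\<leftarrow>L. snd y Q)"
    using weight_decomposition[OF fU] by (elim exE conjE)
  have one: "\<exists>zs. (\<forall>z\<in>set zs. \<forall>R\<in>set (snd z). good_row q p R \<and> length R \<le> k) \<and>
      (\<forall>Q\<in>carrier_mat p k. snd y Q = (\<Sum>z\<leftarrow>zs. fst z * mprod (snd z) (arr Q)))" if "y \<in> set L" for y
  proof -
    have y: "snd y \<in> carrier (U_inv_alg p k)" "col_weight k (fst y) (lift p k (snd y))" "row_inv q (lift p k (snd y))"
      using L(1) that row by (auto simp: rho_iff)
    have "minor_span q p k (fst y) (lift p k (snd y))"
      using polyfn_lift[OF U_inv_poly[OF y(1)]] U_inv_col_inv[OF y(1)] y(2,3) assms(2,3)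
      by (intro minor_span_invariant) auto
    then obtain zs where zs: "\<forall>z\<in>set zs. (\<forall>R\<in>set (snd z). good_row q p R \<and> length R \<le> k) \<and>
       (\<forall>j<k. rlen (snd z) j = fst y j)" "\<forall>x. lift p k (snd y) x = (\<Sum>z\<leftarrow>zs. fst z * mprod (snd z) x)"
      unfolding minor_span_def by (elim exE conjE)
    have "snd y Q = (\<Sum>z\<leftarrow>zs. fst z * mprod (snd z) (arr Q))" if "Q \<in> carrier_mat p k" for Q
      using zs(2)[rule_format, of "arr Q"] by (simp add: lift_arr that)
    then show ?thesis using zs(1) by (intro exI[of _ zs]) auto
  qed
  have "set K \<subseteq> set L \<Longrightarrow> \<exists>zs. (\<forall>z\<in>set zs. \<forall>R\<in>set (snd z). good_row q p R \<and> length R \<le> k) \<and>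
      (\<forall>Q\<in>carrier_mat p k. (\<Sum>y\<leftarrow>K. snd y Q) = (\<Sum>z\<leftarrow>zs. fst z * mprod (snd z) (arr Q)))" for K
  proof (induction K)
    case Nil
    show ?case by (rule exI[of _ "[]"]) simp
  next
    case (Cons y K)
    then obtain us where us: "\<forall>z\<in>set us. \<forall>R\<in>set (snd z). good_row q p R \<and> length R \<le> k"
      "\<forall>Q\<in>carrier_mat p k. (\<Sum>y\<leftarrow>K. snd y Q) = (\<Sum>z\<leftarrow>us. fst z * mprod (snd z) (arr Q))" by auto
    obtain vs where vs: "\<forall>z\<in>set vs. \<forall>R\<in>set (snd z). good_row q p R \<and> length R \<le> k"
      "\<forall>Q\<in>carrier_mat p k. snd y Q = (\<Sum>z\<leftarrow>vs. fst z * mprod (snd z) (arr Q))"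
      using one[of y] Cons.prems by auto
    show ?case by (rule exI[of _ "vs @ us"]) (use us vs in auto)
  qed
  from this[OF order_refl] show ?thesis using L(2) by auto
qed

section \<open>Comparison with the branching algebra\<close>

text \<open>From \<open>q\<close> on, row \<open>i\<close> stands for the chain element
  \<open>i + 1\<close> and is filled with the row chosen by \<open>psi\<close>; below
  \<open>k\<close> it stands for \<open>chain_u (i + 1)\<close>, whose row is \<open>i\<close>
  itself. A good list of length at most \<open>k\<close> meets no row from \<open>k\<close> to
  \<open>q - 1\<close>; the zeros there match the normal form of
  \<open>eq_zero_diagonal\<close>.\<close>

definition pull :: "nat \<Rightarrow> nat \<Rightarrow> nat \<Rightarrow> (nat \<Rightarrow> nat \<Rightarrow> complex) \<Rightarrow> nat \<Rightarrow> nat \<Rightarrow> complex" where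
  "pull p q k x = (\<lambda>i j. if i < k then x i j else if i < q then 0 else x (psi p (Suc i) - 1) j)"

text \<open>The inequalities treat both parities of \<open>p\<close> and \<open>q\<close> at
  once.\<close>

locale branching =
  fixes m n p q k :: nat
  assumes nm: "n < m" and p: "2 * m \<le> p" "p \<le> 2 * m + 1" and q: "2 * n \<le> q" "q \<le> 2 * n + 1"
    and kn: "k \<le> n"
begin

lemma bounds: "k \<le> q" "q \<le> p" "m \<le> p" "k \<le> m" "2 * n < p"
  using nm p q kn by auto

text \<open>The chain elements after the first \<open>q\<close> go to the rows in which
  \<open>orth_with_prescribed_block\<close> can prescribe arbitrary entries.\<close>

lemma psi_middle:
  assumes "q \<le> i" "i < p" shows "n \<le> psi p (Suc i) - 1" "psi p (Suc i) - 1 < p - n"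
proof -
  have "n \<le> psi p (Suc i) - 1 \<and> psi p (Suc i) - 1 < p - n"
  proof (cases "even (Suc i)")
    case True
    then obtain c where "Suc i = 2 * c" by (elim evenE)
    then show ?thesis using assms q bounds(5) True by (auto simp: psi_def)
  next
    case False
    then obtain c where "Suc i = 2 * c + 1" by (elim oddE)
    then show ?thesis using assms q bounds(5) False by (auto simp: psi_def)
  qed
  then show "n \<le> psi p (Suc i) - 1" "psi p (Suc i) - 1 < p - n" by auto
qed

lemma inj_psi: "inj_on (\<lambda>i. psi p (Suc i) - 1) {q..<p}"
proof (rule inj_onI)
  fix i i' assume "i \<in> {q..<p}" "i' \<in> {q..<p}" and eq: "psi p (Suc i) - 1 = psi p (Suc i') - 1"
  then have i: "i < p" "i' < p" by auto
  show "i = i'"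
  proof (cases "even (Suc i)")
    case True
    then obtain c where c: "Suc i = 2 * c" by (elim evenE)
    show ?thesis
    proof (cases "even (Suc i')")
      case True
      then obtain d where "Suc i' = 2 * d" by (elim evenE)
      then show ?thesis using eq c i by (simp add: psi_def)
    next
      case False
      then obtain d where "Suc i' = 2 * d + 1" by (elim oddE)
      then show ?thesis using eq c i by (simp add: psi_def)
    qed
  next
    case False
    then obtain c where c: "Suc i = 2 * c + 1" by (elim oddE)
    show ?thesis
    proof (cases "even (Suc i')")
      case True
      then obtain d where "Suc i' = 2 * d" by (elim evenE)
      then show ?thesis using eq c i by (simp add: psi_def)
    next
      case False
      then obtain d where "Suc i' = 2 * d + 1" by (elim oddE)
      then show ?thesis using eq c i by (simp add: psi_def)
    qed
  qed
qed

definition pullback :: "(complex mat \<Rightarrow> complex) \<Rightarrow> complex mat \<Rightarrow> complex" where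
  "pullback f = (\<lambda>Q\<in>carrier_mat p m. lift p k f (pull p q k (arr Q)))"

lemma polyfn_pull:
  assumes "polyfn p k F" shows "polyfn p m (\<lambda>x. F (pull p q k x))"
proof (rule polyfn_compose[OF assms])
  fix i j assume i: "i < p" and j: "j < k"
  consider "i < k" | "k \<le> i" "i < q" | "k \<le> i" "q \<le> i" by linarith
  then show "polyfn p m (\<lambda>x. pull p q k x i j)"
  proof cases
    case 1
    then show ?thesis using i j bounds by (simp add: pull_def polyfn_coord)
  next
    case 2
    then show ?thesis by (simp add: pull_def polyfn_const)
  next
    case 3
    then show ?thesis using psi_middle(2)[of i] i j bounds by (simp add: pull_def polyfn_coord)
  qed
qed

lemma lift_pullback: "f \<in> poly_funs p k \<Longrightarrow> lift p m (pullback f) x = lift p k f (pull p q k x)"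
  unfolding pullback_def by (rule lift_restrict[OF polyfn_pull[OF polyfn_lift]])

lemma pullback_U_inv:
  assumes f: "f \<in> carrier (B_GL p q k)" shows "pullback f \<in> carrier (U_inv_alg p m)"
proof -
  have fU: "f \<in> carrier (U_inv_alg p k)" by (rule B_GL_in_U_inv[OF f bounds(2)])
  show ?thesis
    unfolding pullback_def
  proof (rule restrict_in_U_inv[OF polyfn_pull[OF polyfn_lift[OF U_inv_poly[OF fU]]]])
    fix u x assume u: "u \<in> unip m"
    define u' where "u' = mat k k (\<lambda>(i, j). u $$ (i, j))"
    have u': "u' \<in> unip k" using u bounds(4) by (auto simp: u'_def unip_iff)
    have "lift p k f (pull p q k (cmul m u x)) = lift p k f (cmul k u' (pull p q k x))"
    proof (rule lift_cong)
      fix i j assume j: "j < k"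
      have "(\<Sum>l<m. y l * u $$ (l, j)) = (\<Sum>l<k. y l * u' $$ (l, j))" for y :: "nat \<Rightarrow> complex"
        by (rule sum.mono_neutral_cong_right) (use u j bounds(4) in \<open>auto simp: u'_def unip_iff\<close>)
      then show "pull p q k (cmul m u x) i j = cmul k u' (pull p q k x) i j"
        by (simp add: pull_def cmul_def)
    qed
    then show "lift p k f (pull p q k (cmul m u x)) = lift p k f (pull p q k x)"
      using U_inv_lift[OF fU u'] by simp
  qed
qed

lemma pullback_binop:
  "pullback (\<lambda>Q\<in>carrier_mat p k. h (f Q) (g Q)) = (\<lambda>Q\<in>carrier_mat p m. h (pullback f Q) (pullback g Q))"
  unfolding pullback_def by (rule restrict_ext) (simp add: lift_def)

text \<open>By elimination it suffices to compare at arrays \<open>x\<close> that are diagonal in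
  the first \<open>q\<close> rows. Such an \<open>x\<close> is the pull of some
  \<open>h E t\<close>: \<open>t\<close> is its diagonal, and its rows from \<open>q\<close> on,
  divided by \<open>t\<close>, are prescribed as the middle block of \<open>h\<close>. As
  \<open>psi\<close> is injective on these rows, the prescription is consistent.\<close>

lemma pullback_injective:
  assumes f: "f \<in> carrier (B_GL p q k)" and g: "g \<in> carrier (B_GL p q k)"
    and eq: "\<And>h t. h \<in> orth_group p \<Longrightarrow> (\<And>j. j < m \<Longrightarrow> t j \<noteq> 0) \<Longrightarrow>
      lift p m (pullback f) (\<lambda>i j. arr h i j * t j) = lift p m (pullback g) (\<lambda>i j. arr h i j * t j)"
  shows "f = g"
proof -
  have poly: "f \<in> poly_funs p k" "g \<in> poly_funs p k" using f g by (auto simp: carrier_B_GL)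
  define H where "H = (\<lambda>x. lift p k f x - lift p k g x)"
  have H: "polyfn p k H" "col_inv k H" "row_inv q H"
    unfolding H_def
    using polyfn_diff[OF B_GL_props(1)[OF f bounds(2)] B_GL_props(1)[OF g bounds(2)]]
      col_inv_diff[OF B_GL_props(2)[OF f bounds(2)] B_GL_props(2)[OF g bounds(2)]]
      row_inv_diff[OF B_GL_props(3)[OF f bounds(2)] B_GL_props(3)[OF g bounds(2)]] by simp_all
  have "H x = 0" for x
  proof (rule eq_zero_diagonal[OF H bounds(1,2)])
    fix x :: "nat \<Rightarrow> nat \<Rightarrow> complex"
    assume x: "\<And>i j. i < q \<Longrightarrow> j < k \<Longrightarrow> i \<noteq> j \<Longrightarrow> x i j = 0" "\<And>j. j < k \<Longrightarrow> x j j \<noteq> 0"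
    \<comment> \<open>The columns from \<open>k\<close> on are not read by \<open>lift p k\<close>;
      the value 1 keeps \<open>t\<close> invertible there.\<close>
    define t where "t = (\<lambda>j. if j < k then x j j else 1)"
    define W where "W = (\<lambda>r j. x (inv_into {q..<p} (\<lambda>i. psi p (Suc i) - 1) r) j / t j)"
    have t: "t j \<noteq> 0" for j using x(2) by (simp add: t_def)
    obtain h where h: "h \<in> orth_group p" "\<And>i j. i < n \<Longrightarrow> j < k \<Longrightarrow> arr h i j = E_arr i j"
      "\<And>i j. n \<le> i \<Longrightarrow> i < p - n \<Longrightarrow> j < k \<Longrightarrow> arr h i j = W i j"
      using orth_with_prescribed_block[OF kn, of p W] bounds(5) by (metis less_imp_le)
    have "pull p q k (\<lambda>i j. arr h i j * t j) i j = x i j" if i: "i < p" and j: "j < k" for i j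
    proof -
      consider "i < k" | "k \<le> i" "i < q" | "k \<le> i" "q \<le> i" by linarith
      then show ?thesis
      proof cases
        case 1
        then have "arr h i j = E_arr i j" using h(2)[of i j] j kn by simp
        then show ?thesis using 1 x(1)[of i j] j bounds(1) by (auto simp: pull_def E_arr_def t_def)
      next
        case 2
        then show ?thesis using x(1)[of i j] j by (simp add: pull_def)
      next
        case 3
        have "inv_into {q..<p} (\<lambda>i. psi p (Suc i) - 1) (psi p (Suc i) - 1) = i"
          using inv_into_f_f[OF inj_psi, of i] 3 i by simp
        then have "arr h (psi p (Suc i) - 1) j = x i j / t j"
          using h(3)[OF psi_middle[of i] j] 3 i by (simp add: W_def)
        then show ?thesis using 3 t by (simp add: pull_def)
      qed
    qed
    then have "H (pull p q k (\<lambda>i j. arr h i j * t j)) = H x" by (rule polyfn_cong[OF H(1)])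
    moreover have "H (pull p q k (\<lambda>i j. arr h i j * t j)) = 0"
      using eq[OF h(1), of t] t by (simp add: H_def lift_pullback poly)
    ultimately show "H x = 0" by simp
  qed
  then have "lift p k f x = lift p k g x" for x by (simp add: H_def)
  then show ?thesis
    using poly_funs_extensional poly lift_arr by (intro ext_eqI[of f p k g]) metis+
qed

lemma delta_eq:
  assumes R: "R = [0..<c] @ Y" "sorted_wrt (<) Y" "set Y \<subseteq> {q..<p}" and ck: "c \<le> k" and len: "length R \<le> k"
  shows "delta p m (chain_u ` {1..c} \<union> Suc ` set Y) = pullback (\<lambda>Q\<in>carrier_mat p k. minor R (arr Q))"
proof -
  let ?I = "chain_u ` {1..c} \<union> Suc ` set Y"
  let ?L = "map chain_u [1..<Suc c] @ map Suc Y"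
  have "sorted_wrt (<) ?L"
  proof -
    have "sorted_wrt (\<lambda>a b. chain_u a < chain_u b) [1..<Suc c]"
      by (rule sorted_wrt_mono_rel[OF _ sorted_wrt_upt]) (auto simp: chain_u_def)
    moreover have "chain_u a < Suc y" if "a \<in> set [1..<Suc c]" "y \<in> set Y" for a y
    proof -
      have "q \<le> y" "a \<le> c" using that R(3) by auto
      then show ?thesis using ck kn q by (simp add: chain_u_def)
    qed
    ultimately show ?thesis using R(2) by (auto simp: sorted_wrt_append sorted_wrt_map)
  qed
  moreover have "set ?L = ?I" by (auto simp: image_iff)
  ultimately have sl: "sorted_list_of_set ?I = ?L"
    by (metis strict_sorted_iff sorted_list_of_set.idem_if_sorted_distinct)
  have "length (sorted_list_of_set ?I) = card ?I" by (rule sorted_list_of_set.length_sorted_key_list_of_set)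
  then have card: "card ?I = length R" unfolding sl by (simp add: R(1) del: upt_Suc)
  have row: "Q $$ (psi p (?L ! j) - 1, l) = pull p q k (arr Q) (R ! j) l" if "j < length R" for Q j l
  proof (cases "j < c")
    case True
    then have "?L ! j = chain_u (Suc j)" "R ! j = j" using R(1) by (auto simp: nth_append simp del: upt_Suc)
    then show ?thesis using psi_u[of "Suc j" p] True ck by (simp add: pull_def arr_def)
  next
    case False
    then have jY: "j - c < length Y" using that R(1) by simp
    have "?L ! j = Suc (Y ! (j - c))" "R ! j = Y ! (j - c)"
      using False jY R(1) by (auto simp: nth_append simp del: upt_Suc)
    moreover have "q \<le> Y ! (j - c)" using nth_mem[OF jY] R(3) by auto
    ultimately show ?thesis using bounds(1) by (simp add: pull_def arr_def)
  qed
  have Rp: "set R \<subseteq> {..<p}" using R ck bounds by auto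
  show ?thesis
    unfolding delta_def pullback_def
  proof (rule restrict_ext)
    fix Q :: "complex mat"
    have "det (mat (card ?I) (card ?I) (\<lambda>(j, l). Q $$ (psi p (sorted_list_of_set ?I ! j) - 1, l))) =
        minor R (pull p q k (arr Q))"
      unfolding minor_def card sl
      by (intro arg_cong[of _ _ det] cong_mat) (simp_all only: prod.case row)
    then show "det (mat (card ?I) (card ?I) (\<lambda>(j, l). Q $$ (psi p (sorted_list_of_set ?I ! j) - 1, l))) =
        lift p k (\<lambda>Q\<in>carrier_mat p k. minor R (arr Q)) (pull p q k (arr Q))"
      by (simp add: lift_restrict[OF polyfn_minor[OF Rp len]])
  qed
qed

lemma smult_B_GL:
  assumes f: "f \<in> carrier (B_GL p q k)" shows "c \<odot>\<^bsub>B_GL p q k\<^esub> f \<in> carrier (B_GL p q k)"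
proof -
  have "act p k (GL_embed p q a) b (\<lambda>Q\<in>carrier_mat p k. c * f Q) = (\<lambda>Q\<in>carrier_mat p k. c * f Q)"
    if a: "a \<in> unip q" and b: "b \<in> unip k" for a b
  proof -
    have "act p k (GL_embed p q a) b f = f" using f a b by (auto simp: carrier_B_GL)
    then show ?thesis
      using act_restrict_binop[OF GL_embed_carrier[OF unip_carrier[OF a] bounds(2)] unip_carrier[OF b],
          where f = f and g = f and h = "\<lambda>x y. c * x"] by simp
  qed
  then show ?thesis using f poly_funs_smult[of f p k c] by (auto simp: carrier_B_GL)
qed

definition to_quotient :: "(complex mat \<Rightarrow> complex) \<Rightarrow> (complex mat \<Rightarrow> complex) set" where
  "to_quotient f = I_O p m +>\<^bsub>U_inv_alg p m\<^esub> pullback f"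

lemma to_quotient_hom: "to_quotient \<in> Ring.ring_hom (B_GL p q k) (F_SO p m)"
proof -
  note hom = coset_hom[OF bounds(3)]
  show ?thesis
  proof (rule ring_hom_memI)
    fix f g assume f: "f \<in> carrier (B_GL p q k)" and g: "g \<in> carrier (B_GL p q k)"
    note U = pullback_U_inv[OF f] pullback_U_inv[OF g]
    show "to_quotient f \<in> carrier (F_SO p m)"
      unfolding to_quotient_def by (rule ring_hom_closed[OF hom U(1)])
    have "pullback (f \<otimes>\<^bsub>B_GL p q k\<^esub> g) = pullback f \<otimes>\<^bsub>U_inv_alg p m\<^esub> pullback g"
      unfolding B_GL_simps U_inv_alg_simps by (rule pullback_binop)
    then show "to_quotient (f \<otimes>\<^bsub>B_GL p q k\<^esub> g) = to_quotient f \<otimes>\<^bsub>F_SO p m\<^esub> to_quotient g"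
      unfolding to_quotient_def by (simp only: ring_hom_mult[OF hom U])
    have "pullback (f \<oplus>\<^bsub>B_GL p q k\<^esub> g) = pullback f \<oplus>\<^bsub>U_inv_alg p m\<^esub> pullback g"
      unfolding B_GL_simps U_inv_alg_simps by (rule pullback_binop)
    then show "to_quotient (f \<oplus>\<^bsub>B_GL p q k\<^esub> g) = to_quotient f \<oplus>\<^bsub>F_SO p m\<^esub> to_quotient g"
      unfolding to_quotient_def by (simp only: ring_hom_add[OF hom U])
  next
    have "pullback \<one>\<^bsub>B_GL p q k\<^esub> = \<one>\<^bsub>U_inv_alg p m\<^esub>"
      by (simp add: pullback_def lift_def)
    then show "to_quotient \<one>\<^bsub>B_GL p q k\<^esub> = \<one>\<^bsub>F_SO p m\<^esub>"
      unfolding to_quotient_def by (simp only: ring_hom_one[OF hom])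
  qed
qed

lemma to_quotient_smult:
  assumes "f \<in> carrier (B_GL p q k)"
  shows "to_quotient (c \<odot>\<^bsub>B_GL p q k\<^esub> f) = c \<odot>\<^bsub>F_SO p m\<^esub> to_quotient f"
proof -
  have "pullback (c \<odot>\<^bsub>B_GL p q k\<^esub> f) = c \<odot>\<^bsub>U_inv_alg p m\<^esub> pullback f"
    unfolding B_GL_simps U_inv_alg_simps by (rule pullback_binop[where h = "\<lambda>x y. c * x" and g = f])
  then show ?thesis
    unfolding to_quotient_def coset_smult[OF bounds(3) pullback_U_inv[OF assms]] by (simp only:)
qed

text \<open>For equal cosets the difference of the pullbacks lies in the ideal, so it vanishes at
  all matrices \<open>h E t\<close>, where distinct elements of \<open>B_GL\<close> have already
  been told apart.\<close>

lemma inj_to_quotient: "inj_on to_quotient (carrier (B_GL p q k))"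
proof (rule inj_onI)
  fix f g assume f: "f \<in> carrier (B_GL p q k)" and g: "g \<in> carrier (B_GL p q k)"
    and eq: "to_quotient f = to_quotient g"
  interpret U: ring "U_inv_alg p m" by (rule ring_U_inv_alg)
  note Uf = pullback_U_inv[OF f] and Ug = pullback_U_inv[OF g]
  let ?d = "pullback f \<ominus>\<^bsub>U_inv_alg p m\<^esub> pullback g"
  have d: "?d \<in> I_O p m"
    using U.quotient_eq_iff_same_a_r_cos[OF ideal_I_O[OF bounds(3)] Uf Ug] eq by (simp only: to_quotient_def)
  have sum: "?d \<oplus>\<^bsub>U_inv_alg p m\<^esub> pullback g = pullback f"
    using Uf Ug by (simp only: a_minus_def U.a_assoc U.a_inv_closed U.l_neg U.r_zero)
  show "f = g"
  proof (rule pullback_injective[OF f g])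
    fix h and t :: "nat \<Rightarrow> complex" assume h: "h \<in> orth_group p" and t: "\<And>j. j < m \<Longrightarrow> t j \<noteq> 0"
    have "lift p m (pullback f) x = lift p m ?d x + lift p m (pullback g) x" for x
      by (subst sum[symmetric]) (simp add: lift_def)
    then show "lift p m (pullback f) (\<lambda>i j. arr h i j * t j) = lift p m (pullback g) (\<lambda>i j. arr h i j * t j)"
      using I_O_vanishes[OF bounds(3) d h t] by simp
  qed
qed

text \<open>A row \<open>y \<ge> q\<close> is the chain element \<open>y + 1 \<ge> q + 1\<close>,
  and \<open>q + 1\<close> is \<open>chain_u (n + 1)\<close> for \<open>q = 2 n\<close> and
  \<open>chain_v (n + 1)\<close> for \<open>q = 2 n + 1\<close>. The initial segment is admissible
  because its length is at most \<open>k \<le> n\<close>.\<close>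

lemma minor_to_generator:
  assumes R: "good_row q p R" "length R \<le> k" "R \<noteq> []"
  shows "to_quotient (\<lambda>Q\<in>carrier_mat p k. minor R (arr Q)) \<in>
    (\<lambda>I. I_O p m +>\<^bsub>U_inv_alg p m\<^esub> delta p m I) ` L_SO p q n k"
proof -
  obtain c Y where Y: "R = [0..<c] @ Y" "c \<le> q" "sorted_wrt (<) Y" "set Y \<subseteq> {q..<p}"
    using R(1) unfolding good_row_def by auto
  have c: "c \<le> k" using Y(1) R(2) by simp
  let ?I = "chain_u ` {1..c} \<union> Suc ` set Y"
  have Yq: "q \<le> y \<and> y < p" if "y \<in> set Y" for y using Y(4) that by auto
  have "card ?I \<le> card (chain_u ` {1..c}) + card (Suc ` set Y)" by (rule card_Un_le)
  also have "\<dots> \<le> c + length Y"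
    using card_image_le[of "{1..c}" chain_u] card_image_le[of "set Y" Suc] card_length[of Y] by simp
  also have "\<dots> \<le> k" using R(2) Y(1) by simp
  finally have "card ?I \<le> k" .
  moreover have "?I \<noteq> {}" using R(3) Y(1) by (cases "c = 0") auto
  moreover have "?I \<subseteq> {1..p}"
    using c kn bounds(5) Yq by (auto simp: chain_u_def Suc_le_eq)
  moreover have "(if q = 2 * n then chain_u (n + 1) else chain_v (n + 1)) \<le> y" if y: "y \<in> Suc ` set Y" for y
  proof -
    obtain x where x: "x \<in> set Y" "y = Suc x" using y by (elim imageE)
    show ?thesis using Yq[OF x(1)] x(2) q by (auto simp: chain_u_def chain_v_def)
  qed
  ultimately have "?I \<in> L_SO p q n k"
    unfolding L_SO_def using c kn by (intro CollectI conjI exI[of _ c] exI[of _ "Suc ` set Y"]) auto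
  then show ?thesis
    unfolding to_quotient_def delta_eq[OF Y(1,3,4) c R(2), symmetric] by (rule imageI)
qed

text \<open>The lower bound on \<open>Y\<close> places it above the initial segment of elements
  \<open>chain_u\<close>, so the union is disjoint and the length of the row list is the cardinality
  of \<open>I\<close>.\<close>

lemma generator_to_minor:
  assumes "I \<in> L_SO p q n k"
  obtains R where "good_row q p R" "length R \<le> k"
    "pullback (\<lambda>Q\<in>carrier_mat p k. minor R (arr Q)) = delta p m I"
proof -
  obtain c Y where I: "I \<subseteq> {1..p}" "card I \<le> k" "c \<le> n" "I = chain_u ` {1..c} \<union> Y"
    and Yb: "\<forall>y\<in>Y. (if q = 2 * n then chain_u (n + 1) else chain_v (n + 1)) \<le> y"
    using assms unfolding L_SO_def by blast
  have Yq: "q < y \<and> y \<le> p" if "y \<in> Y" for y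
    using Yb I(1,4) q that by (auto simp: chain_u_def chain_v_def split: if_splits)
  have fin: "finite Y" using I(1,4) finite_subset[of Y "{1..p}"] by auto
  define Z where "Z = (\<lambda>y. y - 1) ` Y"
  define L where "L = sorted_list_of_set Z"
  have finZ: "finite Z" using fin by (simp add: Z_def)
  have L: "sorted_wrt (<) L" "set L = Z" "length L = card Z"
    using finZ by (simp_all add: L_def strict_sorted_iff)
  have Zq: "Z \<subseteq> {q..<p}" using Yq by (fastforce simp: Z_def)
  have SZ: "Suc ` Z = Y"
  proof -
    have "Suc ` Z = (\<lambda>y. y) ` Y" unfolding Z_def image_image using Yq by (intro image_cong) fastforce+
    then show ?thesis by simp
  qed
  have inj: "inj_on chain_u {1..c}" by (auto simp: inj_on_def chain_u_def)
  have disj: "chain_u ` {1..c} \<inter> Y = {}" using Yq I(3) q by (fastforce simp: chain_u_def)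
  have "card I = c + card Y" unfolding I(4) using fin disj inj by (subst card_Un_disjoint) (auto simp: card_image)
  moreover have "card Y = card Z" using SZ card_image[of Suc Z] by auto
  ultimately have len: "length ([0..<c] @ L) \<le> k" using I(2) L(3) by simp
  then have c: "c \<le> k" by simp
  show thesis
  proof (rule that[of "[0..<c] @ L"])
    show "good_row q p ([0..<c] @ L)"
      unfolding good_row_def using L Zq I(3) q by (intro exI[of _ c] exI[of _ L]) auto
    show "length ([0..<c] @ L) \<le> k" by (rule len)
    show "pullback (\<lambda>Q\<in>carrier_mat p k. minor ([0..<c] @ L) (arr Q)) = delta p m I"
      using delta_eq[of "[0..<c] @ L" c L] L Zq c len SZ I(4) by simp
  qed
qed

text \<open>Write \<open>f\<close> as a combination of products of minors. Each product is mapped to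
  a product of generators, with empty lists giving 1, and \<open>S\<close> is closed under products
  and linear combinations.\<close>

lemma to_quotient_in_subalgebra:
  assumes S: "subring S (F_SO p m)" "\<And>c x. x \<in> S \<Longrightarrow> c \<odot>\<^bsub>F_SO p m\<^esub> x \<in> S"
    and gens: "(\<lambda>I. I_O p m +>\<^bsub>U_inv_alg p m\<^esub> delta p m I) ` L_SO p q n k \<subseteq> S"
    and f: "f \<in> carrier (B_GL p q k)"
  shows "to_quotient f \<in> S"
proof -
  let ?A = "carrier_mat p k"
  interpret B: ring "B_GL p q k" by (rule ring_B_GL[OF bounds(2)])
  interpret F: ring "F_SO p m" by (rule ring_F_SO[OF bounds(3)])
  note hom = to_quotient_hom
  note Sc = subringE[OF S(1)]
  obtain zs where zs: "\<forall>z\<in>set zs. \<forall>R\<in>set (snd z). good_row q p R \<and> length R \<le> k"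
    "\<forall>Q\<in>?A. f Q = (\<Sum>z\<leftarrow>zs. fst z * mprod (snd z) (arr Q))"
    using B_GL_spanned[OF f bounds(1,2)] by (elim exE conjE)
  have prod: "to_quotient (\<lambda>Q\<in>?A. mprod Rs (arr Q)) \<in> S" if "\<forall>R\<in>set Rs. good_row q p R \<and> length R \<le> k" for Rs
    using that
  proof (induction Rs)
    case Nil
    have "to_quotient \<one>\<^bsub>B_GL p q k\<^esub> \<in> S" unfolding ring_hom_one[OF hom] by (rule Sc(3))
    then show ?case by (simp only: B_GL_simps mprod_simps)
  next
    case (Cons R Rs)
    have mem: "(\<lambda>Q\<in>?A. mprod Ts (arr Q)) \<in> carrier (B_GL p q k)" if "set Ts \<subseteq> set (R # Rs)" for Ts
      by (rule mprod_in_B_GL[OF _ bounds(2)]) (use Cons.prems that in blast)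
    show ?case
    proof (cases "R = []")
      case True
      have "to_quotient (\<lambda>Q\<in>?A. mprod Rs (arr Q)) \<in> S"
        by (rule Cons.IH) (use Cons.prems in simp)
      then show ?thesis by (simp only: True mprod_simps minor_Nil mult_1)
    next
      case False
      have "(\<lambda>Q\<in>?A. mprod (R # Rs) (arr Q)) = (\<lambda>Q\<in>?A. mprod [R] (arr Q)) \<otimes>\<^bsub>B_GL p q k\<^esub> (\<lambda>Q\<in>?A. mprod Rs (arr Q))"
        unfolding B_GL_simps by (rule restrict_ext) simp
      moreover have "to_quotient ((\<lambda>Q\<in>?A. mprod [R] (arr Q)) \<otimes>\<^bsub>B_GL p q k\<^esub> (\<lambda>Q\<in>?A. mprod Rs (arr Q))) =
          to_quotient (\<lambda>Q\<in>?A. mprod [R] (arr Q)) \<otimes>\<^bsub>F_SO p m\<^esub> to_quotient (\<lambda>Q\<in>?A. mprod Rs (arr Q))"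
        by (rule ring_hom_mult[OF hom]) (rule mem; auto)+
      moreover have "to_quotient (\<lambda>Q\<in>?A. mprod [R] (arr Q)) \<in> S"
        using minor_to_generator[of R] Cons.prems False gens by auto
      moreover have "to_quotient (\<lambda>Q\<in>?A. mprod Rs (arr Q)) \<in> S"
        by (rule Cons.IH) (use Cons.prems in simp)
      ultimately show ?thesis by (simp only: Sc(6))
    qed
  qed
  have "to_quotient (\<lambda>Q\<in>?A. \<Sum>z\<leftarrow>vs. fst z * mprod (snd z) (arr Q)) \<in> S \<and>
      (\<lambda>Q\<in>?A. \<Sum>z\<leftarrow>vs. fst z * mprod (snd z) (arr Q)) \<in> carrier (B_GL p q k)" if "set vs \<subseteq> set zs" for vs
    using that
  proof (induction vs)
    case Nil
    have "to_quotient \<zero>\<^bsub>B_GL p q k\<^esub> = \<zero>\<^bsub>F_SO p m\<^esub>"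
      by (rule ring_hom_zero[OF hom B.ring_axioms F.ring_axioms])
    then have "to_quotient \<zero>\<^bsub>B_GL p q k\<^esub> \<in> S" using Sc(2) by simp
    then show ?case using B.zero_closed by (simp only: B_GL_simps list.map sum_list.Nil simp_thms)
  next
    case (Cons z vs)
    let ?g = "\<lambda>Q\<in>?A. mprod (snd z) (arr Q)" and ?h = "\<lambda>Q\<in>?A. \<Sum>z\<leftarrow>vs. fst z * mprod (snd z) (arr Q)"
    have z: "\<forall>R\<in>set (snd z). good_row q p R \<and> length R \<le> k" using Cons.prems zs(1) by auto
    have g: "?g \<in> carrier (B_GL p q k)" by (rule mprod_in_B_GL[OF _ bounds(2)]) (use z in blast)
    have cg: "fst z \<odot>\<^bsub>B_GL p q k\<^esub> ?g \<in> carrier (B_GL p q k)" by (rule smult_B_GL[OF g])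
    have vs: "set vs \<subseteq> set zs" using Cons.prems by simp
    note hS = Cons.IH[OF vs, THEN conjunct1] and h = Cons.IH[OF vs, THEN conjunct2]
    have "fst z \<odot>\<^bsub>B_GL p q k\<^esub> ?g \<oplus>\<^bsub>B_GL p q k\<^esub> ?h = (\<lambda>Q\<in>?A. \<Sum>z\<leftarrow>z # vs. fst z * mprod (snd z) (arr Q))"
      unfolding B_GL_simps by (rule restrict_ext) simp
    moreover have "to_quotient (fst z \<odot>\<^bsub>B_GL p q k\<^esub> ?g \<oplus>\<^bsub>B_GL p q k\<^esub> ?h) \<in> S"
      unfolding ring_hom_add[OF hom cg h] to_quotient_smult[OF g]
      by (rule Sc(7)[OF S(2)[OF prod[OF z]] hS])
    moreover have "fst z \<odot>\<^bsub>B_GL p q k\<^esub> ?g \<oplus>\<^bsub>B_GL p q k\<^esub> ?h \<in> carrier (B_GL p q k)"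
      by (rule B.a_closed[OF cg h])
    ultimately show ?case by (simp only: simp_thms)
  qed
  from this[OF order_refl] have "to_quotient (\<lambda>Q\<in>?A. \<Sum>z\<leftarrow>zs. fst z * mprod (snd z) (arr Q)) \<in> S" ..
  moreover have "(\<lambda>Q\<in>?A. \<Sum>z\<leftarrow>zs. fst z * mprod (snd z) (arr Q)) = f"
    using zs(2) poly_funs_extensional[of f p k] f by (intro ext_eqI[of _ p k]) (auto simp: carrier_B_GL)
  ultimately show ?thesis by (simp only:)
qed

text \<open>The image is itself a subalgebra containing the generators; conversely every such
  subalgebra contains the images of the products of minors, which span.\<close>

lemma generated_subalg_eq:
  "generated_subalg (F_SO p m) ((\<lambda>I. I_O p m +>\<^bsub>U_inv_alg p m\<^esub> delta p m I) ` L_SO p q n k) =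
    to_quotient ` carrier (B_GL p q k)"
  unfolding generated_subalg_def
proof
  interpret B: ring "B_GL p q k" by (rule ring_B_GL[OF bounds(2)])
  interpret F: ring "F_SO p m" by (rule ring_F_SO[OF bounds(3)])
  interpret H: ring_hom_ring "B_GL p q k" "F_SO p m" to_quotient
    by (rule ring_hom_ringI2[OF B.ring_axioms F.ring_axioms to_quotient_hom])
  show "(\<lambda>S. subring S (F_SO p m) \<and> (\<forall>c. \<forall>x\<in>S. c \<odot>\<^bsub>F_SO p m\<^esub> x \<in> S)) hull
      ((\<lambda>I. I_O p m +>\<^bsub>U_inv_alg p m\<^esub> delta p m I) ` L_SO p q n k) \<subseteq> to_quotient ` carrier (B_GL p q k)"
  proof (rule hull_minimal)
    show "(\<lambda>I. I_O p m +>\<^bsub>U_inv_alg p m\<^esub> delta p m I) ` L_SO p q n k \<subseteq> to_quotient ` carrier (B_GL p q k)"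
    proof
      fix x assume "x \<in> (\<lambda>I. I_O p m +>\<^bsub>U_inv_alg p m\<^esub> delta p m I) ` L_SO p q n k"
      then obtain I where I: "I \<in> L_SO p q n k" "x = I_O p m +>\<^bsub>U_inv_alg p m\<^esub> delta p m I" by blast
      obtain R where R: "good_row q p R" "length R \<le> k"
        "pullback (\<lambda>Q\<in>carrier_mat p k. minor R (arr Q)) = delta p m I" by (rule generator_to_minor[OF I(1)])
      have "(\<lambda>Q\<in>carrier_mat p k. minor R (arr Q)) \<in> carrier (B_GL p q k)"
        using mprod_in_B_GL[of "[R]" q p k] R(1,2) bounds(2) by simp
      moreover have "x = to_quotient (\<lambda>Q\<in>carrier_mat p k. minor R (arr Q))"
        by (simp only: I(2) to_quotient_def R(3))
      ultimately show "x \<in> to_quotient ` carrier (B_GL p q k)" by blast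
    qed
    have smult: "c \<odot>\<^bsub>F_SO p m\<^esub> x \<in> to_quotient ` carrier (B_GL p q k)"
      if x: "x \<in> to_quotient ` carrier (B_GL p q k)" for c x
    proof -
      obtain f where f: "f \<in> carrier (B_GL p q k)" "x = to_quotient f" using x by (elim imageE)
      show ?thesis unfolding f(2) to_quotient_smult[OF f(1), symmetric] by (rule imageI[OF smult_B_GL[OF f(1)]])
    qed
    show "subring (to_quotient ` carrier (B_GL p q k)) (F_SO p m) \<and>
        (\<forall>c. \<forall>x\<in>to_quotient ` carrier (B_GL p q k). c \<odot>\<^bsub>F_SO p m\<^esub> x \<in> to_quotient ` carrier (B_GL p q k))"
      by (rule conjI[OF H.img_is_subring[OF B.carrier_is_subring]]) (intro allI ballI smult)
  qed
  show "to_quotient ` carrier (B_GL p q k) \<subseteq> (\<lambda>S. subring S (F_SO p m) \<and> (\<forall>c. \<forall>x\<in>S. c \<odot>\<^bsub>F_SO p m\<^esub> x \<in> S)) hull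
      ((\<lambda>I. I_O p m +>\<^bsub>U_inv_alg p m\<^esub> delta p m I) ` L_SO p q n k)"
    unfolding hull_def
  proof (intro subsetI InterI)
    fix y S assume y: "y \<in> to_quotient ` carrier (B_GL p q k)"
      and S: "S \<in> {S. (subring S (F_SO p m) \<and> (\<forall>c. \<forall>x\<in>S. c \<odot>\<^bsub>F_SO p m\<^esub> x \<in> S)) \<and>
        (\<lambda>I. I_O p m +>\<^bsub>U_inv_alg p m\<^esub> delta p m I) ` L_SO p q n k \<subseteq> S}"
    note S' = CollectD[OF S]
    note gens = S'[THEN conjunct2] and sub = S'[THEN conjunct1, THEN conjunct1]
      and closed = S'[THEN conjunct1, THEN conjunct2]
    from y obtain f where f: "f \<in> carrier (B_GL p q k)" and yf: "y = to_quotient f" by (rule imageE)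
    show "y \<in> S"
      unfolding yf by (rule to_quotient_in_subalgebra[OF sub closed[rule_format] gens f])
  qed
qed

text \<open>\<open>to_quotient\<close> maps \<open>B_GL\<close> onto \<open>B_SO\<close>, so the
  isomorphism asked for is its inverse, and the compatibility with scalars is transported along the
  bijection.\<close>

lemma B_SO_isomorphic: "alg_isomorphic (B_SO p m q n k) (B_GL p q k)"
proof -
  let ?C = "carrier (B_GL p q k)"
  interpret B: ring "B_GL p q k" by (rule ring_B_GL[OF bounds(2)])
  have carr: "carrier (B_SO p m q n k) = to_quotient ` ?C"
    unfolding B_SO_def generated_subalg_eq by simp
  have ops: "monoid.mult (B_SO p m q n k) = monoid.mult (F_SO p m)" "add (B_SO p m q n k) = add (F_SO p m)"
    "\<one>\<^bsub>B_SO p m q n k\<^esub> = \<one>\<^bsub>F_SO p m\<^esub>" "module.smult (B_SO p m q n k) = module.smult (F_SO p m)"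
    by (simp_all add: B_SO_def)
  have "to_quotient \<in> Ring.ring_hom (B_GL p q k) (B_SO p m q n k)"
  proof (rule ring_hom_memI)
    fix f g assume f: "f \<in> ?C" and g: "g \<in> ?C"
    show "to_quotient f \<in> carrier (B_SO p m q n k)" unfolding carr by (rule imageI[OF f])
    show "to_quotient (f \<otimes>\<^bsub>B_GL p q k\<^esub> g) = to_quotient f \<otimes>\<^bsub>B_SO p m q n k\<^esub> to_quotient g"
      unfolding ops by (rule ring_hom_mult[OF to_quotient_hom f g])
    show "to_quotient (f \<oplus>\<^bsub>B_GL p q k\<^esub> g) = to_quotient f \<oplus>\<^bsub>B_SO p m q n k\<^esub> to_quotient g"
      unfolding ops by (rule ring_hom_add[OF to_quotient_hom f g])
  next
    show "to_quotient \<one>\<^bsub>B_GL p q k\<^esub> = \<one>\<^bsub>B_SO p m q n k\<^esub>"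
      unfolding ops by (rule ring_hom_one[OF to_quotient_hom])
  qed
  moreover have "bij_betw to_quotient ?C (carrier (B_SO p m q n k))"
    unfolding carr by (rule inj_on_imp_bij_betw[OF inj_to_quotient])
  ultimately have "to_quotient \<in> ring_iso (B_GL p q k) (B_SO p m q n k)"
    unfolding ring_iso_def by (intro CollectI conjI)
  then have inv: "inv_into ?C to_quotient \<in> ring_iso (B_SO p m q n k) (B_GL p q k)"
    by (rule ring_iso_set_sym[OF B.ring_axioms])
  have "inv_into ?C to_quotient (c \<odot>\<^bsub>B_SO p m q n k\<^esub> x) = c \<odot>\<^bsub>B_GL p q k\<^esub> inv_into ?C to_quotient x"
    if x: "x \<in> carrier (B_SO p m q n k)" for c x
  proof -
    obtain f where f: "f \<in> ?C" "x = to_quotient f" using x unfolding carr by (elim imageE)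
    show ?thesis unfolding ops f(2) to_quotient_smult[OF f(1), symmetric]
        inv_into_f_f[OF inj_to_quotient f(1)] inv_into_f_f[OF inj_to_quotient smult_B_GL[OF f(1)]] ..
  qed
  then show ?thesis unfolding alg_isomorphic_def by (intro bexI[OF _ inv] ballI allI)
qed

end

theorem proposition5p10p2:
  fixes m n p q k :: nat
  assumes "n \<ge> 2" and "m > n"
    and "p \<in> {2 * m, 2 * m + 1}"
    and "q \<in> {2 * n, 2 * n + 1}"
    and "k = (if q = 2 * n + 1 then n else n - 1)"
  shows "alg_isomorphic (B_SO p m q n k) (B_GL p q k)"
proof -
  interpret branching m n p q k
    by unfold_locales (use assms in auto)
  show ?thesis by (rule B_SO_isomorphic)
qed

end
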